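(* There exists a randomized committing policy, computable in polynomial time, whose expected utility is at least $0.582\cdot\mathrm{OPT}(\mathbb I)$ for every instance $\mathbb I$ of matroid-max-PBOI.
   Context: Pandora's Box with Optional Inspection (PBOI), maximization. There are $n$ boxes; box $i$ is $\mathcal B_i=(\mathcal D_i,c_i)$ with independent nonnegative value $X_i\sim\mathcal D_i$ (finite support), mean $\mu_i$, and opening cost $c_i\ge0$. Each box is a costly information MDP with two actions from the closed state: "open" (cost $c_i$, leading to a terminal state of value $X_i$) and "grab" (cost $0$, leading to a terminal state of value $\mu_i$). Matroid-max-PBOI: given a matroid on $[n]$ with independent sets $\mathcal F$, a policy adaptively opens/grabs boxes and accepts boxes from terminal states, keeping the accepted set independent; it may stop at any time. Its utility is the sum of accepted terminal values minus opening costs paid; $\mathrm{OPT}(\mathbb I)$ is the maximum expected utility. A committing policy fixes in advance (possibly at random, independently of realized values) for each box whether it will be opened or grabbed, and then acts adaptively on the restricted instance. *)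

theory Defs
  imports
    "HOL-Probability.Probability"
    "HOL-Computational_Algebra.Polynomial"
    "HOL-Library.Log_Nat"
begin

section \<open>Instances\<close>

definition matroid :: "'a set \<Rightarrow> 'a set set \<Rightarrow> bool" where
  "matroid E F \<longleftrightarrow>
     finite E \<and> F \<subseteq> Pow E \<and> {} \<in> F \<and>
     (\<forall>A\<in>F. \<forall>B. B \<subseteq> A \<longrightarrow> B \<in> F) \<and>
     (\<forall>A\<in>F. \<forall>B\<in>F. card A < card B \<longrightarrow> (\<exists>x\<in>B - A. insert x A \<in> F))"

record box =
  value_dist :: "real pmf"
  cost :: real

text \<open>Boxes are numbered from 0.\<close>

record pboi =
  boxes :: "box list"
  indep :: "nat set set"

definition mean :: "box \<Rightarrow> real" where
  "mean B = measure_pmf.expectation (value_dist B) (\<lambda>x. x)"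

definition pboi_instance :: "pboi \<Rightarrow> bool" where
  "pboi_instance I \<longleftrightarrow>
     matroid {..<length (boxes I)} (indep I) \<and>
     (\<forall>B\<in>set (boxes I). finite (set_pmf (value_dist B)) \<and> (\<forall>x\<in>set_pmf (value_dist B). 0 \<le> x) \<and> 0 \<le> cost B)"


section \<open>Policies\<close>

datatype action = Open nat | Grab nat | Accept nat | Stop

datatype event = Opened nat real | Grabbed nat | Accepted nat

type_synonym history = "event list"

type_synonym policy = "history \<Rightarrow> action"

text \<open>Boxes in a terminal state, reached by either action.\<close>

definition inspected :: "history \<Rightarrow> nat set" where
  "inspected h = {i. (\<exists>x. Opened i x \<in> set h) \<or> Grabbed i \<in> set h}"

definition accepted :: "history \<Rightarrow> nat set" where
  "accepted h = {i. Accepted i \<in> set h}"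

fun legal :: "pboi \<Rightarrow> history \<Rightarrow> action \<Rightarrow> bool" where
  "legal I h (Open i) \<longleftrightarrow> i < length (boxes I) \<and> i \<notin> inspected h"
| "legal I h (Grab i) \<longleftrightarrow> i < length (boxes I) \<and> i \<notin> inspected h"
| "legal I h (Accept i) \<longleftrightarrow>
     i \<in> inspected h \<and> i \<notin> accepted h \<and> insert i (accepted h) \<in> indep I"
| "legal I h Stop \<longleftrightarrow> True"

text \<open>
  The history after at most \<open>k\<close> further steps. The value of a box is drawn when the box is opened;
  as a box is opened at most once, this amounts to drawing all values independently in advance.
\<close>

primrec run :: "pboi \<Rightarrow> policy \<Rightarrow> nat \<Rightarrow> history \<Rightarrow> history pmf" where
  "run I p 0 h = return_pmf h"
| "run I p (Suc k) h =
     (case p h of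
        Open i \<Rightarrow> bind_pmf (value_dist (boxes I ! i)) (\<lambda>x. run I p k (h @ [Opened i x]))
      | Grab i \<Rightarrow> run I p k (h @ [Grabbed i])
      | Accept i \<Rightarrow> run I p k (h @ [Accepted i])
      | Stop \<Rightarrow> return_pmf h)"

definition reachable :: "pboi \<Rightarrow> policy \<Rightarrow> history set" where
  "reachable I p = (\<Union>k. set_pmf (run I p k []))"

definition is_policy :: "pboi \<Rightarrow> policy \<Rightarrow> bool" where
  "is_policy I p \<longleftrightarrow> (\<forall>h\<in>reachable I p. legal I h (p h))"

definition terminal_value :: "pboi \<Rightarrow> history \<Rightarrow> nat \<Rightarrow> real" where
  "terminal_value I h i =
     (if Grabbed i \<in> set h then mean (boxes I ! i) else (THE x. Opened i x \<in> set h))"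

definition opened :: "history \<Rightarrow> nat set" where
  "opened h = {i. \<exists>x. Opened i x \<in> set h}"

definition utility :: "pboi \<Rightarrow> history \<Rightarrow> real" where
  "utility I h =
     (\<Sum>i\<in>accepted h. terminal_value I h i) - (\<Sum>i\<in>opened h. cost (boxes I ! i))"

text \<open>
  A legal policy opens or grabs each box at most once and accepts it at most once, so every run has
  ended after \<open>2 n\<close> steps, where \<open>n\<close> is the number of boxes.
\<close>

definition expected_utility :: "pboi \<Rightarrow> policy \<Rightarrow> real" where
  "expected_utility I p =
     measure_pmf.expectation (run I p (2 * length (boxes I)) []) (utility I)"

text \<open>A randomized policy is a random choice, made before any value is drawn, of a policy.\<close>

definition rand_utility :: "pboi \<Rightarrow> policy pmf \<Rightarrow> real" where
  "rand_utility I P = measure_pmf.expectation P (expected_utility I)"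

definition OPT :: "pboi \<Rightarrow> real" where
  "OPT I = (SUP P\<in>{P. \<forall>p\<in>set_pmf P. is_policy I p}. rand_utility I P)"

text \<open>
  A commitment is given by the set \<open>C\<close> of boxes that will be opened rather than grabbed. A
  policy for the restricted instance opens only boxes in \<open>C\<close> and grabs only boxes outside \<open>C\<close>.
\<close>

definition adheres :: "pboi \<Rightarrow> nat set \<Rightarrow> policy \<Rightarrow> bool" where
  "adheres I C p \<longleftrightarrow>
     (\<forall>h\<in>reachable I p. \<forall>i. (p h = Open i \<longrightarrow> i \<in> C) \<and> (p h = Grab i \<longrightarrow> i \<notin> C))"

definition committing_policy :: "pboi \<Rightarrow> (nat set \<times> policy) pmf \<Rightarrow> bool" where
  "committing_policy I P \<longleftrightarrow>
     (\<forall>(C, p)\<in>set_pmf P. C \<subseteq> {..<length (boxes I)} \<and> is_policy I p \<and> adheres I C p)"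


section \<open>A machine model\<close>

text \<open>
  While programs over nested pairs of rational numbers, which can query membership in a set
  system. Every evaluation of an expression is charged the total bit size of all intermediate
  values (logarithmic cost), so that running times agree, up to a polynomial, with those of Turing
  machines with the same queries.
\<close>

datatype val = Num rat | Node val val

fun val_size :: "val \<Rightarrow> nat" where
  "val_size (Num q) =
     1 + nat (bitlen \<bar>fst (quotient_of q)\<bar>) + nat (bitlen (snd (quotient_of q)))"
| "val_size (Node v w) = 1 + val_size v + val_size w"

datatype arith_op = Plus | Minus | Times | Divide | Less

datatype expr =
    Var nat
  | Const val
  | Cons_of expr expr
  | Fst_of expr
  | Snd_of expr
  | Is_node expr
  | Floor_of expr
  | Arith arith_op expr expr

fun num_of :: "val \<Rightarrow> rat" where
  "num_of (Num q) = q"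
| "num_of (Node v w) = 0"

fun left_of :: "val \<Rightarrow> val" where
  "left_of (Node v w) = v"
| "left_of (Num q) = Num 0"

fun right_of :: "val \<Rightarrow> val" where
  "right_of (Node v w) = w"
| "right_of (Num q) = Num 0"

fun val_of_bool :: "bool \<Rightarrow> val" where
  "val_of_bool True = Num 1"
| "val_of_bool False = Num 0"

fun arith_val :: "arith_op \<Rightarrow> rat \<Rightarrow> rat \<Rightarrow> val" where
  "arith_val Plus a b = Num (a + b)"
| "arith_val Minus a b = Num (a - b)"
| "arith_val Times a b = Num (a * b)"
| "arith_val Divide a b = Num (a / b)"
| "arith_val Less a b = val_of_bool (a < b)"

type_synonym store = "nat \<Rightarrow> val"

fun eval_expr :: "store \<Rightarrow> expr \<Rightarrow> val" where
  "eval_expr s (Var x) = s x"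
| "eval_expr s (Const v) = v"
| "eval_expr s (Cons_of a b) = Node (eval_expr s a) (eval_expr s b)"
| "eval_expr s (Fst_of a) = left_of (eval_expr s a)"
| "eval_expr s (Snd_of a) = right_of (eval_expr s a)"
| "eval_expr s (Is_node a) = val_of_bool (\<exists>v w. eval_expr s a = Node v w)"
| "eval_expr s (Floor_of a) = Num (of_int \<lfloor>num_of (eval_expr s a)\<rfloor>)"
| "eval_expr s (Arith f a b) = arith_val f (num_of (eval_expr s a)) (num_of (eval_expr s b))"

fun expr_cost :: "store \<Rightarrow> expr \<Rightarrow> nat" where
  "expr_cost s (Var x) = val_size (s x)"
| "expr_cost s (Const v) = val_size v"
| "expr_cost s (Cons_of a b) = expr_cost s a + expr_cost s b + val_size (eval_expr s (Cons_of a b))"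
| "expr_cost s (Fst_of a) = expr_cost s a + val_size (eval_expr s (Fst_of a))"
| "expr_cost s (Snd_of a) = expr_cost s a + val_size (eval_expr s (Snd_of a))"
| "expr_cost s (Is_node a) = expr_cost s a + val_size (eval_expr s (Is_node a))"
| "expr_cost s (Floor_of a) = expr_cost s a + val_size (eval_expr s (Floor_of a))"
| "expr_cost s (Arith f a b) = expr_cost s a + expr_cost s b + val_size (eval_expr s (Arith f a b))"

datatype com =
    Assign nat expr
  | Query nat expr
  | Seq com com
  | Cond expr com com
  | While expr com

fun val_of_list :: "val list \<Rightarrow> val" where
  "val_of_list [] = Num 0"
| "val_of_list (v # vs) = Node v (val_of_list vs)"

definition val_of_nat :: "nat \<Rightarrow> val" where
  "val_of_nat i = Num (of_nat i)"

definition answer :: "nat set set \<Rightarrow> val \<Rightarrow> val" where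
  "answer F v = val_of_bool (\<exists>is. v = val_of_list (map val_of_nat is) \<and> set is \<in> F)"

text \<open>\<open>exec F c s t s'\<close>: with queries answered from \<open>F\<close>, program \<open>c\<close> leads from \<open>s\<close> to \<open>s'\<close> in time \<open>t\<close>.\<close>

inductive exec :: "nat set set \<Rightarrow> com \<Rightarrow> store \<Rightarrow> nat \<Rightarrow> store \<Rightarrow> bool" for F where
  exec_Assign: "exec F (Assign x a) s (1 + expr_cost s a) (s(x := eval_expr s a))"
| exec_Query: "exec F (Query x a) s (1 + expr_cost s a) (s(x := answer F (eval_expr s a)))"
| exec_Seq: "exec F c s t s' \<Longrightarrow> exec F d s' u s'' \<Longrightarrow> exec F (Seq c d) s (t + u) s''"
| exec_CondT: "eval_expr s a \<noteq> Num 0 \<Longrightarrow> exec F c s t s' \<Longrightarrow>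
    exec F (Cond a c d) s (1 + expr_cost s a + t) s'"
| exec_CondF: "eval_expr s a = Num 0 \<Longrightarrow> exec F d s t s' \<Longrightarrow>
    exec F (Cond a c d) s (1 + expr_cost s a + t) s'"
| exec_WhileT: "eval_expr s a \<noteq> Num 0 \<Longrightarrow> exec F c s t s' \<Longrightarrow> exec F (While a c) s' u s'' \<Longrightarrow>
    exec F (While a c) s (1 + expr_cost s a + t + u) s''"
| exec_WhileF: "eval_expr s a = Num 0 \<Longrightarrow> exec F (While a c) s (1 + expr_cost s a) s"

definition computes_within :: "nat set set \<Rightarrow> com \<Rightarrow> nat \<Rightarrow> val \<Rightarrow> val \<Rightarrow> bool" where
  "computes_within F c t v w \<longleftrightarrow>
     (\<exists>t' s. t' \<le> t \<and> exec F c ((\<lambda>_. Num 0)(0 := v)) t' s \<and> s 0 = w)"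


section \<open>Polynomial-time policies\<close>

text \<open>
  The numerical part of an instance with rational data is written out in full, a distribution being
  the list of its values in increasing order with their probabilities. The matroid is accessible
  only through independence queries.
\<close>

definition rational_instance :: "pboi \<Rightarrow> bool" where
  "rational_instance I \<longleftrightarrow>
     (\<forall>B\<in>set (boxes I). cost B \<in> \<rat> \<and> set_pmf (value_dist B) \<subseteq> \<rat> \<and> range (pmf (value_dist B)) \<subseteq> \<rat>)"

definition val_of_real :: "real \<Rightarrow> val" where
  "val_of_real x = Num (THE q. of_rat q = x)"

definition val_of_box :: "box \<Rightarrow> val" where
  "val_of_box B =
     Node (val_of_real (cost B))
       (val_of_list (map (\<lambda>x. Node (val_of_real x) (val_of_real (pmf (value_dist B) x)))
         (sorted_list_of_set (set_pmf (value_dist B)))))"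

definition val_of_pboi :: "pboi \<Rightarrow> val" where
  "val_of_pboi I = val_of_list (map val_of_box (boxes I))"

fun val_of_event :: "event \<Rightarrow> val" where
  "val_of_event (Opened i x) = Node (Num 0) (Node (val_of_nat i) (val_of_real x))"
| "val_of_event (Grabbed i) = Node (Num 1) (val_of_nat i)"
| "val_of_event (Accepted i) = Node (Num 2) (val_of_nat i)"

fun val_of_action :: "action \<Rightarrow> val" where
  "val_of_action (Open i) = Node (Num 0) (val_of_nat i)"
| "val_of_action (Grab i) = Node (Num 1) (val_of_nat i)"
| "val_of_action (Accept i) = Node (Num 2) (val_of_nat i)"
| "val_of_action Stop = Num 3"

definition val_of_bits :: "bool list \<Rightarrow> val" where
  "val_of_bits bs = val_of_list (map val_of_bool bs)"

definition val_of_commitment :: "pboi \<Rightarrow> nat set \<Rightarrow> val" where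
  "val_of_commitment I C = val_of_bits (map (\<lambda>i. i \<in> C) [0..<length (boxes I)])"

text \<open>
  On a rational instance the randomness is a polynomially long string of fair coin flips. Given the
  instance and the coin flips, one program computes the commitment; a second one, given also the
  history so far, computes the next action. As there are at most \<open>2 n\<close> steps, the whole
  execution of the policy takes polynomial time, in the worst case over coin flips and values.
\<close>

definition polytime_policy :: "(pboi \<Rightarrow> (nat set \<times> policy) pmf) \<Rightarrow> bool" where
  "polytime_policy R \<longleftrightarrow>
     (\<exists>commit_prog act_prog. \<exists>len time :: nat poly. \<forall>I. pboi_instance I \<and> rational_instance I \<longrightarrow>
       (let V = val_of_pboi I; N = val_size V; Seeds = {r :: bool list. length r = poly len N} in
        \<exists>C p. R I = map_pmf (\<lambda>r. (C r, p r)) (pmf_of_set Seeds) \<and>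
          (\<forall>r\<in>Seeds.
             computes_within (indep I) commit_prog (poly time N)
               (Node V (val_of_bits r)) (val_of_commitment I (C r)) \<and>
             (\<forall>h\<in>reachable I (p r).
                computes_within (indep I) act_prog (poly time N)
                  (Node V (Node (val_of_bits r) (val_of_list (map val_of_event h))))
                  (val_of_action (p r h))))))"

end

theory Submission imports Defs begin

text \<open>
  For a single box with outside option \<open>y\<close>, the optimal utility is \<open>E max W y\<close> for a surrogate value
  \<open>W = max a (min X b)\<close>, where grabbing is optimal for \<open>y \<le> a\<close> and opening for \<open>a \<le> y \<le> b\<close>. As a
  function of a single weight, the maximum weight of an independent set has the form
  \<open>P + max w y\<close>, so replacing the boxes one after the other bounds \<open>OPT\<close> by the expected maximum
  weight of an independent set under independent surrogate values. The commitment of box \<open>i\<close> is its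
  locally optimal action against the exchange price \<open>y\<close> that a fresh sample of the surrogate values of
  the other boxes sets for it. Accepting every box against its own price would, in expectation, collect
  the whole upper bound, with marginals in the matroid polytope; by the correlation gap of the weighted
  rank function, the boxes restricted to their commitments have expected maximum weight at
  least \<open>1 - (1 + 1 / m) ^ - m\<close> of it, for every \<open>m\<close> (here \<open>m = 5\<close> gives \<open>0.598\<close>). Once all boxes
  are committed, advancing the box of highest index attains this expected maximum weight exactly.

  A fresh sample is drawn from coin flips by inverting the distribution function at a random dyadic
  number, which multiplies each probability by at least \<open>1 - 2 ^ (N - k)\<close> for \<open>k\<close> flips per sample
  and input size \<open>N\<close>. The price comparison is a single span test, so the commitment is
  computed by maximal independent sets alone. Running times come from closure properties of
  the polynomial-time functions on values.
\<close>

section \<open>Closure of polynomial-time computability over nested pairs, with independence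
  queries\<close>

section \<open>Polynomial-time functions on values\<close>

text \<open>The obstacle is adaptivity: an unrestricted policy may open or grab a box depending on
  values already seen, so its decisions are correlated with the values and with each other. Giving
  each box its own sample of the others makes the decisions independent of each other and of the
  realised values, while the contribution of a box keeps the marginal law it has when all prices
  come from one common sample. That common-sample vector is supported on an independent set, and
  only the passage from it to the product law costs a constant factor. The factor is obtained in
  \<open>m\<close> discrete rounds instead of from a differential equation, so everything stays a
  finite sum. \<open>m = 5\<close> is the smallest number of rounds whose factor still exceeds 0.582
  after the loss of 1/64 granted to sampling. Sampling errors are tracked multiplicatively, since an
  additive error could not be compared with an optimum of unknown scale. The coin-flip sampler is
  built for rational data; other instances use the exact distributions.\<close>

definition poly_bounded :: "(nat \<Rightarrow> nat) \<Rightarrow> bool" where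
  "poly_bounded g \<longleftrightarrow> (\<exists>k. \<forall>x\<ge>2. g x \<le> x ^ k)"

lemma poly_bounded_const: "poly_bounded (\<lambda>x. c)"
  unfolding poly_bounded_def
proof (intro exI[of _ c] allI impI)
  fix x :: nat assume "2 \<le> x"
  then have "2 ^ c \<le> x ^ c" by (rule power_mono) simp
  moreover have "c < 2 ^ c" by simp
  ultimately show "c \<le> x ^ c" by linarith
qed

lemma poly_bounded_id: "poly_bounded (\<lambda>x. x)"
  unfolding poly_bounded_def by (intro exI[of _ 1]) simp

lemma poly_bounded_mult:
  assumes "poly_bounded f" "poly_bounded g"
  shows "poly_bounded (\<lambda>x. f x * g x)"
proof -
  obtain i j where "\<forall>x\<ge>2. f x \<le> x ^ i" "\<forall>x\<ge>2. g x \<le> x ^ j"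
    using assms unfolding poly_bounded_def by blast
  then have "\<forall>x\<ge>2. f x * g x \<le> x ^ (i + j)"
    by (simp add: power_add mult_mono)
  then show ?thesis unfolding poly_bounded_def by blast
qed

lemma poly_bounded_add:
  assumes "poly_bounded f" "poly_bounded g"
  shows "poly_bounded (\<lambda>x. f x + g x)"
proof -
  obtain i j where i: "\<forall>x\<ge>2. f x \<le> x ^ i" and j: "\<forall>x\<ge>2. g x \<le> x ^ j"
    using assms unfolding poly_bounded_def by blast
  have "f x + g x \<le> x ^ Suc (max i j)" if x: "2 \<le> x" for x :: nat
  proof -
    have "f x \<le> x ^ max i j" "g x \<le> x ^ max i j"
      using i j x by (meson le_trans max.cobounded1 max.cobounded2 power_increasing
          order_trans[of 1 2 x] one_le_numeral)+
    then have "f x + g x \<le> 2 * x ^ max i j" by simp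
    also have "\<dots> \<le> x * x ^ max i j" using x by (rule mult_right_mono) simp
    finally show ?thesis by simp
  qed
  then show ?thesis unfolding poly_bounded_def by blast
qed

lemma poly_bounded_power:
  assumes "poly_bounded f"
  shows "poly_bounded (\<lambda>x. f x ^ k)"
  by (induction k) (simp_all add: poly_bounded_const poly_bounded_mult assms)

lemma poly_bounded_Suc: "poly_bounded f \<Longrightarrow> poly_bounded (\<lambda>x. Suc (f x))"
  using poly_bounded_add[OF poly_bounded_const[of 1]] by simp

lemmas poly_bounded_intros =
  poly_bounded_const poly_bounded_id poly_bounded_mult poly_bounded_add poly_bounded_power
  poly_bounded_Suc

text \<open>The reason why polynomial bounds are required only from 2 on: there a single power
  \<open>x ^ k\<close> absorbs constants, sums and products, so one exponent can carry a whole time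
  bound.\<close>

lemma val_size_ge_2: "2 \<le> val_size v"
proof (induction v)
  case (Num q)
  have "0 < snd (quotient_of q)" by (rule quotient_of_denom_pos')
  then have "bitlen (snd (quotient_of q)) > 0" 
    by (metis bitlen_eq_zero_iff bitlen_nonneg linorder_not_less order_less_le)
  then show ?case by simp
qed simp

text \<open>
  Programs implementing a function work relative to a base register, so that they can be composed
  without cleaning up: they need nothing of the registers above the base and keep those below it.
\<close>

definition implements :: "nat \<Rightarrow> com \<Rightarrow> (nat set set \<Rightarrow> val \<Rightarrow> val) \<Rightarrow> nat \<Rightarrow> bool" where
  "implements b c f k \<longleftrightarrow> (\<forall>F s. \<exists>t s'. exec F c s t s' \<and> t \<le> val_size (s b) ^ k \<and>
     s' b = f F (s b) \<and> (\<forall>j<b. s' j = s j))"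

text \<open>The exponent is fixed before the base register, so a program moved to higher registers
  keeps its bound. The output size is bounded alongside the time, which makes the running time of a
  second program polynomial in the input of the first.\<close>

definition ptime :: "(nat set set \<Rightarrow> val \<Rightarrow> val) \<Rightarrow> bool" where
  "ptime f \<longleftrightarrow> (\<exists>k. (\<forall>F v. val_size (f F v) \<le> val_size v ^ k) \<and> (\<forall>b. \<exists>c. implements b c f k))"

lemma ptimeI:
  assumes "poly_bounded g" and "poly_bounded h"
    and size: "\<And>F v. val_size (f F v) \<le> g (val_size v)"
    and prog: "\<And>b. \<exists>c. \<forall>F s. \<exists>t s'. exec F c s t s' \<and> t \<le> h (val_size (s b)) \<and>
       s' b = f F (s b) \<and> (\<forall>j<b. s' j = s j)"
  shows "ptime f"
proof -
  obtain k where k: "\<forall>x\<ge>2. g x + h x \<le> x ^ k"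
    using poly_bounded_add[OF assms(1,2)] unfolding poly_bounded_def by blast
  have gk: "g (val_size v) + h (val_size v) \<le> val_size v ^ k" for v
    using k val_size_ge_2 by blast
  show ?thesis unfolding ptime_def implements_def
  proof (intro exI[of _ k] conjI allI)
    show "val_size (f F v) \<le> val_size v ^ k" for F v
      using size[of F v] gk[of v] by linarith
    fix b
    obtain c where c: "\<And>F s. \<exists>t s'. exec F c s t s' \<and> t \<le> h (val_size (s b)) \<and>
       s' b = f F (s b) \<and> (\<forall>j<b. s' j = s j)" using prog by blast
    show "\<exists>c. \<forall>F s. \<exists>t s'. exec F c s t s' \<and> t \<le> val_size (s b) ^ k \<and>
       s' b = f F (s b) \<and> (\<forall>j<b. s' j = s j)"
    proof (intro exI[of _ c] allI)
      fix F s
      obtain t s' where "exec F c s t s'" "t \<le> h (val_size (s b))" 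
       "s' b = f F (s b)" "\<forall>j<b. s' j = s j" using c by blast
      moreover have "h (val_size (s b)) \<le> val_size (s b) ^ k" using gk[of "s b"] by linarith
      ultimately show "\<exists>t s'. exec F c s t s' \<and> t \<le> val_size (s b) ^ k \<and>
       s' b = f F (s b) \<and> (\<forall>j<b. s' j = s j)" using le_trans by blast
    qed
  qed
qed

lemma ptimeE:
  assumes "ptime f"
  obtains k where "\<And>F v. val_size (f F v) \<le> val_size v ^ k"
    and "\<And>b. \<exists>c. implements b c f k"
  using assms unfolding ptime_def by blast

lemma implementsD:
  assumes "implements b c f k"
  shows "\<exists>t s'. exec F c s t s' \<and> t \<le> val_size (s b) ^ k \<and> s' b = f F (s b) \<and>
    (\<forall>j<b. s' j = s j)"
  using assms unfolding implements_def by blast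

lemma exec_witness:
  assumes "exec F c s t s'" "t \<le> T" "s' b = v" "\<And>j. j < b \<Longrightarrow> s' j = s j"
  shows "\<exists>t s'. exec F c s t s' \<and> t \<le> T \<and> s' b = v \<and> (\<forall>j<b. s' j = s j)"
  using assms by blast

subsection \<open>Composition\<close>

lemma ptime_comp:
  assumes f: "ptime f" and g: "ptime g"
  shows "ptime (\<lambda>F v. f F (g F v))"
proof -
  obtain kf where f1: "\<And>F v. val_size (f F v) \<le> val_size v ^ kf" and f2: "\<And>b. \<exists>c. implements b c f kf"
    using f by (elim ptimeE) blast
  obtain kg where g1: "\<And>F v. val_size (g F v) \<le> val_size v ^ kg" and g2: "\<And>b. \<exists>c. implements b c g kg"
    using g by (elim ptimeE) blast
  have le: "val_size (g F v) ^ kf \<le> (val_size v ^ kg) ^ kf" for F v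
    by (rule power_mono[OF g1]) simp
  show ?thesis
  proof (rule ptimeI[where g="\<lambda>x. (x ^ kg) ^ kf" and h="\<lambda>x. x ^ kg + (x ^ kg) ^ kf"])
    show "val_size (f F (g F v)) \<le> (val_size v ^ kg) ^ kf" for F v
      using f1[of F "g F v"] le[of F v] by linarith
    fix b
    obtain cf cg where cf: "implements b cf f kf" and cg: "implements b cg g kg" using f2 g2 by blast
    show "\<exists>c. \<forall>F s. \<exists>t s'. exec F c s t s' \<and>
           t \<le> val_size (s b) ^ kg + (val_size (s b) ^ kg) ^ kf \<and> s' b = f F (g F (s b)) \<and> (\<forall>j<b. s' j = s j)"
    proof (intro exI[of _ "Seq cg cf"] allI)
      fix F s
      obtain t1 s1 where 1: "exec F cg s t1 s1" "t1 \<le> val_size (s b) ^ kg" "s1 b = g F (s b)"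
        "\<And>j. j < b \<Longrightarrow> s1 j = s j" using implementsD[OF cg, of F "s"] by blast
      obtain t2 s2 where 2: "exec F cf s1 t2 s2" "t2 \<le> val_size (s1 b) ^ kf" "s2 b = f F (s1 b)"
        "\<And>j. j < b \<Longrightarrow> s2 j = s1 j" using implementsD[OF cf, of F "s1"] by blast
      show "\<exists>t s'. exec F (Seq cg cf) s t s' \<and>
           t \<le> val_size (s b) ^ kg + (val_size (s b) ^ kg) ^ kf \<and> s' b = f F (g F (s b)) \<and> (\<forall>j<b. s' j = s j)"
      proof (intro exI conjI)
        show "exec F (Seq cg cf) s (t1 + t2) s2" by (rule exec_Seq[OF 1(1) 2(1)])
        show "t1 + t2 \<le> val_size (s b) ^ kg + (val_size (s b) ^ kg) ^ kf"
          using 1(2) 2(2) 1(3) le[of F "s b"] by simp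
      qed (use 1 2 in auto)
    qed
  qed (intro poly_bounded_intros)+
qed

lemma ptime_assign:
  assumes "poly_bounded g"
    and "\<And>s b. expr_cost s (e b) \<le> g (val_size (s b))" and "\<And>s b. eval_expr s (e b) = f (s b)"
    and "\<And>v. val_size (f v) \<le> g (val_size v)"
  shows "ptime (\<lambda>F v. f v)"
proof (rule ptimeI[where g=g and h="\<lambda>x. 1 + g x"])
  show "\<exists>c. \<forall>F s. \<exists>t s'. exec F c s t s' \<and>
           t \<le> 1 + g (val_size (s b)) \<and> s' b = f (s b) \<and> (\<forall>j<b. s' j = s j)" for b
  proof (intro exI[of _ "Assign b (e b)"] allI)
    fix F s
    show "\<exists>t s'. exec F (Assign b (e b)) s t s' \<and>
           t \<le> 1 + g (val_size (s b)) \<and> s' b = f (s b) \<and> (\<forall>j<b. s' j = s j)"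
      using exec_Assign[of F b "e b" s] assms(2)[of s b] assms(3)[of s b]
      by (intro exI[of _ "1 + expr_cost s (e b)"] exI[of _ "s(b := f (s b))"]) simp
  qed
qed (use assms in \<open>auto intro!: poly_bounded_intros\<close>)

lemma ptime_id: "ptime (\<lambda>F v. v)"
  by (rule ptime_assign[where g="\<lambda>x. x" and e="\<lambda>b. Var b"]) (auto intro: poly_bounded_intros)

lemma ptime_const: "ptime (\<lambda>F v. w)"
  by (rule ptime_assign[where g="\<lambda>x. val_size w" and e="\<lambda>b. Const w"]) (auto intro: poly_bounded_intros)

lemma val_size_0: "val_size (Num 0) = 2"
  by (simp add: bitlen_alt_def)

lemma val_size_left: "val_size (left_of v) \<le> val_size v"
  using val_size_ge_2[of v] by (cases v) (auto simp: val_size_0 simp del: val_size.simps(1))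

lemma val_size_right: "val_size (right_of v) \<le> val_size v"
  using val_size_ge_2[of v] by (cases v) (auto simp: val_size_0 simp del: val_size.simps(1))

lemma ptime_left0: "ptime (\<lambda>F v. left_of v)"
  using val_size_left
  by (intro ptime_assign[where g="\<lambda>x. x + x" and e="\<lambda>b. Fst_of (Var b)"]) (auto intro!: poly_bounded_intros trans_le_add1)

lemma ptime_right0: "ptime (\<lambda>F v. right_of v)"
  using val_size_right
  by (intro ptime_assign[where g="\<lambda>x. x + x" and e="\<lambda>b. Snd_of (Var b)"]) (auto intro!: poly_bounded_intros trans_le_add1)

lemmas ptime_left = ptime_comp[OF ptime_left0]
lemmas ptime_right = ptime_comp[OF ptime_right0]

lemma val_size_bool: "val_size (val_of_bool P) \<le> 3"
  by (cases P) (auto simp: bitlen_alt_def)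

lemma ptime_is_node0: "ptime (\<lambda>F v. val_of_bool (\<exists>a b. v = Node a b))"
  using val_size_bool
  by (intro ptime_assign[where g="\<lambda>x. x + 3" and e="\<lambda>b. Is_node (Var b)"])
    (auto intro!: poly_bounded_intros intro: trans_le_add2)

lemmas ptime_is_node = ptime_comp[OF ptime_is_node0]

definition vfloor :: "val \<Rightarrow> val" where "vfloor v = Num (of_int \<lfloor>num_of v\<rfloor>)"

subsection \<open>Sizes of rational numbers\<close>

lemma nat_bitlen_le: "nat (bitlen x) \<le> k \<longleftrightarrow> x < 2 ^ k"
  using bitlen_le_iff_power[of x "int k"] bitlen_nonneg[of x] by (simp add: nat_le_iff)

text \<open>Lowest terms have the smallest numerator and denominator among all representations, so
  any convenient representation of a number bounds its encoded size.\<close>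

lemma quotient_of_bounds:
  assumes "d > 0" "q = of_int p / of_int d"
  shows "\<bar>fst (quotient_of q)\<bar> \<le> \<bar>p\<bar>" "snd (quotient_of q) \<le> d"
proof -
  obtain m e where me: "quotient_of q = (m, e)" by (cases "quotient_of q")
  have e: "e > 0" "coprime m e" "q = of_int m / of_int e"
    using quotient_of_denom_pos[OF me] quotient_of_coprime[OF me] quotient_of_div[OF me] by auto
  have "of_int (m * d) = (of_int (p * e) :: rat)"
    using e assms by (auto simp: field_simps)
  then have eq: "m * d = p * e" by linarith
  then have "e dvd m * d" by simp
  then have "e dvd d" using e(2) by (metis coprime_commute coprime_dvd_mult_right_iff)
  then obtain g where g: "d = e * g" by (elim dvdE)
  with assms e have "g > 0" by (simp add: zero_less_mult_iff)
  have "p = m * g" using eq g e by simp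
  then have "\<bar>m\<bar> \<le> \<bar>p\<bar>" using \<open>g > 0\<close> mult_left_mono[of 1 g "\<bar>m\<bar>"] by (simp add: abs_mult)
  moreover have "e * 1 \<le> d" unfolding g using e \<open>g > 0\<close> by (intro mult_mono) auto
  ultimately show "\<bar>fst (quotient_of q)\<bar> \<le> \<bar>p\<bar>" "snd (quotient_of q) \<le> d" using me by auto
qed

lemma val_size_Num_le:
  assumes "d > 0" "q = of_int p / of_int d" "\<bar>p\<bar> < 2 ^ i" "d < 2 ^ j"
  shows "val_size (Num q) \<le> 1 + i + j"
proof -
  have "nat (bitlen \<bar>fst (quotient_of q)\<bar>) \<le> i" "nat (bitlen (snd (quotient_of q))) \<le> j"
    unfolding nat_bitlen_le using quotient_of_bounds[OF assms(1,2)] assms(3,4) by auto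
  then show ?thesis by simp
qed

lemma val_size_Num_D:
  assumes "val_size v \<le> Suc k"
  obtains p d where "d > 0" "num_of v = of_int p / of_int d" "\<bar>p\<bar> < 2 ^ k" "d < 2 ^ k"
proof (cases v)
  case (Num q)
  obtain p d where pd: "quotient_of q = (p, d)" by (cases "quotient_of q")
  have "nat (bitlen \<bar>p\<bar>) \<le> k" "nat (bitlen d) \<le> k" using assms pd Num by auto
  then show ?thesis using that[of d p] quotient_of_denom_pos[OF pd] quotient_of_div[OF pd] Num
    unfolding nat_bitlen_le by auto
next
  case (Node v1 v2)
  \<comment> \<open>A pair counts as the number 0, represented as 0 / 1; \<open>k \<ge> 1\<close>
    makes room for the denominator.\<close>
  have "k \<ge> 1" using assms Node val_size_ge_2[of v1] by simp
  then have "(1::int) < 2 ^ k" by simp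
  then show ?thesis using that[of 1 0] Node by simp
qed

lemma ptime_floor0: "ptime (\<lambda>F v. vfloor v)"
proof (rule ptime_assign[where g="\<lambda>x. x + (2 + 2 * x)" and e="\<lambda>b. Floor_of (Var b)"])
  have *: "val_size (vfloor v) \<le> 2 + 2 * val_size v" for v
  proof -
    have "val_size v \<le> Suc (val_size v)" by simp
    then obtain p d where pd: "d > 0" "num_of v = of_int p / of_int d" "\<bar>p\<bar> < 2 ^ val_size v"
      by (rule val_size_Num_D)
    have "\<lfloor>num_of v\<rfloor> = p div d" using pd by (simp add: floor_divide_of_int_eq)
    moreover have "\<bar>p div d\<bar> \<le> \<bar>p\<bar>"
    proof (cases "p \<ge> 0")
      case True
      then have "0 \<le> p div d" using pd(1) by (simp add: pos_imp_zdiv_nonneg_iff)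
      moreover have "p div d * 1 \<le> p div d * d" using calculation pd(1) by (intro mult_left_mono) auto
      moreover have "p div d * d \<le> p" using pd(1) pos_mod_sign[of d p] div_mult_mod_eq[of p d] by linarith
      ultimately show ?thesis by linarith
    next
      case False
      then have "p div d < 0" using pd by (simp add: neg_imp_zdiv_neg_iff pos_imp_zdiv_neg_iff)
      moreover have "p * 1 \<ge> p * d" using False pd by (intro mult_left_mono_neg) auto
      then have "p div d \<ge> p" using pd by (simp add: pos_imp_zdiv_nonneg_iff zdiv_mono1[of "p*d" p d, simplified])
      ultimately show ?thesis by linarith
    qed
    ultimately have "\<bar>\<lfloor>num_of v\<rfloor>\<bar> < 2 ^ val_size v" using pd by linarith
    then have "val_size (vfloor v) \<le> 1 + val_size v + 1"
      unfolding vfloor_def by (intro val_size_Num_le[of 1]) auto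
    then show ?thesis by simp
  qed
  then show "val_size (vfloor v) \<le> val_size v + (2 + 2 * val_size v)" for v using trans_le_add2 by blast
  show "expr_cost s (Floor_of (Var b)) \<le> val_size (s b) + (2 + 2 * val_size (s b))" for s b
    using *[of "s b"] by (simp add: vfloor_def del: val_size.simps)
  show "poly_bounded (\<lambda>x. x + (2 + 2 * x))" by (intro poly_bounded_intros)
qed (auto simp: vfloor_def)

lemmas ptime_floor = ptime_comp[OF ptime_floor0]

lemma abs_mult_less_power:
  fixes a b :: int
  assumes "\<bar>a\<bar> < 2 ^ k" "\<bar>b\<bar> < 2 ^ k"
  shows "\<bar>a * b\<bar> < 2 ^ (2 * k)"
proof -
  have "\<bar>a\<bar> * \<bar>b\<bar> < 2 ^ k * 2 ^ k" using assms by (intro mult_strict_mono) auto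
  then show ?thesis by (simp add: abs_mult mult_2 power_add)
qed

text \<open>Over a common denominator one operation multiplies the number of bits by at most a
  constant. Iterated, that alone would allow exponential growth, so the loops below carry their own
  size bounds.\<close>

lemma val_size_arith: "val_size (arith_val f (num_of v) (num_of w)) \<le> 5 + 4 * (val_size v + val_size w)"
proof -
  let ?k = "val_size v + val_size w"
  have "val_size v \<le> Suc ?k" "val_size w \<le> Suc ?k" by auto
  then obtain p d p' d' where pd: "d > 0" "num_of v = of_int p / of_int d" "\<bar>p\<bar> < 2 ^ ?k" "d < 2 ^ ?k"
    and pd': "d' > 0" "num_of w = of_int p' / of_int d'" "\<bar>p'\<bar> < 2 ^ ?k" "d' < 2 ^ ?k"
    by (elim val_size_Num_D)
  have m: "\<bar>p * p'\<bar> < 2 ^ (2 * ?k)" "\<bar>p * d'\<bar> < 2 ^ (2 * ?k)" "\<bar>p' * d\<bar> < 2 ^ (2 * ?k)" "\<bar>d * d'\<bar> < 2 ^ (2 * ?k)"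
    "\<bar>d * p'\<bar> < 2 ^ (2 * ?k)"
    by (rule abs_mult_less_power; use pd pd' in simp)+
  have m': "\<bar>x\<bar> < 2 ^ Suc (2 * ?k)" if "\<bar>x\<bar> < 2 ^ (2 * ?k)" for x :: int
    using that by simp
  show ?thesis
  proof (cases f)
    case Plus
    have "val_size (Num (num_of v + num_of w)) \<le> 1 + Suc (2 * ?k) + Suc (2 * ?k)"
    proof (rule val_size_Num_le[of "d * d'" _ "p * d' + p' * d"])
      show "\<bar>p * d' + p' * d\<bar> < 2 ^ Suc (2 * ?k)" using m by (simp del: power_mult) 
      show "d * d' < 2 ^ Suc (2 * ?k)" using m m' by force
      show "num_of v + num_of w = of_int (p * d' + p' * d) / of_int (d * d')"
        unfolding pd(2) pd'(2) using pd(1) pd'(1) by (simp add: field_simps)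
    qed (use pd pd' in simp)
    then show ?thesis using Plus by (simp del: val_size.simps)
  next
    case Minus
    have "val_size (Num (num_of v - num_of w)) \<le> 1 + Suc (2 * ?k) + Suc (2 * ?k)"
    proof (rule val_size_Num_le[of "d * d'" _ "p * d' - p' * d"])
      show "\<bar>p * d' - p' * d\<bar> < 2 ^ Suc (2 * ?k)" using m by (simp del: power_mult) 
      show "d * d' < 2 ^ Suc (2 * ?k)" using m m' by force
      show "num_of v - num_of w = of_int (p * d' - p' * d) / of_int (d * d')"
        unfolding pd(2) pd'(2) using pd(1) pd'(1) by (simp add: field_simps)
    qed (use pd pd' in simp)
    then show ?thesis using Minus by (simp del: val_size.simps)
  next
    case Times
    have "val_size (Num (num_of v * num_of w)) \<le> 1 + Suc (2 * ?k) + Suc (2 * ?k)"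
    proof (rule val_size_Num_le[of "d * d'" _ "p * p'"])
      show "d * d' < 2 ^ Suc (2 * ?k)" "\<bar>p * p'\<bar> < 2 ^ Suc (2 * ?k)" using m m' by force+
      show "num_of v * num_of w = of_int (p * p') / of_int (d * d')"
        unfolding pd(2) pd'(2) using pd(1) pd'(1) by (simp add: field_simps)
    qed (use pd pd' in simp)
    then show ?thesis using Times by (simp del: val_size.simps)
  next
    case Divide
    show ?thesis
    proof (cases "p' = 0")
      case True
      then show ?thesis using Divide pd' by (simp add: bitlen_alt_def)
    next
      case False
      \<comment> \<open>Moving the sign of the divisor into the numerator keeps the denominator
        positive.\<close>
      have "val_size (Num (num_of v / num_of w)) \<le> 1 + Suc (2 * ?k) + Suc (2 * ?k)"
      proof (rule val_size_Num_le[of "d * \<bar>p'\<bar>" _ "sgn p' * (p * d')"])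
        show "d * \<bar>p'\<bar> < 2 ^ Suc (2 * ?k)" using m(5) pd m'[of "d * p'"] by (simp add: abs_mult)
        show "\<bar>sgn p' * (p * d')\<bar> < 2 ^ Suc (2 * ?k)" using m(2) m'[of "p * d'"] False by (simp add: abs_mult)
        show "num_of v / num_of w = of_int (sgn p' * (p * d')) / of_int (d * \<bar>p'\<bar>)"
          unfolding pd(2) pd'(2) using pd(1) pd'(1) False by (simp add: field_simps sgn_if abs_if)
      qed (use pd pd' False in auto)
      then show ?thesis using Divide by (simp del: val_size.simps)
    qed
  next
    case Less
    then show ?thesis using val_size_bool[of "num_of v < num_of w"] by simp
  qed
qed

lemma ptime_Node:
  assumes f: "ptime f" and g: "ptime g"
  shows "ptime (\<lambda>F v. Node (f F v) (g F v))"
proof -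
  obtain kf where f1: "\<And>F v. val_size (f F v) \<le> val_size v ^ kf" and f2: "\<And>b. \<exists>c. implements b c f kf"
    using f by (elim ptimeE) blast
  obtain kg where g1: "\<And>F v. val_size (g F v) \<le> val_size v ^ kg" and g2: "\<And>b. \<exists>c. implements b c g kg"
    using g by (elim ptimeE) blast
  show ?thesis
  proof (rule ptimeI[where g="\<lambda>x. 1 + x ^ kf + x ^ kg" and h="\<lambda>x. 4 + 2 * x + 3 * x ^ kf + 3 * x ^ kg"])
    show "val_size (Node (f F v) (g F v)) \<le> 1 + val_size v ^ kf + val_size v ^ kg" for F v
      using f1[of F v] g1[of F v] by simp
    fix b
    obtain cf cg where cf: "implements (b + 1) cf f kf" and cg: "implements (b + 2) cg g kg" using f2 g2 by blast
    \<comment> \<open>The input stays in register \<open>b\<close>; \<open>cf\<close> works from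
      base \<open>b + 1\<close> and \<open>cg\<close> from base \<open>b + 2\<close>, so neither the
      input nor the first result is overwritten.\<close>
    let ?c = "Seq (Assign (b + 1) (Var b)) (Seq cf (Seq (Assign (b + 2) (Var b)) (Seq cg
      (Assign b (Cons_of (Var (b + 1)) (Var (b + 2)))))))"
    show "\<exists>c. \<forall>F s. \<exists>t s'. exec F c s t s' \<and>
           t \<le> 4 + 2 * val_size (s b) + 3 * val_size (s b) ^ kf + 3 * val_size (s b) ^ kg \<and> 
           s' b = Node (f F (s b)) (g F (s b)) \<and> (\<forall>j<b. s' j = s j)"
    proof (intro exI[of _ ?c] allI)
      fix F and s :: store
      let ?v = "s b"
      let ?sa = "s(b + 1 := ?v)"
      obtain t1 s1 where 1: "exec F cf ?sa t1 s1" "t1 \<le> val_size (?sa (b + 1)) ^ kf" "s1 (b + 1) = f F (?sa (b + 1))"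
        "\<And>j. j < b + 1 \<Longrightarrow> s1 j = ?sa j" using implementsD[OF cf, of F "?sa"] by blast
      let ?sb = "s1(b + 2 := ?v)"
      obtain t2 s2 where 2: "exec F cg ?sb t2 s2" "t2 \<le> val_size (?sb (b + 2)) ^ kg" "s2 (b + 2) = g F (?sb (b + 2))"
        "\<And>j. j < b + 2 \<Longrightarrow> s2 j = ?sb j" using implementsD[OF cg, of F "?sb"] by blast
      let ?sc = "s2(b := Node (f F ?v) (g F ?v))"
      have A0: "exec F (Assign (b + 1) (Var b)) s (1 + val_size ?v) ?sa"
        using exec_Assign[of F "b + 1" "Var b" s] by simp
      have A1: "exec F (Assign (b + 2) (Var b)) s1 (1 + val_size ?v) ?sb"
        using exec_Assign[of F "b + 2" "Var b" s1] 1(4)[of b] by simp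
      have A2: "exec F (Assign b (Cons_of (Var (b + 1)) (Var (b + 2)))) s2
          (2 + (val_size (f F ?v) + (val_size (f F ?v) + (val_size (g F ?v) + val_size (g F ?v))))) ?sc"
        using exec_Assign[of F b "Cons_of (Var (b + 1)) (Var (b + 2))" s2] 1(3) 2(3) 2(4)[of "b + 1"] 
        by (simp add: algebra_simps)
      have "exec F ?c s (1 + val_size ?v + (t1 + (1 + val_size ?v + (t2 + 
          (2 + (val_size (f F ?v) + (val_size (f F ?v) + (val_size (g F ?v) + val_size (g F ?v))))))))) ?sc"
        by (rule exec_Seq[OF A0 exec_Seq[OF 1(1) exec_Seq[OF A1 exec_Seq[OF 2(1) A2]]]])
      then show "\<exists>t s'. exec F ?c s t s' \<and>
           t \<le> 4 + 2 * val_size ?v + 3 * val_size ?v ^ kf + 3 * val_size ?v ^ kg \<and> 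
           s' b = Node (f F ?v) (g F ?v) \<and> (\<forall>j<b. s' j = s j)"
      proof (rule exec_witness)
        show "?sc j = s j" if "j < b" for j using that 1(4)[of j] 2(4)[of j] by simp
      qed (use 1(2) 2(2) f1[of F ?v] g1[of F ?v] in auto)
    qed
  qed (intro poly_bounded_intros)+
qed

lemma ptime_arith:
  assumes "ptime f" "ptime g"
  shows "ptime (\<lambda>F v. arith_val opr (num_of (f F v)) (num_of (g F v)))"
proof -
  have le: "val_size (left_of v) \<le> val_size v" "val_size (right_of v) \<le> val_size v" for v
    by (rule val_size_left val_size_right)+
  have "ptime (\<lambda>F v. arith_val opr (num_of (left_of v)) (num_of (right_of v)))"
  proof (rule ptime_assign[where g="\<lambda>x. 4 * x + (5 + 4 * (x + x))" and
      e="\<lambda>b. Arith opr (Fst_of (Var b)) (Snd_of (Var b))"])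
    have *: "val_size (arith_val opr (num_of (left_of v)) (num_of (right_of v))) \<le> 5 + 4 * (val_size v + val_size v)" for v
    proof (rule order_trans[OF val_size_arith])
      show "5 + 4 * (val_size (left_of v) + val_size (right_of v)) \<le> 5 + 4 * (val_size v + val_size v)"
        by (intro add_left_mono mult_left_mono add_mono le) simp
    qed
    show "expr_cost s (Arith opr (Fst_of (Var b)) (Snd_of (Var b)))
       \<le> 4 * val_size (s b) + (5 + 4 * (val_size (s b) + val_size (s b)))" for s b
      using *[of "s b"] le[of "s b"] by simp
    show "val_size (arith_val opr (num_of (left_of v)) (num_of (right_of v)))
       \<le> 4 * val_size v + (5 + 4 * (val_size v + val_size v))" for v
      using *[of v] by simp
    show "poly_bounded (\<lambda>x. 4 * x + (5 + 4 * (x + x)))" by (intro poly_bounded_intros)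
  qed simp
  from ptime_comp[OF this ptime_Node[OF assms]] show ?thesis by simp
qed

lemma ptime_answer0: "ptime (\<lambda>F v. answer F v)"
proof (rule ptimeI[where g="\<lambda>x. 3" and h="\<lambda>x. 1 + x"])
  show "val_size (answer F v) \<le> 3" for F v
    unfolding answer_def by (rule val_size_bool)
  show "\<exists>c. \<forall>F s. \<exists>t s'. exec F c s t s' \<and> t \<le> 1 + val_size (s b) \<and> s' b = answer F (s b) \<and> (\<forall>j<b. s' j = s j)" for b
  proof (intro exI[of _ "Query b (Var b)"] allI)
    fix F and s :: store
    show "\<exists>t s'. exec F (Query b (Var b)) s t s' \<and> t \<le> 1 + val_size (s b) \<and> s' b = answer F (s b) \<and> (\<forall>j<b. s' j = s j)"
      using exec_Query[of F b "Var b" s]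
      by (intro exI[of _ "1 + val_size (s b)"] exI[of _ "s(b := answer F (s b))"]) simp
  qed
qed (intro poly_bounded_intros)+

lemmas ptime_answer = ptime_comp[OF ptime_answer0]

text \<open>Both branches are computed and packed with the condition before the test, which turns
  the conditional into a composition; this is affordable because both are polynomial.\<close>

lemma ptime_if:
  assumes "ptime h" "ptime f" "ptime g"
  shows "ptime (\<lambda>F v. if h F v \<noteq> Num 0 then f F v else g F v)"
proof -
  have "ptime (\<lambda>F v. if left_of v \<noteq> Num 0 then left_of (right_of v) else right_of (right_of v))"
  proof (rule ptimeI[where g="\<lambda>x. x" and h="\<lambda>x. 2 + 6 * x"])
    show "val_size (if left_of v \<noteq> Num 0 then left_of (right_of v) else right_of (right_of v)) \<le> val_size v" for v
      by (auto intro: order_trans[OF val_size_left val_size_right] order_trans[OF val_size_right val_size_right])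
    show "\<exists>c. \<forall>F s. \<exists>t s'. exec F c s t s' \<and> t \<le> 2 + 6 * val_size (s b) \<and> s' b =
      (if left_of (s b) \<noteq> Num 0 then left_of (right_of (s b)) else right_of (right_of (s b))) \<and> (\<forall>j<b. s' j = s j)" for b
    proof (intro exI[of _ "Cond (Fst_of (Var b)) (Assign b (Fst_of (Snd_of (Var b)))) (Assign b (Snd_of (Snd_of (Var b))))"] allI)
      fix F and s :: store
      let ?l = "Assign b (Fst_of (Snd_of (Var b)))" and ?r = "Assign b (Snd_of (Snd_of (Var b)))"
      have sz: "val_size (left_of (s b)) \<le> val_size (s b)" "val_size (right_of (s b)) \<le> val_size (s b)" 
        "val_size (left_of (right_of (s b))) \<le> val_size (s b)" "val_size (right_of (right_of (s b))) \<le> val_size (s b)"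
        by (auto intro: order_trans[OF val_size_left] order_trans[OF val_size_right] val_size_left val_size_right)
      show "\<exists>t s'. exec F (Cond (Fst_of (Var b)) ?l ?r) s t s' \<and> t \<le> 2 + 6 * val_size (s b) \<and> s' b =
      (if left_of (s b) \<noteq> Num 0 then left_of (right_of (s b)) else right_of (right_of (s b))) \<and> (\<forall>j<b. s' j = s j)"
      proof (cases "left_of (s b) = Num 0")
        case True
        have "exec F (Cond (Fst_of (Var b)) ?l ?r) s
            (1 + expr_cost s (Fst_of (Var b)) + (1 + expr_cost s (Snd_of (Snd_of (Var b)))))
            (s(b := right_of (right_of (s b))))"
          using exec_CondF[OF _ exec_Assign[of F b "Snd_of (Snd_of (Var b))" s], of "Fst_of (Var b)" ?l] True by simp
        then show ?thesis using sz True
          by (intro exI[of _ "1 + expr_cost s (Fst_of (Var b)) + (1 + expr_cost s (Snd_of (Snd_of (Var b))))"]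
              exI[of _ "s(b := right_of (right_of (s b)))"]) simp
      next
        case False
        have "exec F (Cond (Fst_of (Var b)) ?l ?r) s
            (1 + expr_cost s (Fst_of (Var b)) + (1 + expr_cost s (Fst_of (Snd_of (Var b)))))
            (s(b := left_of (right_of (s b))))"
          using exec_CondT[OF _ exec_Assign[of F b "Fst_of (Snd_of (Var b))" s], of "Fst_of (Var b)" ?r] False by simp
        then show ?thesis using sz False
          by (intro exI[of _ "1 + expr_cost s (Fst_of (Var b)) + (1 + expr_cost s (Fst_of (Snd_of (Var b))))"]
              exI[of _ "s(b := left_of (right_of (s b)))"]) simp
      qed
    qed
  qed (intro poly_bounded_intros)+
  from ptime_comp[OF this ptime_Node[OF assms(1) ptime_Node[OF assms(2,3)]]] show ?thesis
    by (simp only: left_of.simps right_of.simps)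
qed

subsection \<open>Predicates\<close>

lemma val_of_bool_neq_0 [simp]: "val_of_bool P \<noteq> Num 0 \<longleftrightarrow> P"
  by (cases P) auto

lemma val_of_bool_eq_1: "val_of_bool (val_of_bool P = Num 1) = val_of_bool P"
  by (cases P) auto

lemma ptime_If:
  assumes "ptime (\<lambda>F v. val_of_bool (P F v))" "ptime f" "ptime g"
  shows "ptime (\<lambda>F v. if P F v then f F v else g F v)"
  using ptime_if[OF assms] by simp

lemma ptime_not:
  assumes "ptime (\<lambda>F v. val_of_bool (P F v))"
  shows "ptime (\<lambda>F v. val_of_bool (\<not> P F v))"
proof -
  have eq: "val_of_bool (\<not> P F v) = (if P F v then Num 0 else Num 1)" for F v by simp
  show ?thesis unfolding eq by (rule ptime_If[OF assms ptime_const ptime_const])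
qed

lemma ptime_conj:
  assumes "ptime (\<lambda>F v. val_of_bool (P F v))" "ptime (\<lambda>F v. val_of_bool (Q F v))"
  shows "ptime (\<lambda>F v. val_of_bool (P F v \<and> Q F v))"
proof -
  have eq: "val_of_bool (P F v \<and> Q F v) = (if P F v then val_of_bool (Q F v) else Num 0)" for F v by simp
  show ?thesis unfolding eq by (rule ptime_If[OF assms(1) assms(2) ptime_const])
qed

lemma ptime_disj:
  assumes "ptime (\<lambda>F v. val_of_bool (P F v))" "ptime (\<lambda>F v. val_of_bool (Q F v))"
  shows "ptime (\<lambda>F v. val_of_bool (P F v \<or> Q F v))"
proof -
  have eq: "val_of_bool (P F v \<or> Q F v) = (if P F v then Num 1 else val_of_bool (Q F v))" for F v by simp
  show ?thesis unfolding eq by (rule ptime_If[OF assms(1) ptime_const assms(2)])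
qed

lemma ptime_less:
  assumes "ptime f" "ptime g"
  shows "ptime (\<lambda>F v. val_of_bool (num_of (f F v) < num_of (g F v)))"
  using ptime_arith[OF assms, of Less] by (simp only: arith_val.simps)

lemma ptime_le:
  assumes "ptime f" "ptime g"
  shows "ptime (\<lambda>F v. val_of_bool (num_of (f F v) \<le> num_of (g F v)))"
  using ptime_not[OF ptime_less[OF assms(2,1)]] by (simp only: not_less)

lemma ptime_eq:
  assumes "ptime f" "ptime g"
  shows "ptime (\<lambda>F v. val_of_bool (num_of (f F v) = num_of (g F v)))"
  unfolding order_eq_iff by (rule ptime_conj[OF ptime_le[OF assms] ptime_le[OF assms(2,1)]])

lemma ptime_plus: "ptime f \<Longrightarrow> ptime g \<Longrightarrow> ptime (\<lambda>F v. Num (num_of (f F v) + num_of (g F v)))"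
  and ptime_minus: "ptime f \<Longrightarrow> ptime g \<Longrightarrow> ptime (\<lambda>F v. Num (num_of (f F v) - num_of (g F v)))"
  and ptime_times: "ptime f \<Longrightarrow> ptime g \<Longrightarrow> ptime (\<lambda>F v. Num (num_of (f F v) * num_of (g F v)))"
  and ptime_divide: "ptime f \<Longrightarrow> ptime g \<Longrightarrow> ptime (\<lambda>F v. Num (num_of (f F v) / num_of (g F v)))"
  using ptime_arith[of f g Plus] ptime_arith[of f g Minus] ptime_arith[of f g Times] ptime_arith[of f g Divide]
  by (simp_all only: arith_val.simps)

definition is_node :: "val \<Rightarrow> bool" where
  "is_node v \<longleftrightarrow> (\<exists>a b. v = Node a b)"

lemma is_node_simps [simp]: "is_node (Node a b)" "\<not> is_node (Num q)"
  unfolding is_node_def by auto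

lemma ptime_is_node': "ptime f \<Longrightarrow> ptime (\<lambda>F v. val_of_bool (is_node (f F v)))"
  unfolding is_node_def by (rule ptime_is_node)

lemma ptime_answer': 
  assumes "ptime f" 
  shows "ptime (\<lambda>F v. val_of_bool (answer F (f F v) = Num 1))"
proof -
  have "val_of_bool (answer F w = Num 1) = answer F w" for F w
    unfolding answer_def by (rule val_of_bool_eq_1)
  then show ?thesis using ptime_answer[OF assms] by (simp only:)
qed

subsection \<open>Iteration over lists\<close>

fun list_of :: "val \<Rightarrow> val list" where
  "list_of (Node v w) = v # list_of w"
| "list_of (Num q) = []"

lemma list_of_val_of_list [simp]: "list_of (val_of_list xs) = xs"
  by (induction xs) auto

lemma length_list_of: "length (list_of v) \<le> val_size v"
  by (induction v) auto

lemma val_size_list_of: "x \<in> set (list_of v) \<Longrightarrow> val_size x \<le> val_size v"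
  by (induction v) auto

text \<open>The registers are: \<open>b\<close> the input, \<open>b + 1\<close> the list, \<open>b + 2\<close> the accumulator.\<close>

lemma exec_foldl_loop:
  fixes b :: nat and V L Q kf :: nat
  defines "T \<equiv> 11 + 7 * L + 4 * Q + 3 * V + (2 + Q + L + V) ^ kf"
  assumes cf: "implements (b + 3) cf (\<lambda>F w. f F (left_of w) (left_of (right_of w)) (right_of (right_of w))) kf"
    and v: "s b = v" "val_size v \<le> V"
    and l: "val_size (s (b + 1)) \<le> L"
    and Q: "\<And>ys zs. list_of (s (b + 1)) = ys @ zs \<Longrightarrow> val_size (foldl (\<lambda>acc x. f F acc x v) (s (b + 2)) ys) \<le> Q"
  shows "\<exists>t s'. exec F (While (Is_node (Var (b + 1)))
      (Seq (Assign (b + 3) (Cons_of (Var (b + 2)) (Cons_of (Fst_of (Var (b + 1))) (Var b))))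
        (Seq cf (Seq (Assign (b + 2) (Var (b + 3))) (Assign (b + 1) (Snd_of (Var (b + 1)))))))) s t s' \<and>
    t \<le> Suc (length (list_of (s (b + 1)))) * T \<and>
    s' (b + 2) = foldl (\<lambda>acc x. f F acc x v) (s (b + 2)) (list_of (s (b + 1))) \<and> (\<forall>j\<le>b. s' j = s j)"
  (is "\<exists>t s'. exec F (While ?cond ?body) s t s' \<and> _")
  using v l Q
proof (induction "s (b + 1)" arbitrary: s)
  case (Num q)
  have c: "1 + expr_cost s ?cond \<le> T"
    using Num(1)[symmetric] Num(4) val_size_bool[of False] unfolding T_def by simp
  have "exec F (While ?cond ?body) s (1 + expr_cost s ?cond) s"
    by (rule exec_WhileF) (use Num(1)[symmetric] in simp)
  then show ?case using c Num(1)[symmetric] by (intro exI[of _ s] exI[of _ "1 + expr_cost s ?cond"]) simp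
next
  case (Node x lv)
  note lst = Node(3)[symmetric]
  define acc where "acc = s (b + 2)"
  let ?w = "Node acc (Node x v)"
  define sa where "sa = s(b + 3 := ?w)"
  have accQ: "val_size acc \<le> Q" using Node(7)[of "[]" "list_of (s (b + 1))"] unfolding acc_def by simp
  have xL: "val_size x \<le> L" "val_size lv \<le> L" using Node(6) unfolding lst by auto
  obtain t1 sb where 1: "exec F cf sa t1 sb" "t1 \<le> val_size (sa (b + 3)) ^ kf" "sb (b + 3) = f F acc x v"
        "\<forall>j<b + 3. sb j = sa j" using implementsD[OF cf, of F sa] by (auto simp: sa_def)
  have newQ: "val_size (f F acc x v) \<le> Q"
    using Node(7)[of "[x]" "list_of lv"] unfolding lst acc_def by simp
  define sc where "sc = sb(b + 2 := f F acc x v)"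
  define sd where "sd = sc(b + 1 := lv)"
  have A1: "exec F (Assign (b + 3) (Cons_of (Var (b + 2)) (Cons_of (Fst_of (Var (b + 1))) (Var b)))) s
      (1 + expr_cost s (Cons_of (Var (b + 2)) (Cons_of (Fst_of (Var (b + 1))) (Var b)))) sa"
    using exec_Assign[of F "b + 3" "Cons_of (Var (b + 2)) (Cons_of (Fst_of (Var (b + 1))) (Var b))" s] lst Node(4)
    by (simp add: sa_def acc_def)
  have A2: "exec F (Assign (b + 2) (Var (b + 3))) sb (1 + expr_cost sb (Var (b + 3))) sc"
    using exec_Assign[of F "b + 2" "Var (b + 3)" sb] 1(3) by (simp add: sc_def)
  have sc1: "sc (b + 1) = Node x lv" using 1(4) lst by (simp add: sc_def sa_def)
  have A3: "exec F (Assign (b + 1) (Snd_of (Var (b + 1)))) sc (1 + expr_cost sc (Snd_of (Var (b + 1)))) sd"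
    using exec_Assign[of F "b + 1" "Snd_of (Var (b + 1))" sc] sc1 by (simp add: sd_def)
  note body = exec_Seq[OF A1 exec_Seq[OF 1(1) exec_Seq[OF A2 A3]]]
  have sd: "sd b = v" "sd (b + 1) = lv" "sd (b + 2) = f F acc x v" "\<forall>j\<le>b. sd j = s j"
    using 1(4) Node(4) by (auto simp: sd_def sc_def sa_def)
  have "\<exists>t s'. exec F (While ?cond ?body) sd t s' \<and> t \<le> Suc (length (list_of (sd (b + 1)))) * T \<and>
    s' (b + 2) = foldl (\<lambda>acc x. f F acc x v) (sd (b + 2)) (list_of (sd (b + 1))) \<and> (\<forall>j\<le>b. s' j = sd j)"
  proof (rule Node(2))
    show "lv = sd (b + 1)" "sd b = v" "val_size v \<le> V" "val_size (sd (b + 1)) \<le> L"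
      using sd Node(5) xL by auto
    fix ys zs
    assume "list_of (sd (b + 1)) = ys @ zs"
    then show "val_size (foldl (\<lambda>acc x. f F acc x v) (sd (b + 2)) ys) \<le> Q"
      using Node(7)[of "x # ys" zs] unfolding lst sd acc_def by simp
  qed
  then obtain t2 se where 2: "exec F (While ?cond ?body) sd t2 se" "t2 \<le> Suc (length (list_of lv)) * T"
    "se (b + 2) = foldl (\<lambda>acc x. f F acc x v) (f F acc x v) (list_of lv)" "\<forall>j\<le>b. se j = s j"
    using sd by auto
  have w: "val_size ?w ^ kf \<le> (2 + Q + L + V) ^ kf"
    using accQ xL Node(5) by (intro power_mono) auto
  have "eval_expr s ?cond \<noteq> Num 0" using lst by simp
  from exec_WhileT[OF this body 2(1)]
  show ?case
  proof (intro exI conjI)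
    have c1: "expr_cost s ?cond \<le> L + 3" using val_size_bool[of True] Node(6) lst by simp
    have c2: "expr_cost s (Cons_of (Var (b + 2)) (Cons_of (Fst_of (Var (b + 1))) (Var b))) \<le> 3 + 2 * Q + 4 * L + 3 * V"
      using accQ[unfolded acc_def] xL Node(4,5,6) lst by simp
    have c3: "expr_cost sb (Var (b + 3)) \<le> Q" using 1(3) newQ by simp
    have c4: "expr_cost sc (Snd_of (Var (b + 1))) \<le> 2 * L" using sc1 xL Node(6) lst by simp
    have t1: "t1 \<le> (2 + Q + L + V) ^ kf" using 1(2) w by (simp add: sa_def)
    have "1 + expr_cost s ?cond + (1 + expr_cost s (Cons_of (Var (b + 2)) (Cons_of (Fst_of (Var (b + 1))) (Var b))) +
         (t1 + (1 + expr_cost sb (Var (b + 3)) + (1 + expr_cost sc (Snd_of (Var (b + 1))))))) \<le> T"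
      unfolding T_def using c1 c2 c3 c4 t1 by linarith
    then show "1 + expr_cost s ?cond + (1 + expr_cost s (Cons_of (Var (b + 2)) (Cons_of (Fst_of (Var (b + 1))) (Var b))) +
         (t1 + (1 + expr_cost sb (Var (b + 3)) + (1 + expr_cost sc (Snd_of (Var (b + 1))))))) + t2
         \<le> Suc (length (list_of (s (b + 1)))) * T"
      using 2(2) unfolding lst by simp
    show "se (b + 2) = foldl (\<lambda>acc x. f F acc x v) (s (b + 2)) (list_of (s (b + 1)))"
      unfolding 2(3) lst acc_def by simp
  qed (use 2 in auto)
qed

text \<open>Polynomial time of a single step is not enough, as repeated squaring shows.
  \<open>Q\<close> therefore asks for one polynomial bound on the accumulator after every prefix of
  the list.\<close>

lemma ptime_foldl:
  assumes f: "ptime (\<lambda>F w. f F (left_of w) (left_of (right_of w)) (right_of (right_of w)))"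
    and l: "ptime l" and i: "ptime i" and q: "poly_bounded q"
    and Q: "\<And>F v ys zs. list_of (l F v) = ys @ zs \<Longrightarrow>
      val_size (foldl (\<lambda>acc x. f F acc x v) (i F v) ys) \<le> q (val_size v)"
  shows "ptime (\<lambda>F v. foldl (\<lambda>acc x. f F acc x v) (i F v) (list_of (l F v)))"
proof -
  obtain kf where f2: "\<And>b. \<exists>c. implements b c (\<lambda>F w. f F (left_of w) (left_of (right_of w)) (right_of (right_of w))) kf"
    using f by (elim ptimeE) blast
  obtain kl where l1: "\<And>F v. val_size (l F v) \<le> val_size v ^ kl" and l2: "\<And>b. \<exists>c. implements b c l kl"
    using l by (elim ptimeE) blast
  obtain ki where i1: "\<And>F v. val_size (i F v) \<le> val_size v ^ ki" and i2: "\<And>b. \<exists>c. implements b c i ki"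
    using i by (elim ptimeE) blast
  let ?T = "\<lambda>x. 11 + 7 * x ^ kl + 4 * q x + 3 * x + (2 + q x + x ^ kl + x) ^ kf"
  let ?h = "\<lambda>x. 3 + 2 * x + x ^ kl + x ^ ki + (x ^ kl + 1) * ?T x + q x"
  show ?thesis
  proof (rule ptimeI[where g=q and h="?h"])
    show "val_size (foldl (\<lambda>acc x. f F acc x v) (i F v) (list_of (l F v))) \<le> q (val_size v)" for F v
      using Q[of F v "list_of (l F v)" "[]"] by simp
    fix b
    obtain cf cl ci where cf: "implements (b + 3) cf (\<lambda>F w. f F (left_of w) (left_of (right_of w)) (right_of (right_of w))) kf"
      and cl: "implements (b + 1) cl l kl" and ci: "implements (b + 2) ci i ki" using f2 l2 i2 by blast
    let ?loop = "While (Is_node (Var (b + 1)))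
      (Seq (Assign (b + 3) (Cons_of (Var (b + 2)) (Cons_of (Fst_of (Var (b + 1))) (Var b))))
        (Seq cf (Seq (Assign (b + 2) (Var (b + 3))) (Assign (b + 1) (Snd_of (Var (b + 1)))))))"
    let ?c = "Seq (Assign (b + 1) (Var b)) (Seq cl (Seq (Assign (b + 2) (Var b)) (Seq ci (Seq ?loop
      (Assign b (Var (b + 2)))))))"
    show "\<exists>c. \<forall>F s. \<exists>t s'. exec F c s t s' \<and> t \<le> ?h (val_size (s b)) \<and>
      s' b = foldl (\<lambda>acc x. f F acc x (s b)) (i F (s b)) (list_of (l F (s b))) \<and> (\<forall>j<b. s' j = s j)"
    proof (intro exI[of _ ?c] allI)
      fix F and s :: store
      define v where "v = s b"
      define sa where "sa = s(b + 1 := v)"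
      obtain t1 sb where 1: "exec F cl sa t1 sb" "t1 \<le> val_size (sa (b + 1)) ^ kl" "sb (b + 1) = l F (sa (b + 1))"
        "\<forall>j<b + 1. sb j = sa j" using implementsD[OF cl, of F sa] by blast
      define sc where "sc = sb(b + 2 := v)"
      obtain t2 sd where 2: "exec F ci sc t2 sd" "t2 \<le> val_size (sc (b + 2)) ^ ki" "sd (b + 2) = i F (sc (b + 2))"
        "\<forall>j<b + 2. sd j = sc j" using implementsD[OF ci, of F sc] by blast
      have sd: "sd b = v" "sd (b + 1) = l F v" "sd (b + 2) = i F v" "\<forall>j<b. sd j = s j"
        using 1 2 by (auto simp: sa_def sc_def v_def)
      obtain t3 se where 3: "exec F ?loop sd t3 se"
        "t3 \<le> Suc (length (list_of (l F v))) * ?T (val_size v)"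
        "se (b + 2) = foldl (\<lambda>acc x. f F acc x v) (i F v) (list_of (l F v))" "\<forall>j\<le>b. se j = sd j"
        using exec_foldl_loop[where F=F and s=sd and v=v and V="val_size v" and L="val_size v ^ kl" and Q="q (val_size v)", OF cf]
          sd l1[of F v] Q[of F v] by auto
      have A0: "exec F (Assign (b + 1) (Var b)) s (1 + val_size v) sa"
        using exec_Assign[of F "b + 1" "Var b" s] by (simp add: sa_def v_def)
      have A1: "exec F (Assign (b + 2) (Var b)) sb (1 + val_size v) sc"
        using exec_Assign[of F "b + 2" "Var b" sb] 1(4) by (simp add: sc_def v_def sa_def)
      have A2: "exec F (Assign b (Var (b + 2))) se (1 + val_size (se (b + 2))) (se(b := se (b + 2)))"
        using exec_Assign[of F b "Var (b + 2)" se] by simp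
      have "Suc (length (list_of (l F v))) * ?T (val_size v) \<le> (val_size v ^ kl + 1) * ?T (val_size v)"
        using length_list_of[of "l F v"] l1[of F v] by (intro mult_right_mono) auto
      then have t3: "t3 \<le> (val_size v ^ kl + 1) * ?T (val_size v)" using 3(2) by linarith
      have last: "val_size (se (b + 2)) \<le> q (val_size v)" using Q[of F v "list_of (l F v)" "[]"] 3(3) by simp
      have t12: "t1 \<le> val_size v ^ kl" "t2 \<le> val_size v ^ ki" using 1(2) 2(2) by (simp_all add: sa_def sc_def)
      have "exec F ?c s (1 + val_size v + (t1 + (1 + val_size v + (t2 + (t3 + (1 + val_size (se (b + 2)))))))) (se(b := se (b + 2)))"
        by (rule exec_Seq[OF A0 exec_Seq[OF 1(1) exec_Seq[OF A1 exec_Seq[OF 2(1) exec_Seq[OF 3(1) A2]]]]])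
      then show "\<exists>t s'. exec F ?c s t s' \<and> t \<le> ?h (val_size (s b)) \<and>
        s' b = foldl (\<lambda>acc x. f F acc x (s b)) (i F (s b)) (list_of (l F (s b))) \<and> (\<forall>j<b. s' j = s j)"
      proof (rule exec_witness)
        show "1 + val_size v + (t1 + (1 + val_size v + (t2 + (t3 + (1 + val_size (se (b + 2))))))) \<le> ?h (val_size (s b))"
          unfolding v_def[symmetric] using t12 t3 last by linarith
      qed (use sd 3 in \<open>auto simp: v_def\<close>)
    qed
  qed (intro q poly_bounded_intros)+
qed

subsection \<open>List operations\<close>

definition vadd :: "val \<Rightarrow> val \<Rightarrow> val" where "vadd v w = Num (num_of v + num_of w)"
definition vsub :: "val \<Rightarrow> val \<Rightarrow> val" where "vsub v w = Num (num_of v - num_of w)"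
definition vmul :: "val \<Rightarrow> val \<Rightarrow> val" where "vmul v w = Num (num_of v * num_of w)"
definition vdiv :: "val \<Rightarrow> val \<Rightarrow> val" where "vdiv v w = Num (num_of v / num_of w)"

definition vmap :: "(val \<Rightarrow> val) \<Rightarrow> val \<Rightarrow> val" where
  "vmap f v = val_of_list (map f (list_of v))"

definition vfilter :: "(val \<Rightarrow> bool) \<Rightarrow> val \<Rightarrow> val" where
  "vfilter P v = val_of_list (filter P (list_of v))"

definition vrev :: "val \<Rightarrow> val" where
  "vrev v = val_of_list (rev (list_of v))"

definition venum :: "val \<Rightarrow> val" where
  "venum v = val_of_list (map (\<lambda>(i, x). Node (val_of_nat i) x) (List.enumerate 0 (list_of v)))"

definition vsum :: "(val \<Rightarrow> val) \<Rightarrow> val \<Rightarrow> val" where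
  "vsum f v = Num (\<Sum>x\<leftarrow>list_of v. num_of (f x))"

text \<open>Horner's scheme from the left, so the bit read last becomes the most significant one.
  This is the source of the reversals in the sampling lemmas.\<close>

definition vfrac :: "val \<Rightarrow> val" where
  "vfrac v = foldl (\<lambda>q x. vdiv (vadd q (if x \<noteq> Num 0 then Num 1 else Num 0)) (Num 2)) (Num 0) (list_of v)"

definition vbest :: "val \<Rightarrow> val" where
  "vbest v = foldl (\<lambda>acc x. if \<not> is_node acc \<or> num_of (left_of acc) < num_of (left_of x) then x else acc)
     (Num 0) (list_of v)"

definition vbasis :: "nat set set \<Rightarrow> val \<Rightarrow> val" where
  "vbasis F v = foldl (\<lambda>acc x. if answer F (Node x acc) = Num 1 then Node x acc else acc) (Num 0) (list_of v)"

lemma ptime_arith_ops: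
  assumes "ptime f" "ptime g"
  shows "ptime (\<lambda>F v. vadd (f F v) (g F v))" "ptime (\<lambda>F v. vsub (f F v) (g F v))"
    "ptime (\<lambda>F v. vmul (f F v) (g F v))" "ptime (\<lambda>F v. vdiv (f F v) (g F v))"
  unfolding vadd_def vsub_def vmul_def vdiv_def
  using ptime_plus[OF assms] ptime_minus[OF assms] ptime_times[OF assms] ptime_divide[OF assms] by auto

lemmas ptime_basic_intros = ptime_id ptime_left ptime_right ptime_Node ptime_If ptime_not ptime_conj
  ptime_disj ptime_less ptime_le ptime_eq ptime_arith_ops
  ptime_is_node' ptime_answer' ptime_floor ptime_const

lemma ptime_neq_0:
  assumes "ptime f"
  shows "ptime (\<lambda>F v. val_of_bool (f F v \<noteq> Num 0))"
proof -
  have eq: "val_of_bool (f F v \<noteq> Num 0) = (if f F v \<noteq> Num 0 then Num 1 else Num 0)" for F v by simp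
  show ?thesis unfolding eq by (rule ptime_if[OF assms ptime_const ptime_const])
qed

text \<open>If a step adds to the accumulator an amount depending only on the list element and the
  input, the accumulator grows linearly with the list. This covers every loop that merely collects
  or selects list entries.\<close>

lemma ptime_foldl_additive:
  assumes f: "ptime (\<lambda>F w. f F (left_of w) (left_of (right_of w)) (right_of (right_of w)))"
    and l: "ptime l" and i: "ptime i" and h: "ptime (\<lambda>F w. h F (left_of w) (right_of w))"
    and le: "\<And>F acc x v. val_size (f F acc x v) \<le> val_size acc + val_size (h F x v) + 3"
  shows "ptime (\<lambda>F v. foldl (\<lambda>acc x. f F acc x v) (i F v) (list_of (l F v)))"
proof -
  obtain kl where l1: "\<And>F v. val_size (l F v) \<le> val_size v ^ kl" using l by (elim ptimeE) blast
  obtain ki where i1: "\<And>F v. val_size (i F v) \<le> val_size v ^ ki" using i by (elim ptimeE) blast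
  obtain kh where h1: "\<And>F v. val_size (h F (left_of v) (right_of v)) \<le> val_size v ^ kh" using h by (elim ptimeE) blast
  let ?B = "\<lambda>x. (1 + x ^ kl + x) ^ kh + 3"
  show ?thesis
  proof (rule ptime_foldl[OF f l i, where q = "\<lambda>x. x ^ ki + x ^ kl * ?B x"])
    fix F v ys zs
    assume ys: "list_of (l F v) = ys @ zs"
    have hb: "val_size (h F x v) + 3 \<le> ?B (val_size v)" if "x \<in> set ys" for x
    proof -
      have "val_size x \<le> val_size v ^ kl"
        using val_size_list_of[of x "l F v"] ys that l1[of F v] by (auto intro: order_trans)
      then have "val_size (Node x v) ^ kh \<le> (1 + val_size v ^ kl + val_size v) ^ kh"
        by (intro power_mono) auto
      then show ?thesis using h1[of F "Node x v"] by simp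
    qed
    have "val_size (foldl (\<lambda>acc x. f F acc x v) acc us) \<le> val_size acc + length us * ?B (val_size v)"
      if "set us \<subseteq> set ys" for us acc
      using that
    proof (induction us arbitrary: acc)
      case (Cons x us)
      then have "val_size (foldl (\<lambda>acc x. f F acc x v) (f F acc x v) us) \<le> val_size (f F acc x v) + length us * ?B (val_size v)"
        by simp
      moreover have "val_size (f F acc x v) \<le> val_size acc + ?B (val_size v)"
        using le[of F acc x v] hb[of x] Cons.prems by simp
      ultimately show ?case by simp
    qed simp
    from this[of ys "i F v"]
    have "val_size (foldl (\<lambda>acc x. f F acc x v) (i F v) ys) \<le> val_size (i F v) + length ys * ?B (val_size v)" by simp
    also have "\<dots> \<le> val_size v ^ ki + val_size v ^ kl * ?B (val_size v)"
    proof (intro add_mono mult_right_mono i1)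
      have "length ys \<le> length (list_of (l F v))" using ys by simp
      also have "\<dots> \<le> val_size v ^ kl" using length_list_of[of "l F v"] l1[of F v] by linarith
      finally show "length ys \<le> val_size v ^ kl" .
    qed simp
    finally show "val_size (foldl (\<lambda>acc x. f F acc x v) (i F v) ys) \<le> val_size v ^ ki + val_size v ^ kl * ?B (val_size v)" .
  qed (intro poly_bounded_intros)+
qed

lemma foldl_Node: "foldl (\<lambda>acc x. Node (f x) acc) (val_of_list ys) xs = val_of_list (map f (rev xs) @ ys)"
  by (induction xs arbitrary: ys) (simp_all flip: val_of_list.simps(2))

lemma ptime_rev:
  assumes "ptime l"
  shows "ptime (\<lambda>F v. vrev (l F v))"
proof -
  have "ptime (\<lambda>F v. foldl (\<lambda>acc x. Node x acc) (Num 0) (list_of (l F v)))"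
    by (rule ptime_foldl_additive[where h="\<lambda>F x v. x"]) (intro ptime_basic_intros assms | simp)+
  then show ?thesis using foldl_Node[of "\<lambda>x. x" "[]"] unfolding vrev_def by simp
qed

lemma ptime_map:
  assumes f: "ptime (\<lambda>F w. f F (left_of w) (right_of w))" and l: "ptime l"
  shows "ptime (\<lambda>F v. vmap (\<lambda>x. f F x v) (l F v))"
proof -
  have "ptime (\<lambda>F v. foldl (\<lambda>acc x. Node (f F x v) acc) (Num 0) (list_of (l F v)))"
  proof (rule ptime_foldl_additive[where h=f and f="\<lambda>F acc x v. Node (f F x v) acc"])
    show "ptime (\<lambda>F w. Node (f F (left_of (right_of w)) (right_of (right_of w))) (left_of w))"
      using ptime_comp[OF f ptime_right0] by (intro ptime_Node ptime_left0)
  qed (use f l in \<open>auto intro: ptime_const\<close>)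
  from ptime_rev[OF this] show ?thesis
    using foldl_Node[of "\<lambda>x. f F x v" "[]" for F v] unfolding vrev_def vmap_def by (simp add: rev_map)
qed

lemma ptime_filter:
  assumes P: "ptime (\<lambda>F w. val_of_bool (P F (left_of w) (right_of w)))" and l: "ptime l"
  shows "ptime (\<lambda>F v. vfilter (\<lambda>x. P F x v) (l F v))"
proof -
  have "ptime (\<lambda>F v. foldl (\<lambda>acc x. if P F x v then Node x acc else acc) (Num 0) (list_of (l F v)))"
  proof (rule ptime_foldl_additive[where h="\<lambda>F x v. x" and f="\<lambda>F acc x v. if P F x v then Node x acc else acc"])
    show "ptime (\<lambda>F w. if P F (left_of (right_of w)) (right_of (right_of w)) then Node (left_of (right_of w)) (left_of w) else left_of w)"
      using ptime_comp[OF P ptime_right0] by (intro ptime_If ptime_basic_intros)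
  qed (use l in \<open>auto intro: ptime_const ptime_left0\<close>)
  moreover have "foldl (\<lambda>acc x. if P F x v then Node x acc else acc) (val_of_list ys) xs =
      val_of_list (rev (filter (\<lambda>x. P F x v) xs) @ ys)" for F v xs ys
    by (induction xs arbitrary: ys) (simp_all flip: val_of_list.simps(2))
  from this[where ys="[]"] have "foldl (\<lambda>acc x. if P F x v then Node x acc else acc) (Num 0) xs =
      val_of_list (rev (filter (\<lambda>x. P F x v) xs))" for F v xs by simp
  ultimately show ?thesis using ptime_rev unfolding vrev_def vfilter_def by fastforce
qed

lemma val_size_val_of_nat: "val_size (val_of_nat n) \<le> 2 + n"
proof -
  have "val_size (Num (of_nat n)) \<le> 1 + n + 1"
  proof (rule val_size_Num_le[where d=1 and p="int n"])
    have "n < 2 ^ n" by simp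
    then have "int n < int (2 ^ n)" by linarith
    then show "\<bar>int n\<bar> < 2 ^ n" by simp
  qed auto
  then show ?thesis unfolding val_of_nat_def by simp
qed

lemma val_size_val_of_list:
  assumes "\<And>x. x \<in> set xs \<Longrightarrow> val_size x \<le> k"
  shows "val_size (val_of_list xs) \<le> 2 + length xs * (1 + k)"
  using assms by (induction xs) (fastforce simp: val_size_0 simp del: val_size.simps(1))+

lemma ptime_enum:
  assumes l: "ptime l"
  shows "ptime (\<lambda>F v. venum (l F v))"
proof -
  obtain kl where l1: "\<And>F v. val_size (l F v) \<le> val_size v ^ kl" using l by (elim ptimeE) blast
  \<comment> \<open>The next index is read off the entry added last, so no separate counter has to
    be carried through the loop.\<close>
  let ?f = "\<lambda>acc x. Node (Node (if is_node acc then vadd (left_of (left_of acc)) (Num 1) else Num 0) x) acc"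
  let ?e = "\<lambda>xs. val_of_list (rev (map (\<lambda>(i, x). Node (val_of_nat i) x) (List.enumerate 0 xs)))"
  have next_index: "(if is_node (?e xs) then vadd (left_of (left_of (?e xs))) (Num 1) else Num 0) = val_of_nat (length xs)" for xs
    by (cases xs rule: rev_cases) (simp_all add: enumerate_append_eq val_of_nat_def vadd_def add.commute)
  have sem: "foldl ?f (Num 0) xs = ?e xs" for xs
  proof (induction xs rule: rev_induct)
    case (snoc x xs)
    show ?case unfolding foldl_append foldl.simps snoc next_index by (simp add: enumerate_append_eq)
  qed simp
  have "ptime (\<lambda>F v. foldl ?f (Num 0) (list_of (l F v)))"
  proof (rule ptime_foldl[where f="\<lambda>F acc x v. ?f acc x" and q="\<lambda>x. 2 + x ^ kl * (1 + (1 + (2 + x ^ kl) + x ^ kl))"])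
    show "ptime (\<lambda>F w. ?f (left_of w) (left_of (right_of w)))" by (intro ptime_basic_intros)
    fix F v ys zs
    assume ys: "list_of (l F v) = ys @ zs"
    have len: "length ys \<le> val_size v ^ kl"
      using length_list_of[of "l F v"] l1[of F v] ys by simp
    have "val_size y \<le> 1 + (2 + val_size v ^ kl) + val_size v ^ kl"
      if y: "y \<in> set (rev (map (\<lambda>(i, x). Node (val_of_nat i) x) (List.enumerate 0 ys)))" for y
    proof -
      obtain i x where y: "y = Node (val_of_nat i) x" "i < length ys" "x \<in> set ys"
      proof -
        from y obtain p where p: "p \<in> set (List.enumerate 0 ys)" "y = (case p of (i, x) \<Rightarrow> Node (val_of_nat i) x)"
          by auto
        then have "fst p < length ys" "snd p = ys ! fst p" by (auto simp: in_set_enumerate_eq)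
        then show thesis using p(2) by (intro that[of "fst p" "snd p"]) (auto simp: case_prod_beta)
      qed
      moreover have "val_size x \<le> val_size v ^ kl"
        using val_size_list_of[of x "l F v"] y(3) ys l1[of F v] by simp
      ultimately show ?thesis using val_size_val_of_nat[of i] len by simp
    qed
    then have "val_size (foldl ?f (Num 0) ys) \<le> 2 + length ys * (1 + (1 + (2 + val_size v ^ kl) + val_size v ^ kl))"
      unfolding sem by (intro order_trans[OF val_size_val_of_list]) auto
    also have "\<dots> \<le> 2 + val_size v ^ kl * (1 + (1 + (2 + val_size v ^ kl) + val_size v ^ kl))"
      using len by (intro add_left_mono mult_right_mono) auto
    finally show "val_size (foldl ?f (Num 0) ys) \<le> 2 + val_size v ^ kl * (1 + (1 + (2 + val_size v ^ kl) + val_size v ^ kl))" .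
  qed (intro l ptime_const poly_bounded_intros)+
  from ptime_rev[OF this] show ?thesis unfolding sem vrev_def venum_def by simp
qed

text \<open>Partial sums are bounded through the product of all denominators seen so far. A summand
  contributes at most \<open>K\<close> bits to it and one more bit covers the addition, so the size
  is linear in the number of summands.\<close>

lemma ptime_sum:
  assumes f: "ptime (\<lambda>F w. f F (left_of w) (right_of w))" and l: "ptime l"
  shows "ptime (\<lambda>F v. vsum (\<lambda>x. f F x v) (l F v))"
proof -
  obtain kl where l1: "\<And>F v. val_size (l F v) \<le> val_size v ^ kl" using l by (elim ptimeE) blast
  obtain kf where f1: "\<And>F v. val_size (f F (left_of v) (right_of v)) \<le> val_size v ^ kf" using f by (elim ptimeE) blast
  let ?f = "\<lambda>F acc x v. vadd acc (f F x v)"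
  let ?B = "\<lambda>x. (1 + x ^ kl + x) ^ kf"
  have sem: "foldl (\<lambda>acc x. ?f F acc x v) (Num 0) xs = Num (\<Sum>x\<leftarrow>xs. num_of (f F x v))" for F v xs
    by (induction xs rule: rev_induct) (simp_all add: vadd_def)
  have "ptime (\<lambda>F v. foldl (\<lambda>acc x. ?f F acc x v) (Num 0) (list_of (l F v)))"
  proof (rule ptime_foldl[where f="?f" and q="\<lambda>x. 1 + 2 * ((?B x + 1) * x ^ kl + 1)"])
    show "ptime (\<lambda>F w. vadd (left_of w) (f F (left_of (right_of w)) (right_of (right_of w))))"
      using ptime_comp[OF f ptime_right0] by (intro ptime_basic_intros)
    fix F v ys zs
    assume ys: "list_of (l F v) = ys @ zs"
    have len: "length ys \<le> val_size v ^ kl"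
      using length_list_of[of "l F v"] l1[of F v] ys by simp
    define K where "K = ?B (val_size v)"
    have fK: "val_size (f F x v) \<le> Suc K" if "x \<in> set ys" for x
    proof -
      have "val_size x \<le> val_size v ^ kl"
        using val_size_list_of[of x "l F v"] ys that l1[of F v] by (auto intro: order_trans)
      then have "val_size (Node x v) ^ kf \<le> K"
        unfolding K_def by (intro power_mono) auto
      then show ?thesis using f1[of F "Node x v"] by simp
    qed
    have "\<exists>p d. d > 0 \<and> (\<Sum>x\<leftarrow>us. num_of (f F x v)) = of_int p / of_int d \<and>
        \<bar>p\<bar> < 2 ^ ((K + 1) * length us + 1) \<and> d < 2 ^ ((K + 1) * length us + 1)"
      if "set us \<subseteq> set ys" for us
      using that
    proof (induction us)
      case Nil
      show ?case by (intro exI[of _ 0] exI[of _ 1]) simp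
    next
      case (Cons x us)
      let ?e = "(K + 1) * length us + 1"
      obtain p d where pd: "d > 0" "(\<Sum>x\<leftarrow>us. num_of (f F x v)) = of_int p / of_int d"
        "\<bar>p\<bar> < 2 ^ ?e" "d < 2 ^ ?e" using Cons by auto
      obtain p' d' where pd': "d' > 0" "num_of (f F x v) = of_int p' / of_int d'" "\<bar>p'\<bar> < 2 ^ K" "d' < 2 ^ K"
        using fK[of x] Cons.prems by (auto elim: val_size_Num_D)
      have "\<bar>p\<bar> * d' < 2 ^ ?e * 2 ^ K" "d * \<bar>p'\<bar> < 2 ^ ?e * 2 ^ K" "d * d' < 2 ^ ?e * 2 ^ K"
        by (rule mult_strict_mono; use pd pd' in simp)+
      then have b: "\<bar>p * d' + d * p'\<bar> < 2 ^ (?e + K + 1)" "d * d' < 2 ^ (?e + K + 1)"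
        using pd(1) pd'(1) abs_triangle_ineq[of "p * d'" "d * p'"] by (simp_all add: power_add abs_mult)
      show ?case
      proof (intro exI conjI)
        show "0 < d * d'" using pd pd' by simp
        show "(\<Sum>x\<leftarrow>x # us. num_of (f F x v)) = of_int (p * d' + d * p') / of_int (d * d')"
          using pd(1) pd'(1) unfolding list.map sum_list.Cons pd(2) pd'(2) by (simp add: field_simps)
        have "(K + 1) * length (x # us) + 1 = ?e + K + 1" by simp
        then show "\<bar>p * d' + d * p'\<bar> < 2 ^ ((K + 1) * length (x # us) + 1)" "d * d' < 2 ^ ((K + 1) * length (x # us) + 1)"
          using b by metis+
      qed
    qed
    from this[of ys] obtain p d where pd: "d > 0" "(\<Sum>x\<leftarrow>ys. num_of (f F x v)) = of_int p / of_int d"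
        "\<bar>p\<bar> < 2 ^ ((K + 1) * length ys + 1)" "d < 2 ^ ((K + 1) * length ys + 1)" by auto
    have "val_size (foldl (\<lambda>acc x. ?f F acc x v) (Num 0) ys) \<le> 1 + ((K + 1) * length ys + 1) + ((K + 1) * length ys + 1)"
      unfolding sem by (rule val_size_Num_le[OF pd])
    also have "(K + 1) * length ys \<le> (K + 1) * val_size v ^ kl" using len by (rule mult_left_mono) simp
    finally show "val_size (foldl (\<lambda>acc x. ?f F acc x v) (Num 0) ys) \<le> 1 + 2 * ((?B (val_size v) + 1) * val_size v ^ kl + 1)"
      unfolding K_def by simp
  qed (intro l ptime_const poly_bounded_intros)+
  then show ?thesis unfolding sem vsum_def .
qed

fun binary_fraction :: "bool list \<Rightarrow> 'a :: field" where
  "binary_fraction [] = 0"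
| "binary_fraction (b # bs) = (of_bool b + binary_fraction bs) / 2"

lemma vfrac_eq: "vfrac v = Num (binary_fraction (rev (map (\<lambda>x. x \<noteq> Num 0) (list_of v))))"
proof -
  have "foldl (\<lambda>q x. vdiv (vadd q (if x \<noteq> Num 0 then Num 1 else Num 0)) (Num 2)) (Num 0) xs =
    Num (binary_fraction (rev (map (\<lambda>x. x \<noteq> Num 0) xs)))" for xs
    by (induction xs rule: rev_induct) (auto simp: vdiv_def vadd_def add.commute)
  then show ?thesis unfolding vfrac_def .
qed

text \<open>After \<open>t\<close> bits the accumulator is a fraction over \<open>2 ^ t\<close>, so
  numerator and denominator gain one bit per step, which the general bound for an arithmetic
  operation would not show.\<close>

lemma ptime_frac:
  assumes l: "ptime l"
  shows "ptime (\<lambda>F v. vfrac (l F v))"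
proof -
  obtain kl where l1: "\<And>F v. val_size (l F v) \<le> val_size v ^ kl" using l by (elim ptimeE) blast
  let ?f = "\<lambda>q x. vdiv (vadd q (if x \<noteq> Num 0 then Num 1 else Num 0)) (Num 2)"
  have "ptime (\<lambda>F v. foldl ?f (Num 0) (list_of (l F v)))"
  proof (rule ptime_foldl[where f="\<lambda>F acc x v. ?f acc x" and q="\<lambda>x. 1 + (x ^ kl + 1) + (x ^ kl + 1)"])
    show "ptime (\<lambda>F w. ?f (left_of w) (left_of (right_of w)))"
      by (intro ptime_If ptime_neq_0 ptime_basic_intros)
    fix F v ys zs
    assume ys: "list_of (l F v) = ys @ zs"
    have len: "length ys \<le> val_size v ^ kl"
      using length_list_of[of "l F v"] l1[of F v] ys by simp
    have "\<exists>p. foldl ?f (Num 0) us = Num (of_int p / of_int (2 ^ length us)) \<and> 0 \<le> p \<and> p < 2 ^ length us" for us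
    proof (induction us rule: rev_induct)
      case (snoc x us)
      then obtain p where "foldl ?f (Num 0) us = Num (of_int p / of_int (2 ^ length us))" "0 \<le> p" "p < 2 ^ length us" by blast
      then show ?case
        by (intro exI[of _ "if x \<noteq> Num 0 then p + 2 ^ length us else p"]) (auto simp: vdiv_def vadd_def field_simps)
    qed simp
    then obtain p where p: "foldl ?f (Num 0) ys = Num (of_int p / of_int (2 ^ length ys))" "0 \<le> p" "p < 2 ^ length ys" by blast
    have "val_size (foldl ?f (Num 0) ys) \<le> 1 + (length ys + 1) + (length ys + 1)"
      unfolding p(1) by (rule val_size_Num_le[where d="2 ^ length ys" and p=p]) (use p in auto)
    then show "val_size (foldl ?f (Num 0) ys) \<le> 1 + (val_size v ^ kl + 1) + (val_size v ^ kl + 1)"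
      using len by linarith
  qed (intro l ptime_const poly_bounded_intros)+
  then show ?thesis unfolding vfrac_def .
qed

lemma ptime_best:
  assumes l: "ptime l"
  shows "ptime (\<lambda>F v. vbest (l F v))"
  unfolding vbest_def
  by (rule ptime_foldl_additive[where h="\<lambda>F x v. x"]) (intro ptime_basic_intros l | simp)+

lemma ptime_basis:
  assumes l: "ptime l"
  shows "ptime (\<lambda>F v. vbasis F (l F v))"
  unfolding vbasis_def
  by (rule ptime_foldl_additive[where h="\<lambda>F x v. x"]) (intro ptime_basic_intros l | simp)+

lemmas ptime_intros = ptime_id ptime_left ptime_right ptime_Node ptime_If ptime_not ptime_conj
  ptime_disj ptime_less ptime_le ptime_eq ptime_arith_ops ptime_neq_0
  ptime_is_node' ptime_answer' ptime_floor ptime_map ptime_filter ptime_rev ptime_enum ptime_sum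
  ptime_frac ptime_best ptime_basis ptime_const

lemma ptime_computes_within:
  assumes "ptime f"
  obtains c k where "\<forall>F v T. val_size v ^ k \<le> T \<longrightarrow> computes_within F c T v (f F v)"
proof -
  obtain k where "\<And>b. \<exists>c. implements b c f k" using assms by (elim ptimeE) blast
  then obtain c where c: "implements 0 c f k" by blast
  have "computes_within F c T v (f F v)" if "val_size v ^ k \<le> T" for F v T
    unfolding computes_within_def
    using implementsD[OF c, of F "(\<lambda>_. Num 0)(0 := v)"] that by (auto intro: order_trans)
  then show thesis using that by blast
qed

section \<open>Matroid optimisation: exchange prices and the greedy basis\<close>

section \<open>Weighted matroids\<close>

lemma matroidD:
  assumes "matroid E F"
  shows "finite E" "{} \<in> F" "\<And>A. A \<in> F \<Longrightarrow> A \<subseteq> E" "\<And>A. A \<in> F \<Longrightarrow> finite A" "finite F"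
    "\<And>A B. A \<in> F \<Longrightarrow> B \<subseteq> A \<Longrightarrow> B \<in> F"
    "\<And>A B. A \<in> F \<Longrightarrow> B \<in> F \<Longrightarrow> card A < card B \<Longrightarrow> \<exists>x\<in>B - A. insert x A \<in> F"
proof -
  show fE: "finite E" and "{} \<in> F" using assms unfolding matroid_def by auto
  show sub: "A \<in> F \<Longrightarrow> A \<subseteq> E" for A using assms unfolding matroid_def by auto
  then show "A \<in> F \<Longrightarrow> finite A" for A using fE finite_subset by blast
  show "finite F" using assms fE unfolding matroid_def by (meson finite_Pow_iff finite_subset)
  show "A \<in> F \<Longrightarrow> B \<subseteq> A \<Longrightarrow> B \<in> F" for A B using assms unfolding matroid_def by auto
  show "A \<in> F \<Longrightarrow> B \<in> F \<Longrightarrow> card A < card B \<Longrightarrow> \<exists>x\<in>B - A. insert x A \<in> F" for A B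
    using assms unfolding matroid_def by auto
qed

text \<open>Maximum weight in the matroid contracted by \<open>A\<close>: what can still be gained
  once \<open>A\<close> has been accepted.\<close>

definition max_weight :: "'a set set \<Rightarrow> 'a set \<Rightarrow> ('a \<Rightarrow> real) \<Rightarrow> real" where
  "max_weight F A v = Max ((\<lambda>S. sum v (S - A)) ` {S \<in> F. A \<subseteq> S})"

lemma max_weight_ge:
  assumes "matroid E F" "S \<in> F" "A \<subseteq> S"
  shows "sum v (S - A) \<le> max_weight F A v"
  unfolding max_weight_def using assms matroidD(5)[OF assms(1)] by (intro Max_ge) auto

lemma max_weight_empty_ge: "matroid E F \<Longrightarrow> S \<in> F \<Longrightarrow> sum v S \<le> max_weight F {} v"
  using max_weight_ge[of E F S "{}" v] by simp

lemma max_weight_attained: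
  assumes "matroid E F" "A \<in> F"
  obtains S where "S \<in> F" "A \<subseteq> S" "max_weight F A v = sum v (S - A)"
proof -
  have "max_weight F A v \<in> (\<lambda>S. sum v (S - A)) ` {S \<in> F. A \<subseteq> S}"
    unfolding max_weight_def using assms matroidD(5)[OF assms(1)] by (intro Max_in) auto
  then show ?thesis using that by auto
qed

lemma max_weight_mono:
  assumes "matroid E F" "A \<in> F" "\<And>i. i \<in> E \<Longrightarrow> i \<notin> A \<Longrightarrow> u i \<le> v i"
  shows "max_weight F A u \<le> max_weight F A v"
proof -
  obtain S where S: "S \<in> F" "A \<subseteq> S" "max_weight F A u = sum u (S - A)"
    using max_weight_attained[OF assms(1,2)] .
  have "sum u (S - A) \<le> sum v (S - A)"
    using assms(3) matroidD(3)[OF assms(1) S(1)] by (intro sum_mono) auto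
  then show ?thesis using S max_weight_ge[OF assms(1) S(1,2), of v] by simp
qed

lemma max_weight_cong:
  assumes "matroid E F" "A \<in> F" "\<And>i. i \<in> E \<Longrightarrow> i \<notin> A \<Longrightarrow> u i = v i"
  shows "max_weight F A u = max_weight F A v"
  by (intro antisym max_weight_mono[OF assms(1,2)]) (simp_all add: assms(3))

lemma max_weight_nonneg: "matroid E F \<Longrightarrow> A \<in> F \<Longrightarrow> 0 \<le> max_weight F A v"
  using max_weight_ge[of E F A A v] by simp

lemma max_weight_none:
  assumes "matroid E F" "A \<in> F" "\<And>i. i \<notin> A \<Longrightarrow> insert i A \<notin> F"
  shows "max_weight F A v = 0"
proof -
  obtain S where S: "S \<in> F" "A \<subseteq> S" "max_weight F A v = sum v (S - A)"
    using max_weight_attained[OF assms(1,2)] .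
  have "S - A = {}"
  proof (rule ccontr)
    assume "S - A \<noteq> {}"
    then obtain i where i: "i \<in> S" "i \<notin> A" by auto
    then show False using assms(3)[of i] matroidD(6)[OF assms(1) S(1), of "insert i A"] S(2) by auto
  qed
  then show ?thesis using S by simp
qed

lemma augment_to_card:
  assumes "matroid E F" "A \<in> F" "S \<in> F" "card A \<le> card S"
  shows "\<exists>S'\<in>F. A \<subseteq> S' \<and> S' \<subseteq> A \<union> S \<and> card S' = card S"
  using assms(2,4)
proof (induction "card S - card A" arbitrary: A)
  case 0
  then show ?case by (intro bexI[of _ A]) auto
next
  case (Suc k)
  then have "card A < card S" by linarith
  then obtain x where x: "x \<in> S - A" "insert x A \<in> F"
    using matroidD(7)[OF assms(1) Suc(3) assms(3)] by blast
  then have "card (insert x A) = Suc (card A)" using matroidD(4)[OF assms(1)] Suc by auto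
  then obtain S' where "S' \<in> F" "insert x A \<subseteq> S'" "S' \<subseteq> insert x A \<union> S" "card S' = card S"
    using Suc(1)[of "insert x A"] Suc(2,4) x(2) by force
  then show ?case using x by (intro bexI[of _ S']) auto
qed

text \<open>When \<open>S\<close> is larger than \<open>A\<close>, augmenting
  \<open>insert i A\<close> from \<open>S\<close> up to the size of \<open>S\<close> keeps all of
  \<open>S - A\<close> except one element, whose weight is at most \<open>w\<close>.\<close>

lemma exchange_weight:
  assumes m: "matroid E F" and i: "insert i A \<in> F" "i \<notin> A" and S: "S \<in> F" "A \<subseteq> S" "i \<notin> S"
    and w: "0 \<le> w" "\<And>j. j \<in> S - A \<Longrightarrow> v j \<le> w"
  shows "sum v (S - A) - w \<le> max_weight F (insert i A) v"
proof (cases "S = A")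
  case True
  then show ?thesis using w max_weight_nonneg[OF m i(1), of v] by simp
next
  case False
  have fin: "finite S" "finite A" using matroidD(4)[OF m] S i matroidD(6)[OF m i(1), of A] by auto
  then have "card A < card S" using S False by (intro psubset_card_mono) auto
  then have "card (insert i A) \<le> card S" using fin i by simp
  then obtain S' where S': "S' \<in> F" "insert i A \<subseteq> S'" "S' \<subseteq> insert i A \<union> S" "card S' = card S"
    using augment_to_card[OF m i(1) S(1)] by blast
  have "\<not> S \<subseteq> S'"
  proof
    assume "S \<subseteq> S'"
    then have "insert i S \<subseteq> S'" using S' by auto
    then have "card (insert i S) \<le> card S'" using matroidD(4)[OF m S'(1)] by (intro card_mono) auto
    then show False using S' fin S by simp
  qed
  then obtain j where j: "j \<in> S" "j \<notin> S'" by auto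
  have "S' \<subseteq> insert i (S - {j})" using S' j S by auto
  moreover have "card (insert i (S - {j})) = card S" using fin S j card_Suc_Diff1[of S j] by simp
  ultimately have "S' = insert i (S - {j})" using S'(4) fin by (intro card_seteq) auto
  then have "S' - insert i A = (S - A) - {j}" using S i by auto
  moreover have "sum v ((S - A) - {j}) = sum v (S - A) - v j"
    using fin j S'(2) by (subst sum_diff1) auto
  ultimately have "sum v (S' - insert i A) = sum v (S - A) - v j" by simp
  moreover have "v j \<le> w" using w(2)[of j] j S' by auto
  ultimately show ?thesis using max_weight_ge[OF m S'(1,2), of v] by linarith
qed

lemma max_weight_price:
  assumes m: "matroid E F" and i: "insert i A \<in> F" "i \<notin> A"
  obtains y where "0 \<le> y" "\<forall>x. max_weight F A (v(i := x)) = max_weight F (insert i A) v + max x y"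
    "\<forall>b\<ge>0. (\<forall>j. j \<noteq> i \<longrightarrow> j \<notin> A \<longrightarrow> insert j A \<in> F \<longrightarrow> v j \<le> b) \<longrightarrow> y \<le> b"
proof -
  let ?\<S> = "{S \<in> F. A \<subseteq> S \<and> i \<notin> S}" and ?\<T> = "{S \<in> F. insert i A \<subseteq> S}"
  define P Q where "P = max_weight F (insert i A) v" and "Q = Max ((\<lambda>S. sum v (S - A)) ` ?\<S>)"
  have A: "A \<in> F" by (rule matroidD(6)[OF m i(1)]) auto
  have fin: "finite ?\<S>" "finite ?\<T>" "?\<S> \<noteq> {}" "?\<T> \<noteq> {}" using matroidD(5)[OF m] A i by auto
  have eq: "max_weight F A (v(i := x)) = max (P + x) Q" for x
  proof -
    have split: "{S \<in> F. A \<subseteq> S} = ?\<T> \<union> ?\<S>" by auto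
    have T: "sum (v(i := x)) (S - A) = sum v (S - insert i A) + x" if "S \<in> ?\<T>" for S
    proof -
      have "finite S" using that matroidD(4)[OF m] by auto
      have "S - A = insert i (S - insert i A)" using that i by auto
      then have "sum (v(i := x)) (S - A) = sum (v(i := x)) (insert i (S - insert i A))" by (rule arg_cong)
      also have "\<dots> = x + sum (v(i := x)) (S - insert i A)" using \<open>finite S\<close> by simp
      also have "sum (v(i := x)) (S - insert i A) = sum v (S - insert i A)" by (intro sum.cong) auto
      finally show ?thesis by simp
    qed
    have S: "sum (v(i := x)) (S - A) = sum v (S - A)" if "S \<in> ?\<S>" for S
      using that by (intro sum.cong) auto
    have "(\<lambda>S. sum (v(i := x)) (S - A)) ` ?\<T> = (\<lambda>y. y + x) ` (\<lambda>S. sum v (S - insert i A)) ` ?\<T>"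
      unfolding image_image by (rule image_cong[OF refl T])
    moreover have "Max ((\<lambda>y. y + x) ` (\<lambda>S. sum v (S - insert i A)) ` ?\<T>) = P + x"
      unfolding P_def max_weight_def using fin
      by (subst mono_Max_commute[where f="\<lambda>y. y + x", symmetric]) (auto simp: mono_def)
    moreover have "(\<lambda>S. sum (v(i := x)) (S - A)) ` ?\<S> = (\<lambda>S. sum v (S - A)) ` ?\<S>"
      by (rule image_cong[OF refl S])
    ultimately show ?thesis
      unfolding max_weight_def split image_Un Q_def using fin by (subst Max_Un) auto
  qed
  have "P \<le> Q"
  proof -
    obtain S where S: "S \<in> F" "insert i A \<subseteq> S" "P = sum v (S - insert i A)"
      unfolding P_def using max_weight_attained[OF m i(1)] .
    have "S - {i} \<in> ?\<S>" using S i matroidD(6)[OF m S(1), of "S - {i}"] by auto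
    then have "sum v (S - {i} - A) \<le> Q" unfolding Q_def using fin by (intro Max_ge) auto
    moreover have "S - {i} - A = S - insert i A" by auto
    ultimately show ?thesis using S by simp
  qed
  moreover have "Q - P \<le> b"
    if b: "0 \<le> b" "\<And>j. j \<noteq> i \<Longrightarrow> j \<notin> A \<Longrightarrow> insert j A \<in> F \<Longrightarrow> v j \<le> b" for b
  proof -
    have "Q \<in> (\<lambda>S. sum v (S - A)) ` ?\<S>" unfolding Q_def using fin by (intro Max_in) auto
    then obtain S where S: "S \<in> F" "A \<subseteq> S" "i \<notin> S" "Q = sum v (S - A)" by auto
    have "sum v (S - A) - b \<le> P" unfolding P_def
    proof (rule exchange_weight[OF m i S(1-3) b(1)])
      fix j assume "j \<in> S - A"
      then show "v j \<le> b" using S matroidD(6)[OF m S(1), of "insert j A"] by (intro b(2)) auto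
    qed
    then show ?thesis using S by simp
  qed
  moreover have "max_weight F A (v(i := x)) = max_weight F (insert i A) v + max x (Q - P)" for x
    unfolding eq P_def[symmetric] by (simp add: max_def)
  ultimately show thesis using that[of "Q - P"] by simp
qed

lemma max_weight_loop:
  assumes m: "matroid E F" and i: "insert i A \<notin> F" and A: "A \<in> F"
  shows "max_weight F A (v(i := x)) = max_weight F A v"
proof -
  have "sum (v(i := x)) (S - A) = sum v (S - A)" if "S \<in> F" "A \<subseteq> S" for S
  proof (intro sum.cong refl)
    fix j assume "j \<in> S - A"
    then have "insert j A \<in> F" using matroidD(6)[OF m that(1), of "insert j A"] that by auto
    then show "(v(i := x)) j = v j" using i by auto
  qed
  then show ?thesis unfolding max_weight_def by (intro arg_cong[where f=Max] image_cong) auto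
qed

text \<open>The price of \<open>i\<close> is bounded by the weights of its competitors, hence by
  \<open>v i\<close> itself.\<close>

lemma max_weight_accept:
  assumes m: "matroid E F" and i: "insert i A \<in> F" "i \<notin> A" and v: "0 \<le> v i"
    and best: "\<And>j. j \<noteq> i \<Longrightarrow> j \<notin> A \<Longrightarrow> insert j A \<in> F \<Longrightarrow> v j \<le> v i"
  shows "max_weight F A v = v i + max_weight F (insert i A) v"
proof -
  obtain y where y: "0 \<le> y" "\<forall>x. max_weight F A (v(i := x)) = max_weight F (insert i A) v + max x y"
    "\<forall>b\<ge>0. (\<forall>j. j \<noteq> i \<longrightarrow> j \<notin> A \<longrightarrow> insert j A \<in> F \<longrightarrow> v j \<le> b) \<longrightarrow> y \<le> b"
    using max_weight_price[OF m i, of v] .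
  have "y \<le> v i" using v best y(3) by auto
  then show ?thesis using y(2)[rule_format, of "v i"] by simp
qed

lemma max_weight_accept_le:
  assumes m: "matroid E F" and i: "insert i A \<in> F" "i \<notin> A"
  shows "v i + max_weight F (insert i A) v \<le> max_weight F A v"
proof -
  obtain y where "\<forall>x. max_weight F A (v(i := x)) = max_weight F (insert i A) v + max x y"
    by (rule max_weight_price[OF m i, of v]) (rule that)
  from this[rule_format, of "v i"] show ?thesis by simp
qed

subsection \<open>The greedy solution\<close>

definition basis_of :: "'a set set \<Rightarrow> 'a set \<Rightarrow> 'a set \<Rightarrow> bool" where
  "basis_of F T B \<longleftrightarrow> B \<in> F \<and> B \<subseteq> T \<and> (\<forall>x\<in>T - B. insert x B \<notin> F)"

text \<open>For \<open>i\<close> outside \<open>T\<close> this says that \<open>i\<close> is not in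
  the closure of \<open>T\<close>. A single basis decides it, and that is what the program
  tests.\<close>

definition unspanned :: "'a set set \<Rightarrow> 'a set \<Rightarrow> 'a \<Rightarrow> bool" where
  "unspanned F T i \<longleftrightarrow> (\<forall>B. basis_of F T B \<longrightarrow> insert i B \<in> F)"

lemma basis_extension:
  assumes "matroid E F" "A \<in> F" "A \<subseteq> T"
  obtains B where "basis_of F T B" "A \<subseteq> B"
proof -
  let ?C = "{S \<in> F. A \<subseteq> S \<and> S \<subseteq> T}"
  have "finite ?C" "?C \<noteq> {}" using matroidD(5)[OF assms(1)] assms by auto
  from finite_has_maximal[OF this] obtain B where B: "B \<in> ?C" "\<forall>S\<in>?C. B \<subseteq> S \<longrightarrow> B = S" by (elim bexE)
  have "insert x B \<notin> F" if x: "x \<in> T - B" for x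
  proof
    assume "insert x B \<in> F"
    then have "insert x B \<in> ?C" using B(1) x by auto
    then have "B = insert x B" using B(2) by (meson subset_insertI)
    then show False using x by auto
  qed
  then show thesis using B by (intro that[of B]) (auto simp: basis_of_def)
qed

lemma basis_card_ge:
  assumes "matroid E F" "basis_of F T B" "C \<in> F" "C \<subseteq> T"
  shows "card C \<le> card B"
proof (rule ccontr)
  assume "\<not> card C \<le> card B"
  then obtain x where "x \<in> C - B" "insert x B \<in> F"
    using matroidD(7)[OF assms(1), of B C] assms by (auto simp: basis_of_def)
  then show False using assms by (auto simp: basis_of_def)
qed

text \<open>Bases of \<open>T\<close> have equal size, so another basis \<open>B'\<close> can be
  augmented from \<open>insert i B\<close>, and maximality of \<open>B'\<close> within
  \<open>T\<close> leaves \<open>i\<close> as the only possible new element.\<close>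

lemma unspanned_basis_iff:
  assumes m: "matroid E F" and B: "basis_of F T B" and i: "i \<notin> T"
  shows "unspanned F T i \<longleftrightarrow> insert i B \<in> F"
proof
  assume *: "insert i B \<in> F"
  show "unspanned F T i" unfolding unspanned_def
  proof (intro allI impI)
    fix B' assume B': "basis_of F T B'"
    have "card B' \<le> card B" using basis_card_ge[OF m B, of B'] B' by (auto simp: basis_of_def)
    moreover have "i \<notin> B" "finite B" using B i matroidD(4)[OF m] by (auto simp: basis_of_def)
    ultimately have "card B' < card (insert i B)" by simp
    then obtain x where x: "x \<in> insert i B - B'" "insert x B' \<in> F"
      using matroidD(7)[OF m, of B' "insert i B"] * B' by (auto simp: basis_of_def)
    then have "x = i" using B B' by (auto simp: basis_of_def)
    then show "insert i B' \<in> F" using x by simp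
  qed
qed (use B in \<open>simp add: unspanned_def\<close>)

lemma unspanned_mono:
  assumes m: "matroid E F" and "unspanned F T' i" "T \<subseteq> T'"
  shows "unspanned F T i"
  unfolding unspanned_def
proof (intro allI impI)
  fix B assume B: "basis_of F T B"
  then obtain B' where "basis_of F T' B'" "B \<subseteq> B'"
    using basis_extension[OF m, of B T'] assms(3) by (auto simp: basis_of_def)
  then show "insert i B \<in> F" using assms(2) matroidD(6)[OF m, of "insert i B'" "insert i B"]
    by (auto simp: unspanned_def)
qed

definition ahead :: "'a::linorder set \<Rightarrow> ('a \<Rightarrow> real) \<Rightarrow> 'a \<Rightarrow> 'a set" where
  "ahead E v i = {j \<in> E. v i < v j \<or> v j = v i \<and> j < i}"

text \<open>The greedy algorithm without its run: an element is kept iff it is not spanned by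
  everything ahead of it. Membership needs no knowledge of earlier decisions and is visibly monotone
  in the weights.\<close>

definition greedy_set :: "'a::linorder set set \<Rightarrow> 'a set \<Rightarrow> ('a \<Rightarrow> real) \<Rightarrow> 'a set" where
  "greedy_set F E v = {i \<in> E. unspanned F (ahead E v i) i}"

text \<open>Peeling off the element of least weight, with the largest number among ties, leaves an
  initial segment of the greedy order; this drives the two inductions below.\<close>

lemma last_in_segment:
  fixes v :: "'a::linorder \<Rightarrow> real"
  assumes "finite U" "U \<noteq> {}" "U \<subseteq> E" "\<forall>i\<in>U. ahead E v i \<subseteq> U"
  obtains i where "i \<in> U" "U = insert i (ahead E v i)" "\<forall>j\<in>ahead E v i. ahead E v j \<subseteq> ahead E v i"
    "\<forall>j\<in>U. v i \<le> v j"
proof -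
  define m where "m = Min (v ` U)"
  have m: "m \<in> v ` U" "\<And>j. j \<in> U \<Longrightarrow> m \<le> v j" unfolding m_def using assms by (auto intro: Min_in)
  define i where "i = Max {j \<in> U. v j = m}"
  have "{j \<in> U. v j = m} \<noteq> {}" using m by auto
  then have i: "i \<in> {j \<in> U. v j = m}" unfolding i_def using assms by (intro Max_in) auto
  have i2: "j \<le> i" if "j \<in> U" "v j = m" for j unfolding i_def using that assms by (intro Max_ge) auto
  show thesis
  proof (rule that[of i])
    show "i \<in> U" using i by auto
    show "U = insert i (ahead E v i)"
    proof
      show "U \<subseteq> insert i (ahead E v i)"
      proof
        fix j assume j: "j \<in> U"
        then have jE: "j \<in> E" using assms(3) by blast
        have vi: "v i = m" using i by simp
        show "j \<in> insert i (ahead E v i)"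
        proof (cases "v j = m")
          case True
          then show ?thesis using i2[OF j] jE vi by (auto simp: ahead_def)
        next
          case False
          then have "m < v j" using m(2)[OF j] by simp
          then show ?thesis using jE vi by (simp add: ahead_def)
        qed
      qed
      have "i \<in> U" using i by simp
      then show "insert i (ahead E v i) \<subseteq> U" using bspec[OF assms(4)] by simp
    qed
    show "\<forall>j\<in>ahead E v i. ahead E v j \<subseteq> ahead E v i"
    proof (intro ballI subsetI)
      fix j k assume "j \<in> ahead E v i" "k \<in> ahead E v j"
      then show "k \<in> ahead E v i" unfolding ahead_def mem_Collect_eq
        by (metis order_less_trans)
    qed
    have "v i = m" using i by simp
    then show "\<forall>j\<in>U. v i \<le> v j" using m(2) by simp
  qed
qed

text \<open>Treating all initial segments at once suits the induction: the last element of a segment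
  is tested against exactly the rest of that segment.\<close>

lemma greedy_set_basis:
  fixes v :: "'a::linorder \<Rightarrow> real"
  assumes m: "matroid E F" and U: "U \<subseteq> E" "\<forall>i\<in>U. ahead E v i \<subseteq> U"
  shows "basis_of F U (greedy_set F E v \<inter> U)"
proof -
  have "finite U" by (rule finite_subset[OF U(1) matroidD(1)[OF m]])
  then show ?thesis using U
  proof (induction "card U" arbitrary: U)
    case 0
    then have "U = {}" by simp
    then show ?case using matroidD(2)[OF m] by (simp add: basis_of_def)
  next
    case (Suc k)
    have "U \<noteq> {}" using Suc(2) by auto
    obtain i where i: "i \<in> U" "U = insert i (ahead E v i)"
      "\<forall>j\<in>ahead E v i. ahead E v j \<subseteq> ahead E v i"
      by (rule last_in_segment[OF Suc(3) \<open>U \<noteq> {}\<close> Suc(4,5)]) (rule that)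
    let ?U = "ahead E v i" and ?G = "greedy_set F E v"
    have iU: "i \<notin> ?U" by (simp add: ahead_def)
    have fin: "finite ?U" "?U \<subseteq> E"
      using finite_subset[OF Suc(5)[rule_format, OF i(1)] Suc(3)] by (auto simp: ahead_def)
    have "card U = Suc (card ?U)" by (subst i(2)) (use fin iU in simp)
    then have "k = card ?U" using Suc(2) by simp
    then have B: "basis_of F ?U (?G \<inter> ?U)" by (rule Suc(1)[OF _ fin i(3)])
    have iE: "i \<in> E" using i(1) Suc(4) by auto
    have us: "unspanned F ?U i \<longleftrightarrow> insert i (?G \<inter> ?U) \<in> F" by (rule unspanned_basis_iff[OF m B iU])
    have iG: "i \<in> ?G \<longleftrightarrow> insert i (?G \<inter> ?U) \<in> F" using us iE by (simp add: greedy_set_def)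
    show ?case
    proof (cases "i \<in> ?G")
      case True
      then have eq: "?G \<inter> U = insert i (?G \<inter> ?U)" by (subst i(2)) auto
      have "insert x (insert i (?G \<inter> ?U)) \<notin> F" if "x \<in> U - ?G \<inter> U" for x
      proof
        assume "insert x (insert i (?G \<inter> ?U)) \<in> F"
        then have "insert x (?G \<inter> ?U) \<in> F" by (rule matroidD(6)[OF m]) auto
        moreover have "x \<in> ?U - ?G \<inter> ?U" using that True i(2) by auto
        ultimately show False using B by (auto simp: basis_of_def)
      qed
      moreover have "?G \<inter> U \<in> F" unfolding eq using True iG by simp
      ultimately show ?thesis unfolding basis_of_def using eq by auto
    next
      case False
      then have eq: "?G \<inter> U = ?G \<inter> ?U" by (subst i(2)) auto
      have "insert x (?G \<inter> ?U) \<notin> F" if x: "x \<in> U - ?G \<inter> ?U" for x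
      proof (cases "x = i")
        case False
        then have "x \<in> ?U - ?G \<inter> ?U" using x i(2) by blast
        then show ?thesis using B unfolding basis_of_def by blast
      qed (use False iG in simp)
      moreover have "?G \<inter> ?U \<in> F" using B by (simp add: basis_of_def)
      ultimately show ?thesis using Suc(5)[rule_format, OF i(1)] unfolding eq basis_of_def by blast
    qed
  qed
qed

lemma greedy_set_in:
  fixes v :: "'a::linorder \<Rightarrow> real"
  assumes "matroid E F"
  shows "greedy_set F E v \<in> F"
proof -
  have "basis_of F E (greedy_set F E v \<inter> E)"
    by (rule greedy_set_basis[OF assms]) (simp_all add: ahead_def subset_iff)
  moreover have "greedy_set F E v \<inter> E = greedy_set F E v" by (auto simp: greedy_set_def)
  ultimately show ?thesis by (simp add: basis_of_def)
qed

text \<open>Abel summation: lowering the reference level from \<open>v i\<close> to \<open>w\<close>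
  adds \<open>v i - w\<close> once for each chosen element of the segment, and the greedy set, being
  a basis of the segment, has the most of them.\<close>

lemma greedy_set_dominates:
  fixes v :: "'a::linorder \<Rightarrow> real"
  assumes m: "matroid E F" and T: "T \<in> F" and U: "U \<subseteq> E" "\<forall>i\<in>U. ahead E v i \<subseteq> U"
    and w: "\<And>i. i \<in> U \<Longrightarrow> w \<le> v i"
  shows "(\<Sum>i\<in>T \<inter> U. v i - w) \<le> (\<Sum>i\<in>greedy_set F E v \<inter> U. v i - w)"
proof -
  let ?G = "greedy_set F E v"
  have "finite U" by (rule finite_subset[OF U(1) matroidD(1)[OF m]])
  then show ?thesis using U w
  proof (induction "card U" arbitrary: U w)
    case (Suc k)
    have "U \<noteq> {}" using Suc(2) by auto
    obtain i where i: "i \<in> U" "U = insert i (ahead E v i)"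
      "\<forall>j\<in>ahead E v i. ahead E v j \<subseteq> ahead E v i"
      by (rule last_in_segment[OF Suc(3) \<open>U \<noteq> {}\<close> Suc(4,5)]) (rule that)
    let ?U = "ahead E v i"
    have iU: "i \<notin> ?U" by (simp add: ahead_def)
    have fin: "finite ?U" "?U \<subseteq> E"
      using finite_subset[OF Suc(5)[rule_format, OF i(1)] Suc(3)] by (auto simp: ahead_def)
    have "card U = Suc (card ?U)" by (subst i(2)) (use fin iU in simp)
    then have "k = card ?U" using Suc(2) by simp
    then have IH: "(\<Sum>j\<in>T \<inter> ?U. v j - v i) \<le> (\<Sum>j\<in>?G \<inter> ?U. v j - v i)"
      by (rule Suc(1)[OF _ fin i(3)]) (auto simp: ahead_def)
    have sub: "?U \<subseteq> U" "U - ?U \<subseteq> {i}" using Suc(5)[rule_format, OF i(1)] by (simp, subst i(2), auto)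
    have eq: "(\<Sum>j\<in>X \<inter> U. v j - w) = (\<Sum>j\<in>X \<inter> ?U. v j - v i) + (v i - w) * card (X \<inter> U)" for X
    proof -
      have "(\<Sum>j\<in>X \<inter> U. v j - v i) = (\<Sum>j\<in>X \<inter> ?U. v j - v i)"
      proof (rule sum.mono_neutral_right)
        show "\<forall>j\<in>X \<inter> U - X \<inter> ?U. v j - v i = 0" using sub(2) by auto
      qed (use Suc(3) sub(1) in auto)
      moreover have "(\<Sum>j\<in>X \<inter> U. v j - w) = (\<Sum>j\<in>X \<inter> U. (v j - v i) + (v i - w))" by simp
      ultimately show ?thesis by (simp only: sum.distrib sum_constant mult.commute)
    qed
    have "card (T \<inter> U) \<le> card (?G \<inter> U)"
      using greedy_set_basis[OF m Suc(4,5)] matroidD(6)[OF m T, of "T \<inter> U"]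
      by (intro basis_card_ge[OF m]) auto
    then have "(v i - w) * card (T \<inter> U) \<le> (v i - w) * card (?G \<inter> U)"
      using Suc(6)[OF i(1)] by (intro mult_left_mono) auto
    then show ?case unfolding eq using IH by linarith
  qed simp
qed

lemma max_weight_greedy:
  fixes v :: "'a::linorder \<Rightarrow> real"
  assumes m: "matroid E F" and v: "\<And>i. i \<in> E \<Longrightarrow> 0 \<le> v i"
  shows "max_weight F {} v = sum v (greedy_set F E v)"
proof (rule antisym)
  obtain S where S: "S \<in> F" "max_weight F {} v = sum v S"
    using max_weight_attained[OF m matroidD(2)[OF m], of v] by auto
  have "(\<Sum>i\<in>S \<inter> E. v i - 0) \<le> (\<Sum>i\<in>greedy_set F E v \<inter> E. v i - 0)"
    by (rule greedy_set_dominates[OF m S(1)]) (use v in \<open>auto simp: ahead_def\<close>)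
  moreover have "S \<inter> E = S" "greedy_set F E v \<inter> E = greedy_set F E v"
    using matroidD(3)[OF m] S greedy_set_in[OF m, of v] by auto
  ultimately show "max_weight F {} v \<le> sum v (greedy_set F E v)" using S by simp
  show "sum v (greedy_set F E v) \<le> max_weight F {} v"
    by (rule max_weight_empty_ge[OF m greedy_set_in[OF m]])
qed

text \<open>A larger own weight and smaller other weights can only remove elements from those ahead
  of \<open>i\<close>, and fewer elements span less.\<close>

lemma greedy_set_upward:
  fixes v :: "'a::linorder \<Rightarrow> real"
  assumes "matroid E F" "i \<in> greedy_set F E (u(i := x))" "x \<le> x'" "\<And>j. j \<noteq> i \<Longrightarrow> v j \<le> u j"
  shows "i \<in> greedy_set F E (v(i := x'))"
proof -
  have "ahead E (v(i := x')) i \<subseteq> ahead E (u(i := x)) i"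
    using assms(3,4) by (fastforce simp: ahead_def)
  then show ?thesis using assms(2) unspanned_mono[OF assms(1)] by (auto simp: greedy_set_def)
qed

text \<open>A larger weight vector only raises the exchange price of an element.\<close>

lemma max_weight_diminishing:
  fixes u v :: "'a::linorder \<Rightarrow> real"
  assumes m: "matroid E F" and uv: "\<And>j. 0 \<le> u j" "\<And>j. u j \<le> v j"
  shows "max_weight F {} (v(i := max (v i) x)) - max_weight F {} v \<le>
    max_weight F {} (u(i := max (u i) x)) - max_weight F {} u"
proof (cases "{i} \<in> F")
  case False
  then show ?thesis using max_weight_loop[OF m _ matroidD(2)[OF m]] by simp
next
  case True
  then have iE: "i \<in> E" using matroidD(3)[OF m] by blast
  have v0: "0 \<le> v j" for j using uv[of j] by linarith
  let ?M = "max_weight F {}"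
  obtain p where p: "0 \<le> p" "\<forall>x. ?M (u(i := x)) = max_weight F {i} u + max x p"
    by (rule max_weight_price[OF m True, of u]) (auto intro: that)
  obtain q where q: "0 \<le> q" "\<forall>x. ?M (v(i := x)) = max_weight F {i} v + max x q"
    by (rule max_weight_price[OF m True, of v]) (auto intro: that)
  \<comment> \<open>Above its price an element must be taken: otherwise lowering its weight to the
    price would leave the value of the greedy set unchanged although the optimum drops.\<close>
  have in_greedy: "i \<in> greedy_set F E (w(i := z))"
    if "\<And>x. ?M (w(i := x)) = c + max x y" "\<And>j. 0 \<le> w j" "0 \<le> y" "y < z" for w z c y
  proof (rule ccontr)
    let ?G = "greedy_set F E (w(i := z))"
    assume G: "i \<notin> ?G"
    have "?M (w(i := z)) = sum (w(i := z)) ?G" using that by (intro max_weight_greedy[OF m]) auto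
    also have "\<dots> = sum (w(i := y)) ?G" using G by (intro sum.cong) auto
    also have "\<dots> \<le> ?M (w(i := y))" by (rule max_weight_empty_ge[OF m greedy_set_in[OF m]])
    finally show False using that(1)[of z] that(1)[of y] that(4) by simp
  qed
  \<comment> \<open>Below its price it cannot be taken: otherwise raising its weight to the price
    would raise the value of the greedy set although the optimum stays constant.\<close>
  have not_in_greedy: "i \<notin> greedy_set F E (w(i := z))"
    if "\<And>x. ?M (w(i := x)) = c + max x y" "\<And>j. 0 \<le> w j" "0 \<le> z" "z < y" for w z c y
  proof
    let ?G = "greedy_set F E (w(i := z))"
    assume G: "i \<in> ?G"
    have fin: "finite ?G" using matroidD(4)[OF m greedy_set_in[OF m]] .
    have "?M (w(i := z)) = sum (w(i := z)) ?G" using that by (intro max_weight_greedy[OF m]) auto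
    also have "\<dots> = z + sum w (?G - {i})"
      using G fin by (subst sum.remove[of _ i]) (auto intro!: sum.cong)
    finally have 1: "c + y = z + sum w (?G - {i})" using that(1)[of z] that(4) by simp
    have "y + sum w (?G - {i}) = sum (w(i := y)) ?G"
      using G fin by (subst (2) sum.remove[of _ i]) (auto intro!: sum.cong)
    also have "\<dots> \<le> ?M (w(i := y))" by (rule max_weight_empty_ge[OF m greedy_set_in[OF m]])
    finally show False using 1 that(1)[of y] that(4) by simp
  qed
  have "p \<le> q"
  proof (rule ccontr)
    assume "\<not> p \<le> q"
    \<comment> \<open>At a price itself ties could go either way, so the weight is tested strictly
      between the two prices.\<close>
    then obtain z where z: "q < z" "z < p" using dense[of q p] by auto
    have "i \<in> greedy_set F E (v(i := z))" by (rule in_greedy[OF q(2)[rule_format] v0 q(1) z(1)])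
    then have "i \<in> greedy_set F E (u(i := z))" by (rule greedy_set_upward[OF m]) (simp_all add: uv(2))
    moreover have "i \<notin> greedy_set F E (u(i := z))"
      using z(1) q(1) by (intro not_in_greedy[OF p(2)[rule_format] uv(1) _ z(2)]) simp
    ultimately show False by simp
  qed
  then have "max (max (v i) x) q - max (v i) q \<le> max (max (u i) x) p - max (u i) p"
    using uv(2)[of i] unfolding max_def by auto
  then show ?thesis using p(2)[rule_format, of "max (u i) x"] p(2)[rule_format, of "u i"]
      q(2)[rule_format, of "max (v i) x"] q(2)[rule_format, of "v i"] by simp
qed

section \<open>Calculus of finitely supported expectations\<close>

section \<open>Finite expectations\<close>

abbreviation expect :: "'a pmf \<Rightarrow> ('a \<Rightarrow> real) \<Rightarrow> real" where
  "expect p f \<equiv> measure_pmf.expectation p f"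

lemma expect_add:
  "finite (set_pmf p) \<Longrightarrow> expect p (\<lambda>x. f x + g x) = expect p f + expect p g"
  by (rule Bochner_Integration.integral_add) (auto intro: integrable_measure_pmf_finite)

lemma expect_diff:
  "finite (set_pmf p) \<Longrightarrow> expect p (\<lambda>x. f x - g x) = expect p f - expect p g"
  by (rule Bochner_Integration.integral_diff) (auto intro: integrable_measure_pmf_finite)

lemma expect_sum:
  "finite (set_pmf p) \<Longrightarrow> expect p (\<lambda>x. \<Sum>i\<in>I. f i x) = (\<Sum>i\<in>I. expect p (f i))"
  by (rule Bochner_Integration.integral_sum) (auto intro: integrable_measure_pmf_finite)

lemma expect_mono:
  assumes "finite (set_pmf p)" "\<And>x. x \<in> set_pmf p \<Longrightarrow> f x \<le> g x"
  shows "expect p f \<le> expect p g"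
  using assms by (intro integral_mono_AE integrable_measure_pmf_finite) (auto intro: AE_pmfI)

lemma expect_cong: "(\<And>x. x \<in> set_pmf p \<Longrightarrow> f x = g x) \<Longrightarrow> expect p f = expect p g"
  by (rule integral_cong_AE) (auto intro: AE_pmfI)

lemma expect_sum_pmf:
  "finite (set_pmf p) \<Longrightarrow> expect p f = (\<Sum>x\<in>set_pmf p. pmf p x * f x)"
  by (subst integral_measure_pmf[of "set_pmf p"]) auto

lemma expect_bind:
  assumes "finite (set_pmf p)" "\<And>x. x \<in> set_pmf p \<Longrightarrow> finite (set_pmf (q x))"
  shows "expect (bind_pmf p q) f = expect p (\<lambda>x. expect (q x) f)"
  by (subst pmf_expectation_bind[where A="set_pmf p"]) (use assms in \<open>auto simp: expect_sum_pmf\<close>)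

lemma expect_swap:
  assumes "finite (set_pmf p)" "finite (set_pmf q)"
  shows "expect p (\<lambda>x. expect q (\<lambda>y. f x y)) = expect q (\<lambda>y. expect p (\<lambda>x. f x y))"
  using assms by (simp add: expect_sum_pmf sum_distrib_left sum.swap[of _ "set_pmf p"] mult.left_commute)

lemma finite_set_Pi_pmf:
  assumes "finite A" "\<And>x. x \<in> A \<Longrightarrow> finite (set_pmf (p x))"
  shows "finite (set_pmf (Pi_pmf A d p))"
  using assms by (auto simp: set_Pi_pmf o_def)

lemma expect_Pi_pmf_insert:
  assumes "finite A" "x \<notin> A" "\<And>y. y \<in> insert x A \<Longrightarrow> finite (set_pmf (p y))"
  shows "expect (Pi_pmf (insert x A) d p) f = expect (p x) (\<lambda>y. expect (Pi_pmf A d p) (\<lambda>g. f (g(x := y))))"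
  using assms by (subst Pi_pmf_insert') (simp_all add: expect_bind finite_set_Pi_pmf)

section \<open>Correlation gap for functions with diminishing returns\<close>

section \<open>The correlation gap\<close>

text \<open>Random raises of a coordinate are represented by their action on functions of the vector.\<close>

definition raise :: "('i \<Rightarrow> real) \<Rightarrow> 'i \<Rightarrow> real \<Rightarrow> 'i \<Rightarrow> real" where
  "raise v i r = v(i := max (v i) r)"

definition raise_expect :: "('i \<Rightarrow> real pmf) \<Rightarrow> 'i \<Rightarrow> (('i \<Rightarrow> real) \<Rightarrow> real) \<Rightarrow> ('i \<Rightarrow> real) \<Rightarrow> real" where
  "raise_expect \<rho> i h v = expect (\<rho> i) (\<lambda>r. h (raise v i r))"

definition raise_maybe :: "('i \<Rightarrow> real pmf) \<Rightarrow> real \<Rightarrow> 'i \<Rightarrow> (('i \<Rightarrow> real) \<Rightarrow> real) \<Rightarrow> ('i \<Rightarrow> real) \<Rightarrow> real" where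
  "raise_maybe \<rho> \<alpha> i h v = (1 - \<alpha>) * h v + \<alpha> * raise_expect \<rho> i h v"

abbreviation nonneg_vec :: "('i \<Rightarrow> real) \<Rightarrow> bool" where
  "nonneg_vec v \<equiv> (\<lambda>_. 0) \<le> v"

text \<open>Diminishing returns for raising one coordinate, the form in which
  \<open>max_weight_diminishing\<close> supplies it.\<close>

definition submodular :: "(('i \<Rightarrow> real) \<Rightarrow> real) \<Rightarrow> bool" where
  "submodular h \<longleftrightarrow> (\<forall>u v i x. nonneg_vec u \<longrightarrow> u \<le> v \<longrightarrow> h (raise v i x) - h v \<le> h (raise u i x) - h u)"

definition antitone :: "(('i \<Rightarrow> real) \<Rightarrow> real) \<Rightarrow> bool" where
  "antitone h \<longleftrightarrow> (\<forall>u v. nonneg_vec u \<longrightarrow> u \<le> v \<longrightarrow> h v \<le> h u)"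

lemma submodularD:
  "submodular h \<Longrightarrow> nonneg_vec u \<Longrightarrow> u \<le> v \<Longrightarrow> h (raise v i x) - h v \<le> h (raise u i x) - h u"
  by (simp add: submodular_def)

lemma antitoneD: "antitone h \<Longrightarrow> nonneg_vec u \<Longrightarrow> u \<le> v \<Longrightarrow> h v \<le> h u"
  by (simp add: antitone_def)

lemma raise_ge: "v \<le> raise v i r"
  by (auto simp: raise_def le_fun_def)

lemma nonneg_raise: "nonneg_vec v \<Longrightarrow> nonneg_vec (raise v i r)"
  by (rule order_trans[OF _ raise_ge])

lemma raise_commute: "raise (raise v i r) j s = raise (raise v j s) i r"
  by (auto simp: raise_def fun_eq_iff)

lemma raise_mono: "u \<le> v \<Longrightarrow> raise u i r \<le> raise v i r"
  by (auto simp: raise_def le_fun_def max_def intro: order_trans)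

context
  fixes \<rho> :: "'i \<Rightarrow> real pmf"
  assumes fin: "\<And>i. finite (set_pmf (\<rho> i))"
begin

lemma raise_expect_mono:
  assumes "\<And>v. nonneg_vec v \<Longrightarrow> h v \<le> g v" "nonneg_vec v"
  shows "raise_expect \<rho> i h v \<le> raise_expect \<rho> i g v"
  unfolding raise_expect_def by (rule expect_mono[OF fin]) (rule assms(1)[OF nonneg_raise[OF assms(2)]])

lemma raise_maybe_mono:
  assumes "\<And>v. nonneg_vec v \<Longrightarrow> h v \<le> g v" "nonneg_vec v" "0 \<le> \<alpha>" "\<alpha> \<le> 1"
  shows "raise_maybe \<rho> \<alpha> i h v \<le> raise_maybe \<rho> \<alpha> i g v"
proof -
  have "(1 - \<alpha>) * h v \<le> (1 - \<alpha>) * g v" using assms(1)[OF assms(2)] assms(4) by (intro mult_left_mono) auto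
  moreover have "\<alpha> * raise_expect \<rho> i h v \<le> \<alpha> * raise_expect \<rho> i g v"
    by (rule mult_left_mono[OF raise_expect_mono[OF assms(1,2)] assms(3)])
  ultimately show ?thesis unfolding raise_maybe_def by linarith
qed

lemma raise_maybe_affine:
  "raise_maybe \<rho> \<alpha> i (\<lambda>v. a * h v + c * g v + k) v = a * raise_maybe \<rho> \<alpha> i h v + c * raise_maybe \<rho> \<alpha> i g v + k"
  unfolding raise_maybe_def raise_expect_def
  by (simp add: expect_add[OF fin] algebra_simps)

lemma raise_maybe_sum:
  "raise_maybe \<rho> \<alpha> i (\<lambda>v. \<Sum>x\<leftarrow>xs. h x v) v = (\<Sum>x\<leftarrow>xs. raise_maybe \<rho> \<alpha> i (h x) v)"
proof (induction xs)
  case Nil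
  show ?case by (simp add: raise_maybe_def raise_expect_def)
next
  case (Cons x xs)
  have "raise_maybe \<rho> \<alpha> i (\<lambda>v. \<Sum>x\<leftarrow>x # xs. h x v) v = raise_maybe \<rho> \<alpha> i (\<lambda>v. 1 * h x v + 1 * (\<Sum>x\<leftarrow>xs. h x v) + 0) v"
    by simp
  then show ?case unfolding raise_maybe_affine Cons by simp
qed

lemma raise_maybe_antitone:
  assumes "antitone h" "nonneg_vec v" "0 \<le> \<alpha>"
  shows "raise_maybe \<rho> \<alpha> i h v \<le> h v"
proof -
  have "raise_expect \<rho> i h v \<le> expect (\<rho> i) (\<lambda>_. h v)"
    unfolding raise_expect_def
    by (rule expect_mono[OF fin]) (rule antitoneD[OF assms(1,2) raise_ge])
  then have "\<alpha> * raise_expect \<rho> i h v \<le> \<alpha> * h v" using assms by (intro mult_left_mono) auto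
  then show ?thesis unfolding raise_maybe_def by (simp add: algebra_simps)
qed

lemma raise_expect_commute: "raise_expect \<rho> i (raise_expect \<rho> j h) = raise_expect \<rho> j (raise_expect \<rho> i h)"
  unfolding raise_expect_def by (rule ext, subst expect_swap[OF fin fin]) (simp add: raise_commute)

lemma raise_maybe_commute: "raise_maybe \<rho> \<alpha> i (raise_maybe \<rho> \<beta> j h) = raise_maybe \<rho> \<beta> j (raise_maybe \<rho> \<alpha> i h)"
proof
  fix v
  have lin: "raise_expect \<rho> i (raise_maybe \<rho> \<alpha> j h) v = (1 - \<alpha>) * raise_expect \<rho> i h v + \<alpha> * raise_expect \<rho> i (raise_expect \<rho> j h) v"
    for i j \<alpha>
    unfolding raise_maybe_def raise_expect_def[of _ i] by (simp add: expect_add[OF fin])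
  show "raise_maybe \<rho> \<alpha> i (raise_maybe \<rho> \<beta> j h) v = raise_maybe \<rho> \<beta> j (raise_maybe \<rho> \<alpha> i h) v"
    unfolding raise_maybe_def[of \<rho> _ _ "raise_maybe _ _ _ _"] lin raise_expect_commute[of j i]
    by (simp add: raise_maybe_def algebra_simps)
qed

lemma submodular_raise_expect:
  assumes "submodular h"
  shows "submodular (raise_expect \<rho> j h)"
  unfolding submodular_def
proof (intro allI impI)
  fix u v :: "'i \<Rightarrow> real" and i x
  assume uv: "nonneg_vec u" "u \<le> v"
  have "raise_expect \<rho> j h (raise v i x) - raise_expect \<rho> j h v =
      expect (\<rho> j) (\<lambda>r. h (raise (raise v j r) i x) - h (raise v j r))" for v
    unfolding raise_expect_def by (simp add: expect_diff[OF fin] raise_commute[of v i])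
  moreover have "expect (\<rho> j) (\<lambda>r. h (raise (raise v j r) i x) - h (raise v j r)) \<le>
      expect (\<rho> j) (\<lambda>r. h (raise (raise u j r) i x) - h (raise u j r))"
    by (rule expect_mono[OF fin]) (rule submodularD[OF assms nonneg_raise[OF uv(1)] raise_mono[OF uv(2)]])
  ultimately show "raise_expect \<rho> j h (raise v i x) - raise_expect \<rho> j h v
      \<le> raise_expect \<rho> j h (raise u i x) - raise_expect \<rho> j h u" by simp
qed

lemma antitone_gain:
  assumes "submodular h"
  shows "antitone (\<lambda>v. raise_expect \<rho> i h v - h v)"
proof -
  have "raise_expect \<rho> i h v - h v = expect (\<rho> i) (\<lambda>r. h (raise v i r) - h v)" for v
    unfolding raise_expect_def by (simp add: expect_diff[OF fin])
  moreover have "expect (\<rho> i) (\<lambda>r. h (raise v i r) - h v) \<le> expect (\<rho> i) (\<lambda>r. h (raise u i r) - h u)"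
    if "nonneg_vec u" "u \<le> v" for u v
    by (rule expect_mono[OF fin]) (rule submodularD[OF assms that])
  ultimately show ?thesis unfolding antitone_def by simp
qed

definition raise_all :: "real \<Rightarrow> 'i list \<Rightarrow> (('i \<Rightarrow> real) \<Rightarrow> real) \<Rightarrow> ('i \<Rightarrow> real) \<Rightarrow> real" where
  "raise_all \<alpha> xs = foldr (raise_maybe \<rho> \<alpha>) xs"

lemma raise_all_mono:
  assumes "\<And>v. nonneg_vec v \<Longrightarrow> h v \<le> g v" "0 \<le> \<alpha>" "\<alpha> \<le> 1" "nonneg_vec v"
  shows "raise_all \<alpha> xs h v \<le> raise_all \<alpha> xs g v"
  using assms(4)
proof (induction xs arbitrary: v)
  case (Cons x xs)
  then show ?case using assms(2,3) by (auto simp: raise_all_def intro!: raise_maybe_mono)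
qed (use assms(1) in \<open>simp add: raise_all_def\<close>)

lemma raise_all_affine:
  "raise_all \<alpha> xs (\<lambda>v. a * h v + k) = (\<lambda>v. a * raise_all \<alpha> xs h v + k)"
proof (induction xs)
  case (Cons x xs)
  have "raise_maybe \<rho> \<alpha> x (\<lambda>v. a * raise_all \<alpha> xs h v + 0 * h v + k) =
      (\<lambda>v. a * raise_maybe \<rho> \<alpha> x (raise_all \<alpha> xs h) v + 0 * raise_maybe \<rho> \<alpha> x h v + k)"
    by (rule ext) (rule raise_maybe_affine)
  then show ?case using Cons by (simp add: raise_all_def)
qed (simp add: raise_all_def)

lemma raise_all_sum:
  "raise_all \<alpha> xs (\<lambda>v. \<Sum>y\<leftarrow>ys. h y v) = (\<lambda>v. \<Sum>y\<leftarrow>ys. raise_all \<alpha> xs (h y) v)"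
proof (induction xs)
  case (Cons x xs)
  have eq: "raise_all \<alpha> (x # xs) f = raise_maybe \<rho> \<alpha> x (raise_all \<alpha> xs f)" for f
    by (simp add: raise_all_def)
  show ?case unfolding eq Cons by (rule ext) (rule raise_maybe_sum)
qed (simp add: raise_all_def)

lemma raise_all_antitone:
  assumes "antitone h" "nonneg_vec v" "0 \<le> \<alpha>" "\<alpha> \<le> 1"
  shows "raise_all \<alpha> xs h v \<le> h v"
  using assms(2)
proof (induction xs arbitrary: v)
  case (Cons x xs)
  have "raise_all \<alpha> (x # xs) h v \<le> raise_maybe \<rho> \<alpha> x h v"
    unfolding raise_all_def foldr.simps o_def
    using Cons assms by (intro raise_maybe_mono) (auto simp: raise_all_def)
  also have "\<dots> \<le> h v" by (rule raise_maybe_antitone[OF assms(1) Cons(2) assms(3)])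
  finally show ?case .
qed (simp add: raise_all_def)

text \<open>
  The gains are measured at the vector reached at the end of the round, which is legitimate by
  diminishing returns; this makes the recursion for the gap an implicit Euler step.
\<close>

lemma raise_all_gain:
  assumes h: "submodular h" and \<alpha>: "0 \<le> \<alpha>" "\<alpha> \<le> 1" and v: "nonneg_vec v"
  shows "raise_all \<alpha> xs h v \<ge> h v + \<alpha> * (\<Sum>i\<leftarrow>xs. raise_all \<alpha> xs (\<lambda>v. raise_expect \<rho> i h v - h v) v)"
  using v
proof (induction xs arbitrary: v)
  case (Cons x xs)
  let ?g = "\<lambda>i v. raise_expect \<rho> i h v - h v"
  have "raise_all \<alpha> (x # xs) h v \<ge> raise_maybe \<rho> \<alpha> x (\<lambda>v. 1 * h v + \<alpha> * (\<Sum>i\<leftarrow>xs. raise_all \<alpha> xs (?g i) v) + 0) v"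
    unfolding raise_all_def[of _ "x # xs"] foldr.simps o_def
    using Cons \<alpha> by (intro raise_maybe_mono) (auto simp: raise_all_def)
  also have "raise_maybe \<rho> \<alpha> x (\<lambda>v. 1 * h v + \<alpha> * (\<Sum>i\<leftarrow>xs. raise_all \<alpha> xs (?g i) v) + 0) v =
     raise_maybe \<rho> \<alpha> x h v + \<alpha> * (\<Sum>i\<leftarrow>xs. raise_all \<alpha> (x # xs) (?g i) v)"
    unfolding raise_maybe_affine raise_maybe_sum by (simp add: raise_all_def)
  also have "raise_maybe \<rho> \<alpha> x h v = h v + \<alpha> * ?g x v" by (simp add: raise_maybe_def algebra_simps)
  finally have "raise_all \<alpha> (x # xs) h v \<ge> h v + \<alpha> * ?g x v + \<alpha> * (\<Sum>i\<leftarrow>xs. raise_all \<alpha> (x # xs) (?g i) v)" by simp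
  moreover have "\<alpha> * raise_all \<alpha> (x # xs) (?g x) v \<le> \<alpha> * ?g x v"
    using raise_all_antitone[OF antitone_gain[OF h] Cons(2) \<alpha>] \<alpha> by (intro mult_left_mono) auto
  ultimately show ?case by (simp add: algebra_simps)
qed (simp add: raise_all_def)

text \<open>A round reduces the deficit to at most \<open>1 / (1 + \<alpha>)\<close> of it: the
  gains still available after the round cover the remaining deficit, and at least a fraction
  \<open>\<alpha>\<close> of them has been collected.\<close>

lemma raise_all_rounds:
  assumes h: "submodular h" and \<alpha>: "0 \<le> \<alpha>" "\<alpha> \<le> 1"
    and target: "\<And>v. nonneg_vec v \<Longrightarrow> K - h v \<le> (\<Sum>i\<leftarrow>xs. raise_expect \<rho> i h v - h v)" and v: "nonneg_vec v"
  shows "(K - (raise_all \<alpha> xs ^^ m) h v) * (1 + \<alpha>) ^ m \<le> K - h v"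
  using v
proof (induction m arbitrary: v)
  case (Suc m)
  let ?A = "raise_all \<alpha> xs"
  have mono: "(?A ^^ m) f v \<le> (?A ^^ m) g v" if "\<And>v. nonneg_vec v \<Longrightarrow> f v \<le> g v" "nonneg_vec v" for f g v
    using that(2)
  proof (induction m arbitrary: v)
    case (Suc m)
    then show ?case using \<alpha> by (auto intro: raise_all_mono)
  qed (use that(1) in simp)
  have affine: "(?A ^^ m) (\<lambda>v. a * f v + k) = (\<lambda>v. a * (?A ^^ m) f v + k)" for a f k
    by (induction m) (simp_all add: raise_all_affine)
  \<comment> \<open>Rearranged from \<open>?A h - h \<ge> \<alpha> * (K - ?A h)\<close>, where the
    deficit is measured after the round.\<close>
  have step: "(1 + \<alpha>) * ?A h v + 0 \<ge> 1 * h v + \<alpha> * K" if v: "nonneg_vec v" for v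
  proof -
    have "(- 1) * ?A h v + K \<le> (\<Sum>i\<leftarrow>xs. ?A (\<lambda>v. raise_expect \<rho> i h v - h v) v)"
      using raise_all_mono[of "\<lambda>v. (- 1) * h v + K" "\<lambda>v. \<Sum>i\<leftarrow>xs. raise_expect \<rho> i h v - h v", OF _ \<alpha> v, of xs] target
      unfolding raise_all_sum raise_all_affine by simp
    then have "\<alpha> * ((- 1) * ?A h v + K) \<le> \<alpha> * (\<Sum>i\<leftarrow>xs. ?A (\<lambda>v. raise_expect \<rho> i h v - h v) v)"
      by (rule mult_left_mono[OF _ \<alpha>(1)])
    then show ?thesis using raise_all_gain[OF h \<alpha> v, of xs] by (simp add: algebra_simps)
  qed
  have "1 * (?A ^^ m) h v + \<alpha> * K \<le> (1 + \<alpha>) * (?A ^^ m) (?A h) v + 0"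
    using mono[of "\<lambda>v. 1 * h v + \<alpha> * K" "\<lambda>v. (1 + \<alpha>) * ?A h v + 0", OF step Suc(2)] unfolding affine by simp
  then have "(K - (?A ^^ Suc m) h v) * (1 + \<alpha>) \<le> K - (?A ^^ m) h v"
    by (simp only: funpow_Suc_right o_apply) (simp add: algebra_simps)
  then have "(K - (?A ^^ Suc m) h v) * (1 + \<alpha>) * (1 + \<alpha>) ^ m \<le> (K - (?A ^^ m) h v) * (1 + \<alpha>) ^ m"
    using \<alpha> by (intro mult_right_mono) auto
  then show ?case using Suc.IH[OF Suc(2)] by (simp add: mult.assoc)
qed simp

text \<open>A union bound over attempts on one coordinate: an earlier raise never increases the gain
  of a later one, so each attempt gains at most what the first would.\<close>

lemma raise_maybe_power:
  assumes h: "submodular h" and \<alpha>: "0 \<le> \<alpha>" "\<alpha> \<le> 1" and v: "nonneg_vec v"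
  shows "(raise_maybe \<rho> \<alpha> i ^^ k) h v \<le> h v + \<alpha> * real k * (raise_expect \<rho> i h v - h v)"
  using v
proof (induction k arbitrary: v)
  case (Suc k)
  let ?T = "raise_maybe \<rho> \<alpha> i" and ?g = "\<lambda>v. raise_expect \<rho> i h v - h v"
  have "(?T ^^ Suc k) h v \<le> ?T (\<lambda>v. 1 * h v + (\<alpha> * real k) * ?g v + 0) v"
    unfolding funpow.simps o_apply using Suc \<alpha> by (intro raise_maybe_mono) auto
  also have "\<dots> = ?T h v + \<alpha> * real k * ?T ?g v" unfolding raise_maybe_affine by simp
  also have "?T h v = h v + \<alpha> * ?g v" by (simp add: raise_maybe_def algebra_simps)
  also have "\<alpha> * real k * ?T ?g v \<le> \<alpha> * real k * ?g v"
    using raise_maybe_antitone[OF antitone_gain[OF h] Suc(2) \<alpha>(1)] \<alpha> by (intro mult_left_mono) auto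
  finally show ?case by (simp add: algebra_simps)
qed simp

text \<open>Raises commute, so the rounds can be regrouped by coordinate. A coordinate then receives
  \<open>m\<close> attempts of probability \<open>1 / m\<close>, which together gain at most as much
  as one certain raise.\<close>

lemma raise_all_power_le:
  assumes h: "submodular h" and m: "m > 0" and v: "nonneg_vec v"
  shows "(raise_all (1 / real m) xs ^^ m) h v \<le> foldr (raise_expect \<rho>) xs h v"
proof -
  let ?\<alpha> = "1 / real m"
  let ?T = "raise_maybe \<rho> ?\<alpha>"
  have \<alpha>: "0 \<le> ?\<alpha>" "?\<alpha> \<le> 1" using m by auto
  have comm: "?T x \<circ> raise_all ?\<alpha> xs = raise_all ?\<alpha> xs \<circ> ?T x" for x xs
  proof (induction xs)
    case (Cons y xs)
    have "?T x \<circ> raise_all ?\<alpha> (y # xs) = ?T y \<circ> (?T x \<circ> raise_all ?\<alpha> xs)"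
      by (simp add: raise_all_def fun_eq_iff raise_maybe_commute[of _ x _ y])
    also have "\<dots> = raise_all ?\<alpha> (y # xs) \<circ> ?T x"
      unfolding Cons by (simp add: raise_all_def o_assoc)
    finally show ?case .
  qed (simp add: raise_all_def)
  have comm2: "(f \<circ> g) ^^ k = f ^^ k \<circ> g ^^ k" if fg: "f \<circ> g = g \<circ> f" for f g :: "'b \<Rightarrow> 'b" and k
  proof (induction k)
    case (Suc k)
    have c: "g \<circ> f ^^ j = f ^^ j \<circ> g" for j
    proof
      have "g (f x) = f (g x)" for x using fg by (metis comp_apply)
      then show "(g \<circ> f ^^ j) x = (f ^^ j \<circ> g) x" for x by (induction j) auto
    qed
    have "(f \<circ> g) ^^ Suc k = f \<circ> (g \<circ> f ^^ k) \<circ> g ^^ k" unfolding funpow.simps Suc by (simp add: o_assoc)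
    also have "\<dots> = f ^^ Suc k \<circ> g ^^ Suc k" unfolding c by (simp add: o_assoc)
    finally show ?case .
  qed simp
  have split: "raise_all ?\<alpha> xs ^^ m = foldr (\<lambda>i. ?T i ^^ m) xs" for xs
  proof (induction xs)
    case (Cons x xs)
    have "raise_all ?\<alpha> (x # xs) = ?T x \<circ> raise_all ?\<alpha> xs" by (simp add: raise_all_def)
    then show ?case unfolding foldr.simps Cons[symmetric] using comm2[OF comm[of x xs], of m] by (simp only:)
  next
    case Nil
    show ?case unfolding raise_all_def foldr.simps by (induction m) simp_all
  qed
  have sub: "submodular (foldr (raise_expect \<rho>) xs h)" for xs
    by (induction xs) (auto intro: h submodular_raise_expect)
  have T_mono: "(?T x ^^ k) f v \<le> (?T x ^^ k) g v" if "\<And>v. nonneg_vec v \<Longrightarrow> f v \<le> g v" "nonneg_vec v" for f g x k v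
    using that(2)
  proof (induction k arbitrary: v)
    case (Suc k)
    then show ?case using \<alpha> by (auto intro: raise_maybe_mono)
  qed (use that(1) in simp)
  have "foldr (\<lambda>i. ?T i ^^ m) xs h v \<le> foldr (raise_expect \<rho>) xs h v"
    using v
  proof (induction xs arbitrary: v)
    case (Cons x xs)
    have "foldr (\<lambda>i. ?T i ^^ m) (x # xs) h v \<le> (?T x ^^ m) (foldr (raise_expect \<rho>) xs h) v"
      by simp (rule T_mono[OF Cons.IH Cons.prems])
    also have "\<dots> \<le> foldr (raise_expect \<rho>) (x # xs) h v"
      using raise_maybe_power[OF sub[of xs] \<alpha> Cons.prems, where i=x and k=m] m by simp
    finally show ?case .
  qed simp
  then show ?thesis unfolding split .
qed

lemma raise_expect_Pi_pmf:
  assumes "distinct xs" "nonneg_vec v"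
  shows "foldr (raise_expect \<rho>) xs h v = expect (Pi_pmf (set xs) 0 \<rho>) (\<lambda>f. h (\<lambda>j. max (v j) (f j)))"
  using assms
proof (induction xs arbitrary: v)
  case Nil
  \<comment> \<open>The default value 0 of the product law is neutral for \<open>max\<close> on
    nonnegative vectors.\<close>
  then have "(\<lambda>j. max (v j) 0) = v" by (auto simp: le_fun_def fun_eq_iff max_def intro: antisym)
  then show ?case by simp
next
  case (Cons x xs)
  have "foldr (raise_expect \<rho>) (x # xs) h v =
      expect (\<rho> x) (\<lambda>r. expect (Pi_pmf (set xs) 0 \<rho>) (\<lambda>f. h (\<lambda>j. max (raise v x r j) (f j))))"
    unfolding foldr.simps o_apply raise_expect_def[of _ x] using Cons.prems
    by (intro expect_cong Cons.IH nonneg_raise) auto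
  also have "\<dots> = expect (\<rho> x) (\<lambda>r. expect (Pi_pmf (set xs) 0 \<rho>) (\<lambda>f. h (\<lambda>j. max (v j) ((f(x := r)) j))))"
  proof (intro expect_cong)
    fix r f assume "f \<in> set_pmf (Pi_pmf (set xs) 0 \<rho>)"
    then have "f x = 0" using set_Pi_pmf_subset[of "set xs" 0 \<rho>] Cons.prems(1) by auto
    moreover have "0 \<le> v x" using Cons.prems(2) by (auto simp: le_fun_def)
    ultimately have "(\<lambda>j. max (raise v x r j) (f j)) = (\<lambda>j. max (v j) ((f(x := r)) j))"
      by (auto simp: raise_def fun_eq_iff max_def)
    then show "h (\<lambda>j. max (raise v x r j) (f j)) = h (\<lambda>j. max (v j) ((f(x := r)) j))" by simp
  qed
  also have "\<dots> = expect (Pi_pmf (set (x # xs)) 0 \<rho>) (\<lambda>f. h (\<lambda>j. max (v j) (f j)))"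
    unfolding list.set using Cons.prems(1) by (subst expect_Pi_pmf_insert) (auto simp: fin)
  finally show ?case .
qed

end

lemma submodular_union_bound:
  assumes h: "submodular h" and v: "nonneg_vec v"
  shows "h (\<lambda>j. if j \<in> set xs then max (v j) (d j) else v j) - h v \<le> (\<Sum>i\<leftarrow>xs. h (raise v i (d i)) - h v)"
proof (induction xs)
  case (Cons x xs)
  let ?w = "\<lambda>j. if j \<in> set xs then max (v j) (d j) else v j"
  have eq: "(\<lambda>j. if j \<in> set (x # xs) then max (v j) (d j) else v j) = raise ?w x (d x)"
    by (auto simp: raise_def fun_eq_iff)
  have "v \<le> ?w" by (auto simp: le_fun_def)
  then have "h (raise ?w x (d x)) - h ?w \<le> h (raise v x (d x)) - h v"
    by (rule submodularD[OF h v])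
  then show ?case using Cons unfolding eq by simp
qed simp

text \<open>Raising all coordinates of \<open>v\<close> to a sample \<open>d\<close> reaches at
  least the sum of \<open>d\<close>, so by the union bound the single raises together gain at least
  the deficit, in expectation. These gains involve only the marginals of \<open>D\<close>, which is
  why the product law inherits the bound.\<close>

lemma correlation_gap:
  assumes h: "submodular h" and m: "m > 0" and D: "finite (set_pmf D)" and xs: "distinct xs"
    and h0: "h (\<lambda>_. 0) = 0"
    and lower: "\<And>d v. d \<in> set_pmf D \<Longrightarrow> nonneg_vec v \<Longrightarrow>
      (\<Sum>i\<leftarrow>xs. d i) \<le> h (\<lambda>j. if j \<in> set xs then max (v j) (d j) else v j)"
  shows "(1 - 1 / (1 + 1 / real m) ^ m) * expect D (\<lambda>d. \<Sum>i\<leftarrow>xs. d i) \<le>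
    expect (Pi_pmf (set xs) 0 (\<lambda>i. map_pmf (\<lambda>d. d i) D)) (\<lambda>f. h (\<lambda>j. max 0 (f j)))"
proof -
  define \<rho> where "\<rho> = (\<lambda>i. map_pmf (\<lambda>d. d i) D)"
  have fin: "finite (set_pmf (\<rho> i))" for i unfolding \<rho>_def using D by simp
  let ?K = "expect D (\<lambda>d. \<Sum>i\<leftarrow>xs. d i)" and ?\<alpha> = "1 / real m"
  let ?G = "(raise_all \<rho> ?\<alpha> xs ^^ m) h (\<lambda>_. 0)"
  have \<alpha>: "0 \<le> ?\<alpha>" "?\<alpha> \<le> 1" using m by auto
  have sum_expect: "expect D (\<lambda>d. \<Sum>i\<leftarrow>ys. f i d) = (\<Sum>i\<leftarrow>ys. expect D (f i))" for ys :: "'a list" and f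
    by (induction ys) (simp_all add: expect_add[OF D])
  have target: "?K - h v \<le> (\<Sum>i\<leftarrow>xs. raise_expect \<rho> i h v - h v)" if v: "nonneg_vec v" for v
  proof -
    have "?K - h v = expect D (\<lambda>d. (\<Sum>i\<leftarrow>xs. d i) - h v)" by (simp add: expect_diff[OF D])
    also have "\<dots> \<le> expect D (\<lambda>d. \<Sum>i\<leftarrow>xs. h (raise v i (d i)) - h v)"
    proof (rule expect_mono[OF D])
      fix d assume "d \<in> set_pmf D"
      then show "(\<Sum>i\<leftarrow>xs. d i) - h v \<le> (\<Sum>i\<leftarrow>xs. h (raise v i (d i)) - h v)"
        using lower[OF _ v, of d] submodular_union_bound[OF h v, where d=d and xs=xs] by linarith
    qed
    also have "\<dots> = (\<Sum>i\<leftarrow>xs. raise_expect \<rho> i h v - h v)"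
      unfolding sum_expect raise_expect_def \<rho>_def by (simp add: expect_diff[OF D])
    finally show ?thesis .
  qed
  have "(?K - ?G) * (1 + ?\<alpha>) ^ m \<le> ?K - h (\<lambda>_. 0)"
    by (rule raise_all_rounds[OF fin h \<alpha> target]) auto
  then have "?K - ?G \<le> ?K / (1 + ?\<alpha>) ^ m"
    using h0 by (subst pos_le_divide_eq) (use \<alpha>(1) in \<open>auto intro!: zero_less_power add_pos_nonneg\<close>)
  moreover have "?G \<le> expect (Pi_pmf (set xs) 0 \<rho>) (\<lambda>f. h (\<lambda>j. max 0 (f j)))"
    using raise_all_power_le[OF fin h m, where v="\<lambda>_. 0" and xs=xs]
      raise_expect_Pi_pmf[OF fin xs, where v="\<lambda>_. 0" and h=h] by simp
  ultimately show ?thesis unfolding \<rho>_def by (simp add: algebra_simps)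
qed

section \<open>Reservation values for opening and grabbing, and the surrogate value\<close>

section \<open>Indices of a box\<close>

text \<open>The root \<open>b\<close> of \<open>E max (f X - b) 0 = c\<close>, as the best threshold of a ratio.\<close>

definition gain_root :: "'a set \<Rightarrow> ('a \<Rightarrow> real) \<Rightarrow> ('a \<Rightarrow> real) \<Rightarrow> real \<Rightarrow> real" where
  "gain_root S p f c =
     Max ((\<lambda>t. ((\<Sum>x\<in>{x\<in>S. f t \<le> f x}. p x * f x) - c) / (\<Sum>x\<in>{x\<in>S. f t \<le> f x}. p x)) ` S)"

text \<open>Fixing the set of values that count makes the left-hand side linear in the root, and
  each ratio is where one such linear function equals \<open>c\<close>. The true left-hand side is
  their upper envelope; as they decrease, it equals \<open>c\<close> at the largest ratio.\<close>

lemma gain_root: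
  assumes S: "finite S" "S \<noteq> {}" and p: "\<And>x. x \<in> S \<Longrightarrow> 0 < p x" and c: "0 \<le> c"
  shows "(\<Sum>x\<in>S. p x * max (f x - gain_root S p f c) 0) = c"
proof -
  let ?U = "\<lambda>t. {x\<in>S. f t \<le> f x}"
  define b where "b = gain_root S p f c"
  have pos: "0 < (\<Sum>x\<in>?U t. p x)" if "t \<in> S" for t
    using S p that by (intro sum_pos) auto
  have expand: "(\<Sum>x\<in>A. p x * (f x - b)) = (\<Sum>x\<in>A. p x * f x) - b * (\<Sum>x\<in>A. p x)" for A
    by (simp add: algebra_simps sum_subtractf sum_distrib_left)
  have le: "(\<Sum>x\<in>?U t. p x * (f x - b)) \<le> c" if "t \<in> S" for t
  proof -
    have "((\<Sum>x\<in>?U t. p x * f x) - c) / (\<Sum>x\<in>?U t. p x) \<le> b"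
      unfolding b_def gain_root_def using S that by (intro Max_ge) auto
    then show ?thesis using pos[OF that] unfolding expand by (simp add: pos_divide_le_eq)
  qed
  have "b \<in> (\<lambda>t. ((\<Sum>x\<in>?U t. p x * f x) - c) / (\<Sum>x\<in>?U t. p x)) ` S"
    unfolding b_def gain_root_def using S by (intro Max_in) auto
  then obtain t where t: "t \<in> S" "b = ((\<Sum>x\<in>?U t. p x * f x) - c) / (\<Sum>x\<in>?U t. p x)" by auto
  have eq: "(\<Sum>x\<in>?U t. p x * (f x - b)) = c"
    unfolding expand using pos[OF t(1)] by (subst t(2)) simp
  show ?thesis unfolding b_def[symmetric]
  proof (rule antisym)
    show "(\<Sum>x\<in>S. p x * max (f x - b) 0) \<le> c"
    proof (cases "\<exists>x\<in>S. b < f x")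
      case True
      \<comment> \<open>The values above \<open>b\<close> form the upper set of the smallest of
        them, so the sum of positive parts is one of the linear expressions already bounded.\<close>
      define m where "m = Min (f ` {x\<in>S. b < f x})"
      have "m \<in> f ` {x\<in>S. b < f x}" unfolding m_def using S True by (intro Min_in) auto
      then obtain u where u: "u \<in> S" "b < f u" "f u = m" by auto
      have m: "m \<le> f x" if "x \<in> S" "b < f x" for x unfolding m_def using that S by (intro Min_le) auto
      have "(\<Sum>x\<in>S. p x * max (f x - b) 0) = (\<Sum>x\<in>?U u. p x * max (f x - b) 0)"
        using S m u by (intro sum.mono_neutral_right) (auto simp: not_le max_def intro: leI)
      also have "\<dots> = (\<Sum>x\<in>?U u. p x * (f x - b))"
        using u by (intro sum.cong) auto
      also have "\<dots> \<le> c" by (rule le[OF u(1)])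
      finally show ?thesis .
    next
      case False
      then have "(\<Sum>x\<in>S. p x * max (f x - b) 0) = 0" by (intro sum.neutral) (auto simp: not_less)
      then show ?thesis using c by simp
    qed
    have "c \<le> (\<Sum>x\<in>?U t. p x * max (f x - b) 0)"
      unfolding eq[symmetric] using p by (intro sum_mono mult_left_mono) (auto intro: less_imp_le)
    also have "\<dots> \<le> (\<Sum>x\<in>S. p x * max (f x - b) 0)"
    proof (rule sum_mono2)
      fix x assume "x \<in> S - ?U t"
      then have "0 < p x" using p by simp
      then show "0 \<le> p x * max (f x - b) 0" by simp
    qed (use S in auto)
    finally show "c \<le> (\<Sum>x\<in>S. p x * max (f x - b) 0)" .
  qed
qed

text \<open>Weitzman's reservation value, the outside option at which opening just recovers its
  cost. At cost 0, where the equation has many roots, the formula selects the largest value of the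
  support.\<close>

definition open_index :: "box \<Rightarrow> real" where
  "open_index B = gain_root (set_pmf (value_dist B)) (pmf (value_dist B)) (\<lambda>x. x) (cost B)"

text \<open>Against an outside option below this index, grabbing is better than opening.\<close>

definition grab_index :: "box \<Rightarrow> real" where
  "grab_index B = - gain_root (set_pmf (value_dist B)) (pmf (value_dist B)) uminus (cost B)"

text \<open>
  The value a box is worth to an unrestricted policy: \<open>E max (surrogate B X) y\<close> is the optimal
  utility of the box alone with outside option \<open>y\<close>.
\<close>

definition surrogate :: "box \<Rightarrow> real \<Rightarrow> real" where
  "surrogate B x =
     (if grab_index B \<le> open_index B then max (grab_index B) (min x (open_index B)) else mean B)"

locale finite_box =
  fixes B :: box
  assumes finite_support: "finite (set_pmf (value_dist B))"
    and nonneg_value: "\<And>x. x \<in> set_pmf (value_dist B) \<Longrightarrow> 0 \<le> x"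
    and nonneg_cost: "0 \<le> cost B"
begin

abbreviation "D \<equiv> value_dist B"

lemma open_index_gain: "expect D (\<lambda>x. max (x - open_index B) 0) = cost B"
  unfolding expect_sum_pmf[OF finite_support] open_index_def
  by (rule gain_root[OF finite_support set_pmf_not_empty _ nonneg_cost]) (simp add: pmf_positive)

text \<open>The counterpart at the lower end: against the outside option
  \<open>grab_index B\<close>, opening is worth exactly the mean.\<close>

lemma grab_index_gain: "expect D (\<lambda>x. max (grab_index B - x) 0) = cost B"
proof -
  have "(\<Sum>x\<in>set_pmf D. pmf D x * max (- x - gain_root (set_pmf D) (pmf D) uminus (cost B)) 0) = cost B"
    by (rule gain_root[OF finite_support set_pmf_not_empty _ nonneg_cost]) (simp add: pmf_positive)
  moreover have "- x - r = - r - x" for x r :: real by simp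
  ultimately show ?thesis unfolding expect_sum_pmf[OF finite_support] grab_index_def by (simp only:)
qed

lemma grab_index_nonneg: "0 \<le> grab_index B"
proof -
  have "gain_root (set_pmf D) (pmf D) uminus (cost B) \<le> 0"
    unfolding gain_root_def
  proof (intro Max.boundedI, goal_cases)
    case (3 a)
    then obtain t where a: "a = ((\<Sum>x\<in>{x \<in> set_pmf D. - t \<le> - x}. pmf D x * - x) - cost B) /
       (\<Sum>x\<in>{x \<in> set_pmf D. - t \<le> - x}. pmf D x)" by auto
    have "(\<Sum>x\<in>{x \<in> set_pmf D. - t \<le> - x}. pmf D x * - x) \<le> 0"
      using nonneg_value by (intro sum_nonpos) (auto intro: mult_nonneg_nonneg)
    then show ?case unfolding a using nonneg_cost by (intro divide_nonpos_nonneg sum_nonneg) auto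
  qed (use finite_support set_pmf_not_empty in auto)
  then show ?thesis unfolding grab_index_def by simp
qed

lemma mean_nonneg: "0 \<le> mean B"
  unfolding mean_def using nonneg_value by (intro integral_nonneg_AE AE_pmfI)

lemma surrogate_nonneg: "0 \<le> surrogate B x"
  using grab_index_nonneg mean_nonneg unfolding surrogate_def by (auto simp: max_def)

lemma expect_max: "expect D (\<lambda>x. max x y) = mean B + expect D (\<lambda>x. max (y - x) 0)"
  "expect D (\<lambda>x. max x y) = y + expect D (\<lambda>x. max (x - y) 0)"
proof -
  have "expect D (\<lambda>x. max x y) = expect D (\<lambda>x. x + max (y - x) 0)"
    by (intro expect_cong) auto
  then show "expect D (\<lambda>x. max x y) = mean B + expect D (\<lambda>x. max (y - x) 0)"
    unfolding mean_def by (simp add: expect_add[OF finite_support])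
  have "expect D (\<lambda>x. max x y) = expect D (\<lambda>x. y + max (x - y) 0)"
    by (intro expect_cong) auto
  then show "expect D (\<lambda>x. max x y) = y + expect D (\<lambda>x. max (x - y) 0)"
    by (simp add: expect_add[OF finite_support])
qed

text \<open>Raising to the grab index and capping at the open index shift the mean by
  \<open>cost B\<close> in opposite directions.\<close>

lemma mean_surrogate: "expect D (surrogate B) = mean B"
proof (cases "grab_index B \<le> open_index B")
  case True
  have "expect D (surrogate B) =
      expect D (\<lambda>x. x + max (grab_index B - x) 0 - max (x - open_index B) 0)"
    using True by (intro expect_cong) (auto simp: surrogate_def max_def min_def)
  then show ?thesis using open_index_gain grab_index_gain
    by (simp add: expect_add[OF finite_support] expect_diff[OF finite_support] mean_def)
next
  case False
  then have "surrogate B = (\<lambda>_. mean B)" by (simp add: surrogate_def fun_eq_iff)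
  then show ?thesis by simp
qed

lemma surrogate_ge_mean: "max (mean B) y \<le> expect D (\<lambda>x. max (surrogate B x) y)"
proof -
  have "expect D (surrogate B) \<le> expect D (\<lambda>x. max (surrogate B x) y)"
    by (rule expect_mono[OF finite_support]) simp
  moreover have "expect D (\<lambda>_. y) \<le> expect D (\<lambda>x. max (surrogate B x) y)"
    by (rule expect_mono[OF finite_support]) simp
  ultimately show ?thesis unfolding mean_surrogate by simp
qed

text \<open>Amortisation: up to the index, paying the cost has the same effect in expectation as
  capping the value at the index.\<close>

lemma open_index_value:
  assumes "y \<le> open_index B"
  shows "expect D (\<lambda>x. max (min x (open_index B)) y) = expect D (\<lambda>x. max x y) - cost B"
proof -
  have "expect D (\<lambda>x. max (min x (open_index B)) y) = expect D (\<lambda>x. max x y - max (x - open_index B) 0)"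
    using assms by (intro expect_cong) (auto simp: max_def min_def)
  then show ?thesis using open_index_gain by (simp add: expect_diff[OF finite_support])
qed

text \<open>Outside the interval between the indices, opening is no better than grabbing or than the
  outside option, and the mean bound covers both. Inside it the floor is hidden by \<open>y\<close>,
  and the cap gives opening its exact value.\<close>

lemma surrogate_ge_open: "expect D (\<lambda>x. max x y) - cost B \<le> expect D (\<lambda>x. max (surrogate B x) y)"
proof -
  have ge: "max (mean B) y \<le> expect D (\<lambda>x. max (surrogate B x) y)" by (rule surrogate_ge_mean)
  consider "y \<le> grab_index B" | "open_index B \<le> y" | "grab_index B < y" "y < open_index B" by linarith
  then show ?thesis
  proof cases
    case 1
    then have "expect D (\<lambda>x. max (y - x) 0) \<le> expect D (\<lambda>x. max (grab_index B - x) 0)"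
      by (intro expect_mono[OF finite_support]) auto
    then show ?thesis using ge grab_index_gain expect_max(1)[of y] by linarith
  next
    case 2
    then have "expect D (\<lambda>x. max (x - y) 0) \<le> expect D (\<lambda>x. max (x - open_index B) 0)"
      by (intro expect_mono[OF finite_support]) auto
    then show ?thesis using ge open_index_gain expect_max(2)[of y] by linarith
  next
    case 3
    then have "expect D (\<lambda>x. max (surrogate B x) y) = expect D (\<lambda>x. max (min x (open_index B)) y)"
      by (intro expect_cong) (auto simp: surrogate_def)
    then show ?thesis using open_index_value[of y] 3 by simp
  qed
qed

end

section \<open>A supermartingale bound on every policy\<close>

section \<open>Runs of policies\<close>

lemma run_compose:
  assumes "h' \<in> set_pmf (run I p k h)" "h'' \<in> set_pmf (run I p m h')"
  shows "h'' \<in> set_pmf (run I p (k + m) h)"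
  using assms(1)
proof (induction k arbitrary: h)
  case 0
  then show ?case using assms(2) by simp
next
  case (Suc k)
  show ?case
  proof (cases "p h")
    \<comment> \<open>A stopped run is a fixed point: further steps leave the history
      unchanged.\<close>
    case Stop
    then show ?thesis using Suc assms(2) by (cases m) auto
  qed (use Suc in auto)
qed

lemma reachable_step:
  "h \<in> reachable I p \<Longrightarrow> h' \<in> set_pmf (run I p 1 h) \<Longrightarrow> h' \<in> reachable I p"
  unfolding reachable_def using run_compose[where h="[]" and m=1] by blast

lemma Nil_reachable: "[] \<in> reachable I p"
  unfolding reachable_def by (rule UN_I[of 0]) auto

inductive valid_history :: "pboi \<Rightarrow> history \<Rightarrow> bool" for I where
  valid_Nil: "valid_history I []"
| valid_Opened: "valid_history I h \<Longrightarrow> legal I h (Open i) \<Longrightarrow> x \<in> set_pmf (value_dist (boxes I ! i)) \<Longrightarrow>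
    valid_history I (h @ [Opened i x])"
| valid_Grabbed: "valid_history I h \<Longrightarrow> legal I h (Grab i) \<Longrightarrow> valid_history I (h @ [Grabbed i])"
| valid_Accepted: "valid_history I h \<Longrightarrow> legal I h (Accept i) \<Longrightarrow> valid_history I (h @ [Accepted i])"

lemma history_Nil [simp]: "inspected [] = {}" "accepted [] = {}" "opened [] = {}"
  by (auto simp: inspected_def accepted_def opened_def)

lemma history_snoc [simp]:
  "inspected (h @ [Opened i x]) = insert i (inspected h)"
  "inspected (h @ [Grabbed i]) = insert i (inspected h)"
  "inspected (h @ [Accepted i]) = inspected h"
  "accepted (h @ [Opened i x]) = accepted h"
  "accepted (h @ [Grabbed i]) = accepted h"
  "accepted (h @ [Accepted i]) = insert i (accepted h)"
  "opened (h @ [Opened i x]) = insert i (opened h)"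
  "opened (h @ [Grabbed i]) = opened h"
  "opened (h @ [Accepted i]) = opened h"
  by (auto simp: inspected_def accepted_def opened_def)

text \<open>Legality is demanded only where \<open>Q\<close> holds. With reachability as
  \<open>Q\<close> this covers arbitrary policies, which may act illegally elsewhere; with the
  trivial \<open>Q\<close> it covers index policies.\<close>

definition run_invariant :: "pboi \<Rightarrow> policy \<Rightarrow> (history \<Rightarrow> bool) \<Rightarrow> bool" where
  "run_invariant I p Q \<longleftrightarrow> (\<forall>h. valid_history I h \<longrightarrow> Q h \<longrightarrow> legal I h (p h)) \<and>
     (\<forall>h h'. Q h \<longrightarrow> h' \<in> set_pmf (run I p 1 h) \<longrightarrow> Q h')"

lemma run_invariantD:
  assumes "run_invariant I p Q"
  shows "valid_history I h \<Longrightarrow> Q h \<Longrightarrow> legal I h (p h)" "Q h \<Longrightarrow> h' \<in> set_pmf (run I p 1 h) \<Longrightarrow> Q h'"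
  using assms unfolding run_invariant_def by blast+

lemma valid_run:
  assumes "valid_history I h" "Q h" "h' \<in> set_pmf (run I p k h)"
    and inv: "run_invariant I p Q"
  shows "valid_history I h' \<and> Q h'"
  using assms(1-3)
proof (induction k arbitrary: h)
  case (Suc k)
  note l = run_invariantD(1)[OF inv Suc(2,3)] and q = run_invariantD(2)[OF inv Suc(3)]
  show ?case
  proof (cases "p h")
    case (Open i)
    then obtain x where x: "x \<in> set_pmf (value_dist (boxes I ! i))" "h' \<in> set_pmf (run I p k (h @ [Opened i x]))"
      using Suc(4) by auto
    show ?thesis using Open l x(1) q by (intro Suc.IH[OF _ _ x(2)] valid_Opened Suc(2)) auto
  next
    case (Grab i)
    show ?thesis using Grab l q Suc(4) by (intro Suc.IH[of "h @ [Grabbed i]"] valid_Grabbed Suc(2)) auto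
  next
    case (Accept i)
    show ?thesis using Accept l q Suc(4) by (intro Suc.IH[of "h @ [Accepted i]"] valid_Accepted Suc(2)) auto
  next
    case Stop
    then show ?thesis using Suc by auto
  qed
qed auto

locale valid_instance =
  fixes I :: pboi
  assumes inst: "pboi_instance I"
begin

abbreviation "n \<equiv> length (boxes I)"
abbreviation "F \<equiv> indep I"
abbreviation "bx i \<equiv> boxes I ! i"
abbreviation "dist_of i \<equiv> value_dist (bx i)"
abbreviation "unseen h \<equiv> {..<n} - inspected h"

lemma mat: "matroid {..<n} F"
  using inst by (simp add: pboi_instance_def)

lemma finite_bx: "i < n \<Longrightarrow> finite_box (bx i)"
  using inst nth_mem[of i "boxes I"] unfolding pboi_instance_def by unfold_locales auto

lemma finite_dist: "i < n \<Longrightarrow> finite (set_pmf (dist_of i))"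
  using finite_bx by (simp add: finite_box_def)

lemma terminal_value_snoc:
  shows "j \<noteq> i \<Longrightarrow> terminal_value I (h @ [Opened i x]) j = terminal_value I h j"
    and "j \<noteq> i \<Longrightarrow> terminal_value I (h @ [Grabbed i]) j = terminal_value I h j"
    and "terminal_value I (h @ [Accepted i]) j = terminal_value I h j"
    and "i \<notin> inspected h \<Longrightarrow> terminal_value I (h @ [Opened i x]) i = x"
    and "terminal_value I (h @ [Grabbed i]) i = mean (bx i)"
proof -
  assume i: "i \<notin> inspected h"
  then have "(THE x'. Opened i x' \<in> set (h @ [Opened i x])) = x" 
    by (auto simp: inspected_def intro!: the_equality)
  then show "terminal_value I (h @ [Opened i x]) i = x" using i by (simp add: terminal_value_def inspected_def)
qed (auto simp: terminal_value_def)

lemma valid_history_facts: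
  assumes "valid_history I h"
  shows "inspected h \<subseteq> {..<n}" "accepted h \<subseteq> inspected h" "accepted h \<in> F" "finite (opened h)"
    "opened h \<subseteq> inspected h"
    "\<And>i. i \<in> inspected h \<Longrightarrow> 0 \<le> terminal_value I h i"
proof -
  have "inspected h \<subseteq> {..<n} \<and> accepted h \<subseteq> inspected h \<and> accepted h \<in> F \<and> finite (opened h) \<and> opened h \<subseteq> inspected h"
    using assms by (induction rule: valid_history.induct) (auto simp: matroidD(2)[OF mat])
  then show "inspected h \<subseteq> {..<n}" "accepted h \<subseteq> inspected h" "accepted h \<in> F" "finite (opened h)"
    "opened h \<subseteq> inspected h" by auto
next
  fix i assume "i \<in> inspected h"
  with assms show "0 \<le> terminal_value I h i"
  proof (induction rule: valid_history.induct)
    case (valid_Opened h j x)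
    have j: "j < n" "j \<notin> inspected h" using valid_Opened(2) by auto
    have "0 \<le> x" using finite_bx[OF j(1)] valid_Opened(3) by (simp add: finite_box_def)
    then show ?case using valid_Opened(4,5) terminal_value_snoc(1)[of i j h x] terminal_value_snoc(4)[OF j(2), of x]
      by (cases "i = j") simp_all
  next
    case (valid_Grabbed h j)
    have j: "j < n" "j \<notin> inspected h" using valid_Grabbed(2) by auto
    have "0 \<le> mean (bx j)" using finite_box.mean_nonneg[OF finite_bx[OF j(1)]] .
    then show ?case using valid_Grabbed(3,4) terminal_value_snoc(2)[of i j h] terminal_value_snoc(5)[of h j]
      by (cases "i = j") simp_all
  qed (simp_all add: terminal_value_snoc(3))
qed

lemma utility_snoc:
  assumes h: "valid_history I h"
  shows "i \<notin> inspected h \<Longrightarrow> utility I (h @ [Opened i x]) = utility I h - cost (bx i)"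
    and "i \<notin> inspected h \<Longrightarrow> utility I (h @ [Grabbed i]) = utility I h"
    and "i \<in> inspected h \<Longrightarrow> i \<notin> accepted h \<Longrightarrow> utility I (h @ [Accepted i]) = utility I h + terminal_value I h i"
proof -
  note facts = valid_history_facts[OF h]
  have fin: "finite (accepted h)" by (rule finite_subset[OF facts(2) finite_subset[OF facts(1)]]) simp
  have same: "(\<Sum>j\<in>accepted h. terminal_value I (h @ [e]) j) = (\<Sum>j\<in>accepted h. terminal_value I h j)"
    if "i \<notin> inspected h" "e = Opened i x \<or> e = Grabbed i" for e
  proof (rule sum.cong[OF refl])
    fix j assume "j \<in> accepted h"
    then have "j \<noteq> i" using facts(2) that(1) by blast
    then show "terminal_value I (h @ [e]) j = terminal_value I h j"
      using that(2) terminal_value_snoc(1,2) by blast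
  qed
  show "utility I (h @ [Opened i x]) = utility I h - cost (bx i)" if "i \<notin> inspected h"
  proof -
    have "i \<notin> opened h" using that facts(5) by blast
    then show ?thesis using same[OF that, of "Opened i x"] facts(4) by (simp add: utility_def)
  qed
  show "utility I (h @ [Grabbed i]) = utility I h" if "i \<notin> inspected h"
    using same[OF that, of "Grabbed i"] by (simp add: utility_def)
  show "utility I (h @ [Accepted i]) = utility I h + terminal_value I h i" if "i \<notin> accepted h"
    using that fin by (simp add: utility_def terminal_value_snoc(3))
qed

subsection \<open>A potential for histories\<close>

text \<open>Inspected boxes count with their actual value, all others through
  \<open>\<kappa>\<close> applied to a fresh draw. \<open>\<kappa>\<close> becomes
  \<open>surrogate\<close> for the upper bound and \<open>committed C\<close> for the lower
  one.\<close>

definition weights :: "(nat \<Rightarrow> real \<Rightarrow> real) \<Rightarrow> history \<Rightarrow> (nat \<Rightarrow> real) \<Rightarrow> nat \<Rightarrow> real" where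
  "weights \<kappa> h w j = (if j \<in> inspected h then terminal_value I h j else \<kappa> j (w j))"

definition potential :: "(nat \<Rightarrow> real \<Rightarrow> real) \<Rightarrow> history \<Rightarrow> real" where
  "potential \<kappa> h = expect (Pi_pmf (unseen h) 0 dist_of) (\<lambda>w. max_weight F (accepted h) (weights \<kappa> h w))"

text \<open>The draw of box \<open>i\<close> is placed innermost, so that the other weights, and
  with them the price of \<open>i\<close>, are fixed inside.\<close>

lemma potential_split:
  assumes "i < n" "i \<notin> inspected h"
  shows "potential \<kappa> h = expect (Pi_pmf (unseen h - {i}) 0 dist_of)
    (\<lambda>w. expect (dist_of i) (\<lambda>x. max_weight F (accepted h) ((weights \<kappa> h w)(i := \<kappa> i x))))"
proof -
  have "unseen h = insert i (unseen h - {i})" using assms by auto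
  then have "potential \<kappa> h = expect (Pi_pmf (insert i (unseen h - {i})) 0 dist_of)
      (\<lambda>w. max_weight F (accepted h) (weights \<kappa> h w))" unfolding potential_def by simp
  also have "\<dots> = expect (dist_of i) (\<lambda>x. expect (Pi_pmf (unseen h - {i}) 0 dist_of)
      (\<lambda>w. max_weight F (accepted h) (weights \<kappa> h (w(i := x)))))"
    using assms by (subst expect_Pi_pmf_insert) (auto intro: finite_dist)
  finally have 1: "potential \<kappa> h = expect (dist_of i) (\<lambda>x. expect (Pi_pmf (unseen h - {i}) 0 dist_of)
      (\<lambda>w. max_weight F (accepted h) (weights \<kappa> h (w(i := x)))))" .
  have eq: "weights \<kappa> h (w(i := x)) = (weights \<kappa> h w)(i := \<kappa> i x)" for w x
    using assms by (auto simp: weights_def fun_eq_iff)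
  from 1[unfolded eq] show ?thesis
    by (subst (asm) expect_swap) (auto intro!: finite_dist finite_set_Pi_pmf assms)
qed

lemma potential_open:
  assumes "i < n" "i \<notin> inspected h"
  shows "expect (dist_of i) (\<lambda>x. potential \<kappa> (h @ [Opened i x])) =
    expect (Pi_pmf (unseen h - {i}) 0 dist_of)
    (\<lambda>w. expect (dist_of i) (\<lambda>x. max_weight F (accepted h) ((weights \<kappa> h w)(i := x))))"
proof -
  have "weights \<kappa> (h @ [Opened i x]) w = (weights \<kappa> h w)(i := x)" for w x
    using assms by (auto simp: weights_def fun_eq_iff terminal_value_snoc)
  moreover have "unseen (h @ [Opened i x]) = unseen h - {i}" for x by auto
  ultimately have "expect (dist_of i) (\<lambda>x. potential \<kappa> (h @ [Opened i x])) =
    expect (dist_of i) (\<lambda>x. expect (Pi_pmf (unseen h - {i}) 0 dist_of)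
      (\<lambda>w. max_weight F (accepted h) ((weights \<kappa> h w)(i := x))))"
    unfolding potential_def by simp
  then show ?thesis
    by (subst (asm) expect_swap) (auto intro!: finite_dist finite_set_Pi_pmf assms)
qed

lemma potential_grab:
  assumes "i < n" "i \<notin> inspected h"
  shows "potential \<kappa> (h @ [Grabbed i]) =
    expect (Pi_pmf (unseen h - {i}) 0 dist_of)
    (\<lambda>w. max_weight F (accepted h) ((weights \<kappa> h w)(i := mean (bx i))))"
proof -
  have "weights \<kappa> (h @ [Grabbed i]) w = (weights \<kappa> h w)(i := mean (bx i))" for w
    using assms by (auto simp: weights_def fun_eq_iff terminal_value_snoc)
  moreover have "unseen (h @ [Grabbed i]) = unseen h - {i}" by auto
  ultimately show ?thesis unfolding potential_def by simp
qed

lemma potential_accept: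
  "potential \<kappa> (h @ [Accepted i]) =
    expect (Pi_pmf (unseen h) 0 dist_of) (\<lambda>w. max_weight F (insert i (accepted h)) (weights \<kappa> h w))"
proof -
  have "weights \<kappa> (h @ [Accepted i]) w = weights \<kappa> h w" for w
    by (auto simp: weights_def fun_eq_iff terminal_value_snoc)
  then show ?thesis unfolding potential_def by simp
qed

lemma finite_unseen: "finite (set_pmf (Pi_pmf (unseen h - X) 0 dist_of))"
  by (intro finite_set_Pi_pmf) (auto intro: finite_dist)

lemma finite_unseen': "finite (set_pmf (Pi_pmf (unseen h) 0 dist_of))"
  using finite_unseen[of h "{}"] by simp

lemma finite_run:
  assumes "valid_history I h" "Q h"
    and inv: "run_invariant I p Q"
  shows "finite (set_pmf (run I p k h))"
  using assms(1,2)
proof (induction k arbitrary: h)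
  case (Suc k)
  note l = run_invariantD(1)[OF inv Suc(2,3)] and q = run_invariantD(2)[OF inv Suc(3)]
  show ?case
  proof (cases "p h")
    case (Open i)
    have "finite (set_pmf (run I p k (h @ [Opened i x])))" if "x \<in> set_pmf (dist_of i)" for x
      using Open l q that by (intro Suc.IH valid_Opened Suc(2)) auto
    then show ?thesis using Open l finite_dist by auto
  next
    case (Grab i)
    then show ?thesis using l q by (auto intro!: Suc.IH[of "h @ [Grabbed i]"] valid_Grabbed Suc(2))
  next
    case (Accept i)
    then show ?thesis using l q by (auto intro!: Suc.IH[of "h @ [Accepted i]"] valid_Accepted Suc(2))
  qed auto
qed auto

lemma expect_run_open:
  assumes "valid_history I h" "Q h"
    and inv: "run_invariant I p Q"
    and "p h = Open i"
  shows "expect (run I p (Suc k) h) f = expect (dist_of i) (\<lambda>x. expect (run I p k (h @ [Opened i x])) f)"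
proof -
  have l: "legal I h (Open i)" using run_invariantD(1)[OF inv assms(1,2)] assms(4) by simp
  have "finite (set_pmf (run I p k (h @ [Opened i x])))" if "x \<in> set_pmf (dist_of i)" for x
    using that run_invariantD(2)[OF inv assms(2)] assms(4) by (intro finite_run[OF _ _ inv] valid_Opened assms(1) l) auto
  then show ?thesis using assms(4) l finite_dist by (simp add: expect_bind)
qed

subsection \<open>The upper bound on the optimum\<close>

abbreviation "\<kappa>_opt \<equiv> \<lambda>i. surrogate (bx i)"

text \<open>With all other weights fixed, the box faces nothing but its exchange price as an outside
  option, so the single-box inequalities apply.\<close>

lemma surrogate_open_step:
  assumes i: "i < n" "i \<notin> A" and A: "A \<in> F"
  shows "expect (dist_of i) (\<lambda>x. max_weight F A (v(i := x))) - cost (bx i) \<le>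
    expect (dist_of i) (\<lambda>x. max_weight F A (v(i := surrogate (bx i) x)))"
    and "max_weight F A (v(i := mean (bx i))) \<le> expect (dist_of i) (\<lambda>x. max_weight F A (v(i := surrogate (bx i) x)))"
proof -
  interpret b: finite_box "bx i" by (rule finite_bx[OF i(1)])
  have "expect (dist_of i) (\<lambda>x. max_weight F A (v(i := x))) - cost (bx i) \<le>
    expect (dist_of i) (\<lambda>x. max_weight F A (v(i := surrogate (bx i) x))) \<and>
    max_weight F A (v(i := mean (bx i))) \<le> expect (dist_of i) (\<lambda>x. max_weight F A (v(i := surrogate (bx i) x)))"
  proof (cases "insert i A \<in> F")
    case True
    obtain y where y: "\<forall>x. max_weight F A (v(i := x)) = max_weight F (insert i A) v + max x y"
      by (rule max_weight_price[OF mat True i(2), of v]) (rule that)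
    show ?thesis using b.surrogate_ge_open[of y] b.surrogate_ge_mean[of y]
      by (simp add: y expect_add[OF b.finite_support])
  next
    case False
    show ?thesis using b.nonneg_cost by (simp add: max_weight_loop[OF mat False A])
  qed
  then show "expect (dist_of i) (\<lambda>x. max_weight F A (v(i := x))) - cost (bx i) \<le>
    expect (dist_of i) (\<lambda>x. max_weight F A (v(i := surrogate (bx i) x)))"
    "max_weight F A (v(i := mean (bx i))) \<le> expect (dist_of i) (\<lambda>x. max_weight F A (v(i := surrogate (bx i) x)))"
    by auto
qed

text \<open>Utility plus potential is a supermartingale: no legal action raises its expectation, and
  stopping only forfeits a nonnegative potential.\<close>

lemma utility_le_potential:
  assumes "valid_history I h" "Q h"
    and inv: "run_invariant I p Q"
  shows "expect (run I p k h) (utility I) \<le> utility I h + potential \<kappa>_opt h"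
  using assms(1,2)
proof (induction k arbitrary: h)
  case 0
  have "0 \<le> potential \<kappa>_opt h" unfolding potential_def
    by (intro integral_nonneg_AE AE_I2 max_weight_nonneg[OF mat] valid_history_facts(3) 0)
  then show ?case by simp
next
  case (Suc k)
  note l = run_invariantD(1)[OF inv Suc(2,3)] and q = run_invariantD(2)[OF inv Suc(3)] and facts = valid_history_facts[OF Suc(2)]
  show ?case
  proof (cases "p h")
    case (Open i)
    then have i: "i < n" "i \<notin> inspected h" using l by auto
    then have iA: "i \<notin> accepted h" using facts(2) by auto
    have "expect (run I p (Suc k) h) (utility I) = expect (dist_of i) (\<lambda>x. expect (run I p k (h @ [Opened i x])) (utility I))"
      by (rule expect_run_open[OF Suc(2,3) inv Open])
    also have "\<dots> \<le> expect (dist_of i) (\<lambda>x. (utility I h - cost (bx i)) + potential \<kappa>_opt (h @ [Opened i x]))"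
    proof (rule expect_mono[OF finite_dist[OF i(1)]])
      fix x assume x: "x \<in> set_pmf (dist_of i)"
      have "expect (run I p k (h @ [Opened i x])) (utility I) \<le> utility I (h @ [Opened i x]) + potential \<kappa>_opt (h @ [Opened i x])"
        using l Open x q by (intro Suc.IH valid_Opened Suc(2)) auto
      then show "expect (run I p k (h @ [Opened i x])) (utility I) \<le> (utility I h - cost (bx i)) + potential \<kappa>_opt (h @ [Opened i x])"
        using utility_snoc(1)[OF Suc(2) i(2)] by simp
    qed
    also have "\<dots> = utility I h + (expect (dist_of i) (\<lambda>x. potential \<kappa>_opt (h @ [Opened i x])) - cost (bx i))"
      by (simp add: expect_add[OF finite_dist[OF i(1)]])
    also have "expect (dist_of i) (\<lambda>x. potential \<kappa>_opt (h @ [Opened i x])) - cost (bx i) =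
      expect (Pi_pmf (unseen h - {i}) 0 dist_of)
       (\<lambda>w. expect (dist_of i) (\<lambda>x. max_weight F (accepted h) ((weights \<kappa>_opt h w)(i := x))) - cost (bx i))"
      unfolding potential_open[OF i] by (simp add: expect_diff[OF finite_unseen])
    also have "\<dots> \<le> potential \<kappa>_opt h" unfolding potential_split[OF i]
      by (rule expect_mono[OF finite_unseen]) (rule surrogate_open_step(1)[OF i(1) iA facts(3)])
    finally show ?thesis by simp
  next
    case (Grab i)
    then have i: "i < n" "i \<notin> inspected h" using l by auto
    then have iA: "i \<notin> accepted h" using facts(2) by auto
    have "expect (run I p k (h @ [Grabbed i])) (utility I) \<le> utility I (h @ [Grabbed i]) + potential \<kappa>_opt (h @ [Grabbed i])"
      using l Grab q by (intro Suc.IH valid_Grabbed Suc(2)) auto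
    also have "potential \<kappa>_opt (h @ [Grabbed i]) \<le> potential \<kappa>_opt h"
      unfolding potential_grab[OF i] potential_split[OF i]
      by (rule expect_mono[OF finite_unseen]) (rule surrogate_open_step(2)[OF i(1) iA facts(3)])
    finally show ?thesis using Grab utility_snoc(2)[OF Suc(2) i(2)] by simp
  next
    case (Accept i)
    then have i: "i \<in> inspected h" "i \<notin> accepted h" "insert i (accepted h) \<in> F" using l by auto
    have "expect (run I p k (h @ [Accepted i])) (utility I) \<le> utility I (h @ [Accepted i]) + potential \<kappa>_opt (h @ [Accepted i])"
      using l Accept q by (intro Suc.IH valid_Accepted Suc(2)) auto
    also have "\<dots> = utility I h + expect (Pi_pmf (unseen h) 0 dist_of)
       (\<lambda>w. terminal_value I h i + max_weight F (insert i (accepted h)) (weights \<kappa>_opt h w))"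
      using utility_snoc(3)[OF Suc(2) i(1,2)] unfolding potential_accept by (simp add: expect_add[OF finite_unseen'])
    also have "\<dots> \<le> utility I h + potential \<kappa>_opt h"
      unfolding potential_def
    proof (intro add_left_mono expect_mono finite_unseen')
      fix w
      show "terminal_value I h i + max_weight F (insert i (accepted h)) (weights \<kappa>_opt h w) \<le>
          max_weight F (accepted h) (weights \<kappa>_opt h w)"
        using max_weight_accept_le[OF mat i(3,2), of "weights \<kappa>_opt h w"] i(1) by (simp add: weights_def)
    qed
    finally show ?thesis using Accept by simp
  next
    case Stop
    have "0 \<le> potential \<kappa>_opt h" unfolding potential_def
      by (intro integral_nonneg_AE AE_I2 max_weight_nonneg[OF mat] facts(3))
    then show ?thesis using Stop by simp
  qed
qed

definition upper_bound :: real where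
  "upper_bound = expect (Pi_pmf {..<n} 0 dist_of) (\<lambda>w. max_weight F {} (\<lambda>j. surrogate (bx j) (w j)))"

lemma potential_Nil: "potential \<kappa> [] = expect (Pi_pmf {..<n} 0 dist_of) (\<lambda>w. max_weight F {} (\<lambda>j. \<kappa> j (w j)))"
  by (simp add: potential_def weights_def[abs_def])

lemma upper_bound_nonneg: "0 \<le> upper_bound"
  unfolding upper_bound_def by (intro integral_nonneg_AE AE_I2 max_weight_nonneg[OF mat] matroidD(2)[OF mat])

lemma OPT_le_upper_bound: "OPT I \<le> upper_bound"
proof -
  have pol: "expected_utility I p \<le> upper_bound" if "is_policy I p" for p
  proof -
    have "expect (run I p (2 * n) []) (utility I) \<le> utility I [] + potential \<kappa>_opt []"
      using that Nil_reachable reachable_step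
      by (intro utility_le_potential[where Q="\<lambda>h. h \<in> reachable I p"] valid_Nil)
        (auto simp: is_policy_def run_invariant_def)
    then show ?thesis unfolding expected_utility_def potential_Nil upper_bound_def by (simp add: utility_def)
  qed
  show ?thesis unfolding OPT_def
  proof (rule cSUP_least)
    have "is_policy I (\<lambda>_. Stop)" by (simp add: is_policy_def)
    then show "{P. \<forall>p\<in>set_pmf P. is_policy I p} \<noteq> {}" by (intro CollectI exI[of _ "return_pmf (\<lambda>_. Stop)"] ex_in_conv[THEN iffD1]) auto
  next
    fix P assume P: "P \<in> {P. \<forall>p\<in>set_pmf P. is_policy I p}"
    show "rand_utility I P \<le> upper_bound"
    proof (cases "integrable (measure_pmf P) (expected_utility I)")
      case True
      have "rand_utility I P \<le> expect P (\<lambda>_. upper_bound)" unfolding rand_utility_def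
        using P pol by (intro integral_mono_AE True AE_pmfI) auto
      then show ?thesis by simp
    next
      \<comment> \<open>The integral of a non-integrable function is 0 by convention, which the
        nonnegative bound covers.\<close>
      case False
      then show ?thesis unfolding rand_utility_def by (simp add: not_integrable_integral_eq upper_bound_nonneg)
    qed
  qed
qed

end

section \<open>Adaptive play once the commitment is fixed\<close>

section \<open>The index policy\<close>

context valid_instance
begin

definition index :: "nat set \<Rightarrow> history \<Rightarrow> nat \<Rightarrow> real" where
  "index C h j = (if j \<in> inspected h then terminal_value I h j
     else if j \<in> C then open_index (bx j) else mean (bx j))"

definition candidates :: "history \<Rightarrow> nat set" where
  "candidates h = {j \<in> {..<n}. j \<notin> accepted h \<and> insert j (accepted h) \<in> F}"

definition advance :: "nat set \<Rightarrow> history \<Rightarrow> nat \<Rightarrow> action" where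
  "advance C h i = (if i \<in> inspected h then Accept i else if i \<in> C then Open i else Grab i)"

definition greedy_step :: "nat set \<Rightarrow> history \<Rightarrow> action \<Rightarrow> bool" where
  "greedy_step C h a \<longleftrightarrow> (if candidates h = {} then a = Stop
     else \<exists>i\<in>candidates h. (\<forall>j\<in>candidates h. index C h j \<le> index C h i) \<and> a = advance C h i)"

lemma greedy_step_legal: "greedy_step C h a \<Longrightarrow> legal I h a"
  by (auto simp: greedy_step_def candidates_def advance_def split: if_splits)

text \<open>The amortised value of a committed box: when the box is opened, the cap absorbs the cost
  as in \<open>open_index_value\<close>.\<close>

definition committed :: "nat set \<Rightarrow> nat \<Rightarrow> real \<Rightarrow> real" where
  "committed C j x = (if j \<in> C then min x (open_index (bx j)) else mean (bx j))"

lemma weights_le_index: "weights (committed C) h w j \<le> index C h j"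
  by (simp add: weights_def index_def committed_def)

text \<open>The price of the advanced box is at most its index, because each competing weight is at
  most the index of its box. Hence accepting it, opening it at the capped value, or grabbing it
  preserves utility plus potential in expectation. Every step enlarges \<open>inspected h\<close> or
  \<open>accepted h\<close>, so the bound on \<open>k\<close> leaves enough steps to finish.\<close>

lemma potential_le_utility:
  assumes h: "valid_history I h" and step: "\<And>h. valid_history I h \<Longrightarrow> greedy_step C h (p h)"
    and C: "\<And>i. i \<in> C \<Longrightarrow> 0 \<le> open_index (bx i)"
    and k: "2 * n \<le> k + card (inspected h) + card (accepted h)"
  shows "utility I h + potential (committed C) h \<le> expect (run I p k h) (utility I)"
  using h k
proof (induction k arbitrary: h)
  case (0 h)
  note facts = valid_history_facts[OF 0(1)]
  have fin: "finite (inspected h)" by (rule finite_subset[OF facts(1)]) simp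
  \<comment> \<open>With no step left both counts must be maximal: every box has been accepted and
    the potential is 0.\<close>
  have "card (inspected h) \<le> n" using card_mono[OF _ facts(1)] by simp
  moreover have "card (accepted h) \<le> n" using card_mono[OF fin facts(2)] calculation by simp
  ultimately have "card (accepted h) = n" using 0(2) by simp
  then have "accepted h = {..<n}" using facts(1,2) by (intro card_subset_eq) auto
  then have "insert i (accepted h) \<notin> F" if "i \<notin> accepted h" for i
    using that matroidD(3)[OF mat] by blast
  then have "max_weight F (accepted h) v = 0" for v
    by (rule max_weight_none[OF mat facts(3)])
  then show ?case by (simp add: potential_def)
next
  case (Suc k)
  note facts = valid_history_facts[OF Suc(2)] and s = step[OF Suc(2)]
  note l = greedy_step_legal[OF s]
  have inv: "run_invariant I p (\<lambda>_. True)"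
    using greedy_step_legal step by (auto simp: run_invariant_def)
  have fin: "finite (inspected h)" by (rule finite_subset[OF facts(1)]) simp
  then have finA: "finite (accepted h)" using finite_subset[OF facts(2)] by simp
  show ?case
  proof (cases "candidates h = {}")
    case True
    then have "insert i (accepted h) \<notin> F" if "i \<notin> accepted h" for i
      using that matroidD(3)[OF mat, of "insert i (accepted h)"] by (auto simp: candidates_def)
    then have "max_weight F (accepted h) v = 0" for v
      by (rule max_weight_none[OF mat facts(3)])
    moreover have "p h = Stop" using s True by (simp add: greedy_step_def)
    ultimately show ?thesis by (simp add: potential_def)
  next
    case False
    then obtain i where i: "i \<in> candidates h" "\<forall>j\<in>candidates h. index C h j \<le> index C h i" "p h = advance C h i"
      using s by (auto simp: greedy_step_def)
    have i': "i < n" "i \<notin> accepted h" "insert i (accepted h) \<in> F" using i(1) by (auto simp: candidates_def)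
    have best: "weights (committed C) h w j \<le> index C h i" if "j \<notin> accepted h" "insert j (accepted h) \<in> F" for w j
    proof -
      have "j \<in> candidates h" using that matroidD(3)[OF mat that(2)] by (auto simp: candidates_def)
      then show ?thesis using i(2) weights_le_index[of C h w j] by force
    qed
    consider "i \<in> inspected h" | "i \<notin> inspected h" "i \<in> C" | "i \<notin> inspected h" "i \<notin> C" by blast
    then show ?thesis
    proof cases
      case 1
      then have a: "p h = Accept i" using i(3) by (simp add: advance_def)
      have w: "weights (committed C) h w i = terminal_value I h i" "index C h i = terminal_value I h i" for w
        using 1 by (simp_all add: weights_def index_def)
      have "utility I h + potential (committed C) h = utility I h + expect (Pi_pmf (unseen h) 0 dist_of)
         (\<lambda>v. terminal_value I h i + max_weight F (insert i (accepted h)) (weights (committed C) h v))"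
        unfolding potential_def
      proof (intro arg_cong2[where f="(+)"] refl expect_cong)
        fix v
        show "max_weight F (accepted h) (weights (committed C) h v) =
            terminal_value I h i + max_weight F (insert i (accepted h)) (weights (committed C) h v)"
          using max_weight_accept[OF mat i'(3,2), of "weights (committed C) h v"] best[of _ v] facts(6)[OF 1] w
          by simp
      qed
      also have "\<dots> = utility I (h @ [Accepted i]) + potential (committed C) (h @ [Accepted i])"
        unfolding potential_accept utility_snoc(3)[OF Suc(2) 1 i'(2)] by (simp add: expect_add[OF finite_unseen'])
      also have "\<dots> \<le> expect (run I p k (h @ [Accepted i])) (utility I)"
        using l a Suc(3) i'(2) finA by (intro Suc.IH valid_Accepted Suc(2)) auto
      finally show ?thesis using a by simp
    next
      case 2
      then have a: "p h = Open i" using i(3) by (simp add: advance_def)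
      interpret b: finite_box "bx i" by (rule finite_bx[OF i'(1)])
      let ?v = "weights (committed C) h"
      have idx: "index C h i = open_index (bx i)" using 2 by (simp add: index_def)
      have step: "expect (dist_of i) (\<lambda>x. max_weight F (accepted h) ((?v w)(i := committed C i x))) =
          expect (dist_of i) (\<lambda>x. max_weight F (accepted h) ((?v w)(i := x))) - cost (bx i)" for w
      proof -
        obtain y where y: "\<forall>x. max_weight F (accepted h) ((?v w)(i := x)) = max_weight F (insert i (accepted h)) (?v w) + max x y"
          "\<forall>b\<ge>0. (\<forall>j. j \<noteq> i \<longrightarrow> j \<notin> accepted h \<longrightarrow> insert j (accepted h) \<in> F \<longrightarrow> ?v w j \<le> b) \<longrightarrow> y \<le> b"
          by (rule max_weight_price[OF mat i'(3,2), of "?v w"]) (rule that)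
        \<comment> \<open>Nonnegativity of the index enters here: the price is controlled only by
          nonnegative bounds on the competitors.\<close>
        have "y \<le> open_index (bx i)" using y(2) C[OF 2(2)] best[of _ w] unfolding idx by blast
        then show ?thesis using b.open_index_value[of y] 2
          by (simp add: y(1) committed_def expect_add[OF b.finite_support])
      qed
      have "utility I h + potential (committed C) h = expect (dist_of i) (\<lambda>x. (utility I h - cost (bx i)) + potential (committed C) (h @ [Opened i x]))"
        unfolding potential_split[OF i'(1) 2(1)] step
        by (simp add: potential_open[OF i'(1) 2(1)] expect_add[OF b.finite_support] expect_diff[OF finite_unseen])
      also have "\<dots> \<le> expect (dist_of i) (\<lambda>x. expect (run I p k (h @ [Opened i x])) (utility I))"
      proof (rule expect_mono[OF b.finite_support])
        fix x assume "x \<in> set_pmf (dist_of i)"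
        then have "utility I (h @ [Opened i x]) + potential (committed C) (h @ [Opened i x]) \<le> expect (run I p k (h @ [Opened i x])) (utility I)"
          using l a Suc(3) 2(1) fin by (intro Suc.IH valid_Opened Suc(2)) auto
        then show "(utility I h - cost (bx i)) + potential (committed C) (h @ [Opened i x]) \<le> expect (run I p k (h @ [Opened i x])) (utility I)"
          using utility_snoc(1)[OF Suc(2) 2(1)] by simp
      qed
      also have "\<dots> = expect (run I p (Suc k) h) (utility I)"
        by (rule expect_run_open[OF Suc(2) _ inv a, symmetric]) simp
      finally show ?thesis .
    next
      case 3
      then have a: "p h = Grab i" using i(3) by (simp add: advance_def)
      have "potential (committed C) h = potential (committed C) (h @ [Grabbed i])"
        unfolding potential_split[OF i'(1) 3(1)] potential_grab[OF i'(1) 3(1)] using 3(2) by (simp add: committed_def)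
      moreover have "utility I (h @ [Grabbed i]) + potential (committed C) (h @ [Grabbed i]) \<le> expect (run I p k (h @ [Grabbed i])) (utility I)"
        using l a Suc(3) 3(1) fin by (intro Suc.IH valid_Grabbed Suc(2)) auto
      ultimately show ?thesis using a utility_snoc(2)[OF Suc(2) 3(1)] by simp
    qed
  qed
qed

definition commitment_value :: "nat set \<Rightarrow> real" where
  "commitment_value C = expect (Pi_pmf {..<n} 0 dist_of) (\<lambda>w. max_weight F {} (\<lambda>j. committed C j (w j)))"

lemma commitment_value_nonneg: "0 \<le> commitment_value C"
  unfolding commitment_value_def
  by (intro integral_nonneg_AE AE_I2 max_weight_nonneg[OF mat] matroidD(2)[OF mat])

lemma greedy_policy:
  assumes step: "\<And>h. valid_history I h \<Longrightarrow> greedy_step C h (p h)"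
  shows "is_policy I p" "adheres I C p" "\<And>h. h \<in> reachable I p \<Longrightarrow> valid_history I h"
    and "(\<And>i. i \<in> C \<Longrightarrow> 0 \<le> open_index (bx i)) \<Longrightarrow> commitment_value C \<le> expected_utility I p"
proof -
  have inv: "run_invariant I p (\<lambda>_. True)"
    using greedy_step_legal step by (auto simp: run_invariant_def)
  show v: "valid_history I h" if "h \<in> reachable I p" for h
    using valid_run[OF valid_Nil _ _ inv] that by (auto simp: reachable_def)
  show "is_policy I p" unfolding is_policy_def by (intro ballI greedy_step_legal[OF step] v)
  show "adheres I C p" unfolding adheres_def
  proof (intro ballI allI)
    fix h i assume "h \<in> reachable I p"
    then have "greedy_step C h (p h)" using v step by simp
    then show "(p h = Open i \<longrightarrow> i \<in> C) \<and> (p h = Grab i \<longrightarrow> i \<notin> C)"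
      by (auto simp: greedy_step_def advance_def split: if_splits)
  qed
  show "commitment_value C \<le> expected_utility I p" if C: "\<And>i. i \<in> C \<Longrightarrow> 0 \<le> open_index (bx i)"
    using potential_le_utility[OF valid_Nil step C, of "2 * n"]
    unfolding expected_utility_def potential_Nil commitment_value_def by (simp add: utility_def)
qed

end

section \<open>The random commitment and its robustness under approximate sampling\<close>

section \<open>Sampling a commitment\<close>

context valid_instance
begin

definition sampled_weights :: "(nat \<Rightarrow> real) \<Rightarrow> nat \<Rightarrow> real" where
  "sampled_weights xs j = surrogate (bx j) (xs j)"

text \<open>
  The best decision for a single box against the exchange price set by a sample of the others:
  the price is below the grab index iff the greedy solution takes the box at that weight.
\<close>

definition grabs :: "nat \<Rightarrow> (nat \<Rightarrow> real) \<Rightarrow> bool" where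
  "grabs i xs \<longleftrightarrow> open_index (bx i) < grab_index (bx i) \<or>
     i \<in> greedy_set F {..<n} ((sampled_weights xs)(i := grab_index (bx i)))"

text \<open>Each flag has its own sample, which makes the flags independent. The law
  \<open>P\<close> of the samples is a parameter so that rounded distributions can replace the true
  ones.\<close>

definition grab_flags :: "(nat \<Rightarrow> real pmf) \<Rightarrow> (nat \<Rightarrow> bool) pmf" where
  "grab_flags P = Pi_pmf {..<n} False (\<lambda>i. map_pmf (grabs i) (Pi_pmf {..<n} 0 P))"

definition opened_by :: "(nat \<Rightarrow> bool) \<Rightarrow> nat set" where
  "opened_by g = {i \<in> {..<n}. \<not> g i}"

text \<open>
  What box \<open>i\<close> contributes when it is accepted against the price set by \<open>xs\<close>. Its distribution
  for independent \<open>xs\<close> and \<open>x\<close> is realised by the commitment, and the one for \<open>x = xs i\<close> adds up to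
  the upper bound.
\<close>

definition taken :: "nat \<Rightarrow> (nat \<Rightarrow> real) \<Rightarrow> real \<Rightarrow> real" where
  "taken i xs x =
     (if open_index (bx i) < grab_index (bx i) then
        (if i \<in> greedy_set F {..<n} ((sampled_weights xs)(i := surrogate (bx i) x)) then mean (bx i) else 0)
      else if i \<in> greedy_set F {..<n} ((sampled_weights xs)(i := grab_index (bx i))) then mean (bx i)
      else if i \<in> greedy_set F {..<n} ((sampled_weights xs)(i := surrogate (bx i) x)) then min x (open_index (bx i))
      else 0)"

lemma sampled_weights_upd: "(sampled_weights (xs(i := y)))(i := z) = (sampled_weights xs)(i := z)"
  by (auto simp: sampled_weights_def fun_eq_iff)

lemma taken_upd: "taken i (xs(i := y)) x = taken i xs x"
  unfolding taken_def sampled_weights_upd ..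

lemma surrogate_alt:
  "open_index (bx i) < grab_index (bx i) \<Longrightarrow> surrogate (bx i) x = mean (bx i)"
  "\<not> open_index (bx i) < grab_index (bx i) \<Longrightarrow> grab_index (bx i) \<le> surrogate (bx i) x"
  by (auto simp: surrogate_def)

lemma greedy_surrogate:
  assumes "i \<in> greedy_set F {..<n} (v(i := grab_index (bx i)))" "\<not> open_index (bx i) < grab_index (bx i)"
  shows "i \<in> greedy_set F {..<n} (v(i := surrogate (bx i) x))"
  by (rule greedy_set_upward[OF mat assms(1) surrogate_alt(2)[OF assms(2)]]) simp

lemma taken_eq_0:
  "i \<notin> greedy_set F {..<n} ((sampled_weights xs)(i := surrogate (bx i) x)) \<Longrightarrow> taken i xs x = 0"
  using greedy_surrogate unfolding taken_def by auto

text \<open>If the price is low enough for grabbing, the box is taken at every value, and surrogate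
  and true means agree. Otherwise it is taken only when the surrogate exceeds the grab index, where
  the surrogate is just the capped value.\<close>

lemma expect_taken:
  assumes "i < n"
  shows "expect (dist_of i) (\<lambda>x. taken i xs x) = expect (dist_of i)
    (\<lambda>x. if i \<in> greedy_set F {..<n} ((sampled_weights xs)(i := surrogate (bx i) x)) then surrogate (bx i) x else 0)"
proof (cases "open_index (bx i) < grab_index (bx i)")
  case True
  then show ?thesis by (simp add: taken_def surrogate_alt)
next
  case F: False
  show ?thesis
  proof (cases "i \<in> greedy_set F {..<n} ((sampled_weights xs)(i := grab_index (bx i)))")
    case True
    have "expect (dist_of i) (\<lambda>x. surrogate (bx i) x) = mean (bx i)"
      by (rule finite_box.mean_surrogate[OF finite_bx[OF assms]])
    then show ?thesis using True F greedy_surrogate[OF True F] by (simp add: taken_def)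
  next
    case False
    show ?thesis
    proof (rule expect_cong)
      fix x
      have "min x (open_index (bx i)) = surrogate (bx i) x"
        if "i \<in> greedy_set F {..<n} ((sampled_weights xs)(i := surrogate (bx i) x))"
      proof -
        have "surrogate (bx i) x \<noteq> grab_index (bx i)" using that False by metis
        then show ?thesis using F by (auto simp: surrogate_def max_def split: if_splits)
      qed
      then show "taken i xs x = (if i \<in> greedy_set F {..<n} ((sampled_weights xs)(i := surrogate (bx i) x))
          then surrogate (bx i) x else 0)"
        using F False by (simp add: taken_def)
    qed
  qed
qed

abbreviation "samples \<equiv> Pi_pmf {..<n} 0 dist_of"

lemma finite_samples: "finite (set_pmf samples)"
  by (intro finite_set_Pi_pmf) (auto intro: finite_dist)

lemma expect_samples_split:
  assumes "i < n"
  shows "expect samples f = expect (Pi_pmf ({..<n} - {i}) 0 dist_of) (\<lambda>g. expect (dist_of i) (\<lambda>x. f (g(i := x))))"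
proof -
  have "{..<n} = insert i ({..<n} - {i})" using assms by auto
  then have "expect samples f = expect (Pi_pmf (insert i ({..<n} - {i})) 0 dist_of) f" by simp
  also have "\<dots> = expect (dist_of i) (\<lambda>x. expect (Pi_pmf ({..<n} - {i}) 0 dist_of) (\<lambda>g. f (g(i := x))))"
    using assms by (subst expect_Pi_pmf_insert) (auto intro: finite_dist)
  finally show ?thesis
    by (subst (asm) expect_swap) (auto intro!: finite_dist finite_set_Pi_pmf assms)
qed

text \<open>Since \<open>taken i xs\<close> ignores \<open>xs i\<close>, the value of box
  \<open>i\<close> can be averaged first, which turns it into its surrogate contribution. These add
  up over the greedy set to the maximum weight.\<close>

lemma expect_sum_taken: "expect samples (\<lambda>xs. \<Sum>i<n. taken i xs (xs i)) = upper_bound"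
proof -
  let ?G = "\<lambda>xs. greedy_set F {..<n} (sampled_weights xs)"
  have W: "sampled_weights (g(i := x)) = (sampled_weights g)(i := surrogate (bx i) x)" for g i x
    by (auto simp: sampled_weights_def fun_eq_iff)
  have each: "expect samples (\<lambda>xs. taken i xs (xs i)) = expect samples (\<lambda>xs. if i \<in> ?G xs then sampled_weights xs i else 0)"
    if "i < n" for i
    unfolding expect_samples_split[OF that] fun_upd_same taken_upd expect_taken[OF that] W ..
  have "expect samples (\<lambda>xs. \<Sum>i<n. taken i xs (xs i)) = expect samples (\<lambda>xs. \<Sum>i<n. if i \<in> ?G xs then sampled_weights xs i else 0)"
    by (simp add: expect_sum[OF finite_samples] each)
  also have "\<dots> = upper_bound"
    unfolding upper_bound_def
  proof (rule expect_cong)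
    fix xs
    have "?G xs \<subseteq> {..<n}" by (auto simp: greedy_set_def)
    then have "(\<Sum>i<n. if i \<in> ?G xs then sampled_weights xs i else 0) = sum (sampled_weights xs) (?G xs)"
      by (simp add: sum.If_cases Int_absorb1)
    also have "\<dots> = max_weight F {} (sampled_weights xs)"
      using finite_box.surrogate_nonneg[OF finite_bx]
      by (intro max_weight_greedy[OF mat, symmetric]) (simp add: sampled_weights_def)
    finally show "(\<Sum>i<n. if i \<in> ?G xs then sampled_weights xs i else 0) = max_weight F {} (\<lambda>j. surrogate (bx j) (xs j))"
      by (simp add: sampled_weights_def[abs_def])
  qed
  finally show ?thesis .
qed

text \<open>Since \<open>taken i xs\<close> ignores \<open>xs i\<close>, reusing the sampled value
  and drawing a fresh one give the same law. This concerns one box at a time; the joint law over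
  several boxes is what the correlation gap deals with.\<close>

lemma taken_distribution:
  assumes "i < n"
  shows "map_pmf (\<lambda>xs. taken i xs (xs i)) samples = bind_pmf samples (\<lambda>xs. map_pmf (taken i xs) (dist_of i))"
proof -
  let ?rest = "Pi_pmf ({..<n} - {i}) 0 dist_of"
  have "{..<n} = insert i ({..<n} - {i})" using assms by auto
  then have eq: "samples = bind_pmf (dist_of i) (\<lambda>y. bind_pmf ?rest (\<lambda>g. return_pmf (g(i := y))))"
    using Pi_pmf_insert'[of "{..<n} - {i}" i 0 dist_of] by simp
  have "map_pmf (\<lambda>xs. taken i xs (xs i)) samples = bind_pmf (dist_of i) (\<lambda>y. bind_pmf ?rest (\<lambda>g. return_pmf (taken i g y)))"
    unfolding eq by (simp add: map_bind_pmf taken_upd)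
  also have "\<dots> = bind_pmf ?rest (\<lambda>g. bind_pmf (dist_of i) (\<lambda>y. return_pmf (taken i g y)))"
    by (rule bind_commute_pmf)
  also have "\<dots> = bind_pmf samples (\<lambda>xs. map_pmf (taken i xs) (dist_of i))"
    unfolding eq by (simp add: bind_assoc_pmf bind_return_pmf taken_upd map_pmf_def)
  finally show ?thesis .
qed

lemma expect_Pi_pmf_bind:
  fixes d :: 'd and P :: "'c \<Rightarrow> 'd pmf"
  assumes "finite A" "\<And>i. i \<in> A \<Longrightarrow> finite (set_pmf (P i))"
  shows "expect (Pi_pmf A 0 (\<lambda>i. bind_pmf (P i) (\<lambda>x. return_pmf (f i x)))) h =
    expect (Pi_pmf A d P) (\<lambda>g. h (\<lambda>i. if i \<in> A then f i (g i) else 0))"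
  by (subst Pi_pmf_bind[where d'=d], rule assms(1)) (simp add: assms expect_bind finite_set_Pi_pmf)

text \<open>All entries of \<open>D\<close> come from one common sample, so they vanish outside a
  greedy, hence independent, set and sum to the upper bound in expectation. The correlation gap
  replaces them by independent entries with the same marginals, realised by a separate sample and a
  fresh value for each box.\<close>

theorem commitment_guarantee:
  assumes m: "m > 0"
  shows "(1 - 1 / (1 + 1 / real m) ^ m) * upper_bound \<le>
    expect (grab_flags dist_of) (\<lambda>g. commitment_value (opened_by g))"
proof -
  let ?h = "max_weight F {}"
  define D where "D = map_pmf (\<lambda>xs i. taken i xs (xs i)) samples"
  have finD: "finite (set_pmf D)" unfolding D_def using finite_samples by simp
  have sub: "submodular ?h"
    unfolding submodular_def raise_def
    by (intro allI impI max_weight_diminishing[OF mat]) (auto simp: le_fun_def)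
  have cong: "?h u = ?h v" if "\<And>i. i < n \<Longrightarrow> u i = v i" for u v
    using that by (intro max_weight_cong[OF mat matroidD(2)[OF mat]]) auto
  have h0: "?h (\<lambda>_. 0) = 0"
    using max_weight_greedy[OF mat, of "\<lambda>_. 0"] by simp
  have list: "(\<Sum>i\<leftarrow>[0..<n]. d i) = (\<Sum>i<n. d i)" for d :: "nat \<Rightarrow> real"
    by (simp add: interv_sum_list_conv_sum_set_nat atLeast0LessThan)
  have lower: "(\<Sum>i\<leftarrow>[0..<n]. d i) \<le> ?h (\<lambda>j. if j \<in> set [0..<n] then max (v j) (d j) else v j)"
    if "d \<in> set_pmf D" "nonneg_vec v" for d v
  proof -
    have "d \<in> (\<lambda>xs i. taken i xs (xs i)) ` set_pmf samples" using that(1) by (simp only: D_def set_map_pmf)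
    then obtain xs where d: "d = (\<lambda>i. taken i xs (xs i))" by (elim imageE)
    let ?G = "greedy_set F {..<n} (sampled_weights xs)"
    have G: "?G \<in> F" "?G \<subseteq> {..<n}" using greedy_set_in[OF mat] by (auto simp: greedy_set_def)
    have "d i = 0" if "i \<notin> ?G" for i
    proof -
      have "(sampled_weights xs)(i := surrogate (bx i) (xs i)) = sampled_weights xs"
        by (auto simp: sampled_weights_def fun_eq_iff)
      then show ?thesis using taken_eq_0[of i xs "xs i"] that d by simp
    qed
    then have "(\<Sum>i<n. d i) = sum d ?G" using G by (intro sum.mono_neutral_right) auto
    also have "\<dots> \<le> (\<Sum>j\<in>?G. if j \<in> set [0..<n] then max (v j) (d j) else v j)"
      using G(2) by (intro sum_mono) auto
    also have "\<dots> \<le> ?h (\<lambda>j. if j \<in> set [0..<n] then max (v j) (d j) else v j)"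
      by (rule max_weight_empty_ge[OF mat G(1)])
    finally show ?thesis unfolding list .
  qed
  have "expect D (\<lambda>d. \<Sum>i\<leftarrow>[0..<n]. d i) = upper_bound"
    unfolding list D_def by (simp add: expect_sum_taken)
  then have gap: "(1 - 1 / (1 + 1 / real m) ^ m) * upper_bound \<le>
      expect (Pi_pmf {..<n} 0 (\<lambda>i. map_pmf (\<lambda>d. d i) D)) (\<lambda>f. ?h (\<lambda>j. max 0 (f j)))"
    using correlation_gap[OF sub m finD distinct_upt[of 0 n] h0 lower] by (simp add: atLeast0LessThan)
  let ?J = "\<lambda>i. pair_pmf samples (dist_of i)"
  let ?Z = "(\<lambda>_. 0, 0) :: (nat \<Rightarrow> real) \<times> real"
  have finJ: "finite (set_pmf (?J i))" if "i \<in> {..<n}" for i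
    using that finite_samples finite_dist by simp
  \<comment> \<open>What the commitment alone yields, without the acceptance test against the
    sampled price; acceptance is left to the matroid optimum.\<close>
  define out where "out i z = (if grabs i (fst z) then mean (bx i) else min (snd z) (open_index (bx i)))"
    for i and z :: "(nat \<Rightarrow> real) \<times> real"
  have "Pi_pmf {..<n} 0 (\<lambda>i. map_pmf (\<lambda>d. d i) D) =
      Pi_pmf {..<n} 0 (\<lambda>i. bind_pmf (?J i) (\<lambda>z. return_pmf (taken i (fst z) (snd z))))"
  proof (intro Pi_pmf_cong refl)
    fix i assume "i \<in> {..<n}"
    then have "map_pmf (\<lambda>d. d i) D = bind_pmf samples (\<lambda>xs. map_pmf (taken i xs) (dist_of i))"
      unfolding D_def pmf.map_comp o_def by (intro taken_distribution) simp
    then show "map_pmf (\<lambda>d. d i) D = bind_pmf (?J i) (\<lambda>z. return_pmf (taken i (fst z) (snd z)))"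
      by (simp add: pair_pmf_def bind_assoc_pmf bind_return_pmf map_pmf_def)
  qed
  then have "expect (Pi_pmf {..<n} 0 (\<lambda>i. map_pmf (\<lambda>d. d i) D)) (\<lambda>f. ?h (\<lambda>j. max 0 (f j))) =
      expect (Pi_pmf {..<n} 0 (\<lambda>i. bind_pmf (?J i) (\<lambda>z. return_pmf (taken i (fst z) (snd z))))) (\<lambda>f. ?h (\<lambda>j. max 0 (f j)))"
    by (rule arg_cong)
  also have "\<dots> =
      expect (Pi_pmf {..<n} ?Z ?J) (\<lambda>g. ?h (\<lambda>j. max 0 (if j \<in> {..<n} then taken j (fst (g j)) (snd (g j)) else 0)))"
    by (rule expect_Pi_pmf_bind[OF _ finJ]) simp_all
  also have "\<dots> \<le> expect (Pi_pmf {..<n} ?Z ?J) (\<lambda>g. ?h (\<lambda>j. if j \<in> {..<n} then out j (g j) else 0))"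
  proof (intro expect_mono finite_set_Pi_pmf finJ max_weight_mono[OF mat matroidD(2)[OF mat]])
    fix g j assume g: "g \<in> set_pmf (Pi_pmf {..<n} ?Z ?J)" and j: "j \<in> {..<n}"
    interpret b: finite_box "bx j" using finite_bx j by simp
    have "g j \<in> set_pmf (?J j)" using g j by (auto simp: set_Pi_pmf PiE_dflt_def)
    then have x: "0 \<le> snd (g j)" using b.nonneg_value by (cases "g j") auto
    \<comment> \<open>\<open>taken\<close> is either \<open>out\<close> or 0, and \<open>out\<close>
      is nonnegative: a box that is not grabbed has an open index at least its grab index, hence
      nonnegative.\<close>
    have "max 0 (taken j (fst (g j)) (snd (g j))) \<le> out j (g j)"
      using x b.mean_nonneg b.grab_index_nonneg unfolding out_def taken_def grabs_def by auto
    then show "max 0 (if j \<in> {..<n} then taken j (fst (g j)) (snd (g j)) else 0) \<le> (if j \<in> {..<n} then out j (g j) else 0)"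
      using j by simp
  qed auto
  also have "\<dots> = expect (Pi_pmf {..<n} 0 (\<lambda>i. bind_pmf (?J i) (\<lambda>z. return_pmf (out i z)))) ?h"
    by (subst expect_Pi_pmf_bind[OF _ finJ, where d="?Z"]) auto
  also have "(\<lambda>i. bind_pmf (?J i) (\<lambda>z. return_pmf (out i z))) =
      (\<lambda>i. bind_pmf (map_pmf (grabs i) samples) (\<lambda>b. bind_pmf (dist_of i) (\<lambda>x.
        return_pmf (if b then mean (bx i) else min x (open_index (bx i))))))"
    by (simp add: out_def pair_pmf_def bind_assoc_pmf bind_return_pmf map_pmf_def cong: if_cong)
  also have "expect (Pi_pmf {..<n} 0 (\<lambda>i. bind_pmf (map_pmf (grabs i) samples) (\<lambda>b. bind_pmf (dist_of i) (\<lambda>x.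
        return_pmf (if b then mean (bx i) else min x (open_index (bx i))))))) ?h =
      expect (grab_flags dist_of) (\<lambda>g. expect (Pi_pmf {..<n} 0 (\<lambda>i. bind_pmf (dist_of i) (\<lambda>x.
        return_pmf (if g i then mean (bx i) else min x (open_index (bx i)))))) ?h)"
    unfolding grab_flags_def
    by (subst Pi_pmf_bind[where d'=False], simp)
      (intro expect_bind finite_set_Pi_pmf; simp add: finite_samples finite_dist)
  also have "\<dots> = expect (grab_flags dist_of) (\<lambda>g. commitment_value (opened_by g))"
    unfolding commitment_value_def
  proof (intro expect_cong)
    fix g
    have "expect (Pi_pmf {..<n} 0 (\<lambda>i. bind_pmf (dist_of i) (\<lambda>x.
        return_pmf (if g i then mean (bx i) else min x (open_index (bx i)))))) ?h =
       expect samples (\<lambda>w. ?h (\<lambda>i. if i \<in> {..<n} then if g i then mean (bx i) else min (w i) (open_index (bx i)) else 0))"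
      by (rule expect_Pi_pmf_bind) (auto intro: finite_dist)
    also have "\<dots> = expect samples (\<lambda>w. ?h (\<lambda>j. committed (opened_by g) j (w j)))"
      by (intro expect_cong cong) (simp add: committed_def opened_by_def)
    finally show "expect (Pi_pmf {..<n} 0 (\<lambda>i. bind_pmf (dist_of i) (\<lambda>x.
        return_pmf (if g i then mean (bx i) else min x (open_index (bx i)))))) ?h =
       expect samples (\<lambda>w. ?h (\<lambda>j. committed (opened_by g) j (w j)))" .
  qed
  finally show ?thesis using gap by simp
qed

subsection \<open>Approximate sampling\<close>

text \<open>A multiplicative comparison of laws on nonnegative functions; it passes to images and
  products without any upper bound on the functions.\<close>

definition dominates :: "real \<Rightarrow> 'b pmf \<Rightarrow> 'b pmf \<Rightarrow> bool" where
  "dominates c q p \<longleftrightarrow> (\<forall>f. (\<forall>x. 0 \<le> f x) \<longrightarrow> c * expect p f \<le> expect q f)"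

lemma dominates_pmf:
  fixes p q :: "'b pmf"
  assumes "finite (set_pmf p)" "finite (set_pmf q)" "\<And>x. x \<in> set_pmf p \<Longrightarrow> c * pmf p x \<le> pmf q x"
  shows "dominates c q p"
  unfolding dominates_def
proof (intro allI impI)
  fix f :: "'b \<Rightarrow> real" assume f: "\<forall>x. 0 \<le> f x"
  have "c * expect p f = (\<Sum>x\<in>set_pmf p. c * pmf p x * f x)"
    by (simp add: expect_sum_pmf[OF assms(1)] sum_distrib_left mult.assoc)
  also have "\<dots> \<le> (\<Sum>x\<in>set_pmf p. pmf q x * f x)"
    using f assms(3) by (intro sum_mono mult_right_mono) auto
  also have "\<dots> \<le> (\<Sum>x\<in>set_pmf p \<union> set_pmf q. pmf q x * f x)"
    using f assms(1,2) by (intro sum_mono2) auto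
  also have "\<dots> = expect q f"
    unfolding expect_sum_pmf[OF assms(2)] using assms(1,2) 
    by (intro sum.mono_neutral_right) (auto simp: set_pmf_iff)
  finally show "c * expect p f \<le> expect q f" .
qed

lemma dominates_map: "dominates c q p \<Longrightarrow> dominates c (map_pmf g q) (map_pmf g p)"
  unfolding dominates_def by simp

lemma dominates_Pi_pmf:
  fixes p q :: "'b \<Rightarrow> 'c pmf"
  assumes "finite A" "0 \<le> c" "\<And>i. i \<in> A \<Longrightarrow> finite (set_pmf (p i)) \<and> finite (set_pmf (q i)) \<and> dominates c (q i) (p i)"
  shows "dominates (c ^ card A) (Pi_pmf A d q) (Pi_pmf A d p)"
  using assms(1,3)
proof (induction A)
  case empty
  then show ?case by (simp add: dominates_def)
next
  case (insert x A)
  show ?case unfolding dominates_def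
  proof (intro allI impI)
    fix f :: "('b \<Rightarrow> 'c) \<Rightarrow> real" assume f: "\<forall>x. 0 \<le> f x"
    let ?P = "\<lambda>y. expect (Pi_pmf A d p) (\<lambda>g. f (g(x := y)))" and ?Q = "\<lambda>y. expect (Pi_pmf A d q) (\<lambda>g. f (g(x := y)))"
    have "c ^ card (insert x A) * expect (Pi_pmf (insert x A) d p) f = c * expect (p x) (\<lambda>y. c ^ card A * ?P y)"
      using insert by (subst expect_Pi_pmf_insert) auto
    also have "\<dots> \<le> c * expect (p x) ?Q"
      using insert f assms(2) by (intro mult_left_mono expect_mono) (auto simp: dominates_def)
    also have "\<dots> \<le> expect (q x) ?Q"
      using insert.prems[of x] f by (auto simp: dominates_def intro!: integral_nonneg_AE)
    also have "\<dots> = expect (Pi_pmf (insert x A) d q) f"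
      using insert by (subst expect_Pi_pmf_insert) auto
    finally show "c ^ card (insert x A) * expect (Pi_pmf (insert x A) d p) f \<le> expect (Pi_pmf (insert x A) d q) f" .
  qed
qed

text \<open>A factor \<open>c\<close> is lost for each drawn value: \<open>n\<close> values per
  sample and one sample for each of the \<open>n\<close> boxes.\<close>

lemma approximate_commitment:
  assumes m: "m > 0" and c: "0 \<le> c"
    and P: "\<And>i. i < n \<Longrightarrow> finite (set_pmf (P i)) \<and> (\<forall>x\<in>set_pmf (dist_of i). c * pmf (dist_of i) x \<le> pmf (P i) x)"
  shows "(c ^ n) ^ n * (1 - 1 / (1 + 1 / real m) ^ m) * OPT I \<le>
    expect (grab_flags P) (\<lambda>g. commitment_value (opened_by g))"
proof -
  have 1: "dominates (c ^ card {..<n}) (Pi_pmf {..<n} 0 P) samples"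
    using P finite_dist by (intro dominates_Pi_pmf c conjI dominates_pmf) auto
  have fin: "finite (set_pmf (Pi_pmf {..<n} 0 P))" using P by (intro finite_set_Pi_pmf) auto
  have "dominates ((c ^ card {..<n}) ^ card {..<n}) (grab_flags P) (grab_flags dist_of)"
    unfolding grab_flags_def
  proof (rule dominates_Pi_pmf)
    show "finite (set_pmf (map_pmf (grabs i) samples)) \<and> finite (set_pmf (map_pmf (grabs i) (Pi_pmf {..<n} 0 P))) \<and>
      dominates (c ^ card {..<n}) (map_pmf (grabs i) (Pi_pmf {..<n} 0 P)) (map_pmf (grabs i) samples)" for i
      using fin finite_samples dominates_map[OF 1] by simp
  qed (use c in simp_all)
  then have dom: "(c ^ n) ^ n * expect (grab_flags dist_of) (\<lambda>g. commitment_value (opened_by g)) \<le>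
      expect (grab_flags P) (\<lambda>g. commitment_value (opened_by g))"
    using commitment_value_nonneg by (simp add: dominates_def)
  have "1 \<le> (1 + 1 / real m) ^ m" by (rule one_le_power) simp
  moreover have "0 \<le> 1 - 1 / X" if "1 \<le> X" for X :: real using that by (simp add: divide_le_eq_1)
  ultimately have "0 \<le> 1 - 1 / (1 + 1 / real m) ^ m" by blast
  then have "(1 - 1 / (1 + 1 / real m) ^ m) * OPT I \<le> expect (grab_flags dist_of) (\<lambda>g. commitment_value (opened_by g))"
    using mult_left_mono[OF OPT_le_upper_bound] commitment_guarantee[OF m] order_trans by blast
  then have "(c ^ n) ^ n * ((1 - 1 / (1 + 1 / real m) ^ m) * OPT I) \<le>
      (c ^ n) ^ n * expect (grab_flags dist_of) (\<lambda>g. commitment_value (opened_by g))"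
    using c by (intro mult_left_mono) auto
  then show ?thesis using dom by (simp add: mult.assoc)
qed

end

section \<open>Inverse-transform sampling from fair coins\<close>

section \<open>Sampling with coin flips\<close>

definition flips :: "nat \<Rightarrow> bool list pmf" where
  "flips k = pmf_of_set {r. length r = k}"

lemma finite_bool_lists: "finite {r :: bool list. length r = k}" "{r :: bool list. length r = k} \<noteq> {}"
  using finite_lists_length_eq[of "UNIV :: bool set" k] Ex_list_of_length[of k] by auto

lemma set_flips: "set_pmf (flips k) = {r. length r = k}"
  unfolding flips_def by (rule set_pmf_of_set[OF finite_bool_lists(2,1)])

lemma finite_flips: "finite (set_pmf (flips k))"
  unfolding set_flips by (rule finite_bool_lists)

lemma pair_pmf_of_set:
  assumes "finite A" "A \<noteq> {}" "finite B" "B \<noteq> {}"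
  shows "pair_pmf (pmf_of_set A) (pmf_of_set B) = pmf_of_set (A \<times> B)"
proof (rule pmf_eqI)
  fix z :: "'a \<times> 'b"
  obtain a b where z: "z = (a, b)" by (cases z)
  have "pmf (pmf_of_set (A \<times> B)) (a, b) = indicator (A \<times> B) (a, b) / real (card (A \<times> B))"
    by (rule pmf_of_set) (use assms in auto)
  then show "pmf (pair_pmf (pmf_of_set A) (pmf_of_set B)) z = pmf (pmf_of_set (A \<times> B)) z"
    unfolding z pmf_pair pmf_of_set[OF assms(2,1)] pmf_of_set[OF assms(4,3)]
    by (simp add: indicator_def card_cartesian_product)
qed

lemma flips_add: "flips (a + b) = map_pmf (\<lambda>(x, y). x @ y) (pair_pmf (flips a) (flips b))"
proof -
  have inj: "inj_on (\<lambda>(x, y). x @ y) ({r :: bool list. length r = a} \<times> {r. length r = b})"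
    by (auto simp: inj_on_def)
  have img: "(\<lambda>(x, y). x @ y) ` ({r :: bool list. length r = a} \<times> {r. length r = b}) = {r. length r = a + b}"
  proof (rule set_eqI, rule iffI)
    fix r :: "bool list" assume "r \<in> {r. length r = a + b}"
    then show "r \<in> (\<lambda>(x, y). x @ y) ` ({r. length r = a} \<times> {r. length r = b})"
      by (intro image_eqI[of _ _ "(take a r, drop a r)"]) auto
  qed auto
  have "pair_pmf (flips a) (flips b) = pmf_of_set ({r. length r = a} \<times> {r. length r = b})"
    unfolding flips_def by (rule pair_pmf_of_set) (rule finite_bool_lists)+
  then show ?thesis
    unfolding flips_def using finite_bool_lists by (simp add: map_pmf_of_set_inj[OF inj] img)
qed

lemma flips_0: "flips 0 = return_pmf []"
  unfolding flips_def by (simp add: pmf_of_set_singleton)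

lemma flips_1: "flips 1 = map_pmf (\<lambda>b. [b]) (pmf_of_set UNIV)"
proof -
  have "(\<lambda>b. [b]) ` (UNIV :: bool set) = {r. length r = 1}"
    by (auto simp: length_Suc_conv image_iff)
  then show ?thesis unfolding flips_def by (subst map_pmf_of_set_inj) (auto simp: inj_on_def)
qed

lemma map_rev_flips: "map_pmf rev (flips k) = flips k"
proof -
  have "rev ` {r :: bool list. length r = k} = {r. length r = k}"
    by (auto intro!: image_eqI[of _ _ "rev _"])
  then show ?thesis
    unfolding flips_def using finite_bool_lists by (subst map_pmf_of_set_inj) (auto simp: inj_on_def)
qed

lemma take_flips: "map_pmf (take a) (flips (a + b)) = flips a"
proof -
  have "map_pmf (take a) (flips (a + b)) = map_pmf fst (pair_pmf (flips a) (flips b))"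
    unfolding flips_add pmf.map_comp
    by (intro map_pmf_cong refl) (auto simp: set_flips)
  then show ?thesis by (simp add: map_fst_pair_pmf)
qed

definition chunk :: "nat \<Rightarrow> nat \<Rightarrow> 'a list \<Rightarrow> 'a list" where
  "chunk k j r = take k (drop (j * k) r)"

text \<open>Disjoint blocks of fair flips are independent. The surplus \<open>e\<close> stands for
  flips left over when the length is not a multiple of the block length; they are discarded.\<close>

lemma flips_chunks:
  "map_pmf (\<lambda>r j. if j < n then chunk k j r else []) (flips (n * k + e)) = Pi_pmf {..<n} [] (\<lambda>_. flips k)"
proof (induction n arbitrary: e)
  case 0
  show ?case by simp
next
  case (Suc n)
  have "map_pmf (\<lambda>r j. if j < Suc n then chunk k j r else []) (flips (Suc n * k + e)) =
      map_pmf (\<lambda>(x, y) j. if j < Suc n then chunk k j (x @ y) else []) (pair_pmf (flips (n * k)) (flips (k + e)))"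
  proof -
    have "Suc n * k + e = n * k + (k + e)" by simp
    then show ?thesis 
      by (simp only: flips_add[of "n * k" "k + e"] pmf.map_comp) (intro map_pmf_cong refl, auto simp: fun_eq_iff)
  qed
  also have "\<dots> = map_pmf (\<lambda>(x, y). (\<lambda>j. if j < n then chunk k j x else [])(n := take k y))
      (pair_pmf (flips (n * k)) (flips (k + e)))"
  proof (intro map_pmf_cong refl)
    fix z assume "z \<in> set_pmf (pair_pmf (flips (n * k)) (flips (k + e)))"
    then obtain x y where z: "z = (x, y)" and x: "length x = n * k" by (cases z) (auto simp: set_flips)
    have "(if j < Suc n then chunk k j (x @ y) else []) = ((\<lambda>j. if j < n then chunk k j x else [])(n := take k y)) j" for j
    proof (cases "j < n")
      case True
      then have "Suc j * k \<le> n * k" by (intro mult_right_mono) auto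
      then show ?thesis using True x by (simp add: chunk_def)
    next
      case False
      then show ?thesis using x by (auto simp: chunk_def)
    qed
    then show "(case z of (x, y) \<Rightarrow> \<lambda>j. if j < Suc n then chunk k j (x @ y) else []) =
        (case z of (x, y) \<Rightarrow> (\<lambda>j. if j < n then chunk k j x else [])(n := take k y))"
      unfolding z by (simp only: case_prod_conv)
  qed
  also have "\<dots> = map_pmf (\<lambda>(y, f). f(n := y)) (pair_pmf (map_pmf (take k) (flips (k + e)))
      (map_pmf (\<lambda>r j. if j < n then chunk k j r else []) (flips (n * k + 0))))"
    by (simp add: pair_map_pmf1 pair_map_pmf2 pmf.map_comp o_def case_prod_beta pair_commute_pmf[of "flips (n * k)"]
        cong: if_cong)
  also have "\<dots> = map_pmf (\<lambda>(y, f). f(n := y)) (pair_pmf (flips k) (Pi_pmf {..<n} [] (\<lambda>_. flips k)))"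
    unfolding take_flips Suc ..
  also have "\<dots> = Pi_pmf {..<Suc n} [] (\<lambda>_. flips k)"
    by (simp add: lessThan_Suc Pi_pmf_insert)
  finally show ?case .
qed

lemma Pi_pmf_map_dependent:
  assumes "finite A"
  shows "Pi_pmf A d' (\<lambda>i. map_pmf (f i) (P i)) = map_pmf (\<lambda>g i. if i \<in> A then f i (g i) else d') (Pi_pmf A d P)"
  unfolding map_pmf_def using assms by (subst Pi_pmf_bind[where d'=d]) auto

subsection \<open>Dyadic approximation\<close>

lemma binary_fraction_bounds: "0 \<le> (binary_fraction r :: real)" "(binary_fraction r :: real) < 1"
  by (induction r) (auto simp: of_bool_def)

text \<open>The fraction is uniform on the multiples of \<open>1 / 2 ^ k\<close> in the unit
  interval, so the probability of falling below \<open>t\<close> is the clamped \<open>t\<close>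
  rounded up by at most one grid cell.\<close>

lemma prob_binary_fraction:
  fixes t :: real
  defines "c \<equiv> \<lambda>t :: real. max 0 (min t 1)"
  shows "c t \<le> measure_pmf.prob (flips k) {r. binary_fraction r < t}" (is "_ \<le> ?A k t")
    and "measure_pmf.prob (flips k) {r. binary_fraction r < t} \<le> c t + 1 / 2 ^ k"
proof -
  have zero: "?A k t = 0" if "t \<le> 0" for k t
  proof -
    have "{r. binary_fraction r < t} = {}" using binary_fraction_bounds(1) that by (smt (verit) Collect_empty_eq)
    then show ?thesis by simp
  qed
  \<comment> \<open>Conditioning on the most significant bit doubles the threshold and subtracts
    that bit.\<close>
  have step: "?A (Suc k) t = (?A k (2 * t) + ?A k (2 * t - 1)) / 2" for k t
  proof -
    have "flips (Suc k) = bind_pmf (pmf_of_set UNIV) (\<lambda>b. map_pmf (\<lambda>r. b # r) (flips k))"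
      using flips_add[of 1 k] unfolding flips_1
      by (simp add: pair_pmf_def map_pmf_def bind_assoc_pmf bind_return_pmf)
    moreover have prob: "measure_pmf.prob p A = expect p (indicat_real A)" for p and A :: "bool list set" by simp
    ultimately have "?A (Suc k) t = expect (bind_pmf (pmf_of_set UNIV) (\<lambda>b. map_pmf (\<lambda>r. b # r) (flips k))) (indicat_real {r. binary_fraction r < t})"
      by (simp only: prob)
    also have "\<dots> = expect (pmf_of_set UNIV) (\<lambda>b. expect (map_pmf (\<lambda>r. b # r) (flips k)) (indicat_real {r. binary_fraction r < t}))"
      using finite_flips by (intro expect_bind) auto
    also have "\<dots> = expect (pmf_of_set UNIV) (\<lambda>b. expect (flips k) (\<lambda>r. indicat_real {r. binary_fraction r < t} (b # r)))"
      by (simp only: integral_map_pmf)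
    also have "\<dots> = (\<Sum>b\<in>UNIV. expect (flips k) (\<lambda>r. indicat_real {r. binary_fraction r < t} (b # r))) / 2"
      by (subst integral_pmf_of_set) auto
    also have "\<dots> = (\<Sum>b\<in>UNIV. ?A k (2 * t - of_bool b)) / 2"
      unfolding prob by (intro arg_cong2[where f="(/)"] sum.cong expect_cong refl) (auto simp: indicator_def)
    finally show ?thesis by (simp add: UNIV_bool)
  qed
  have "c t \<le> ?A k t \<and> ?A k t \<le> c t + 1 / 2 ^ k" for t
  proof (induction k arbitrary: t)
    case 0
    show ?case by (cases "0 < t") (auto simp: flips_0 c_def zero)
  next
    case (Suc k)
    have c: "c t = (c (2 * t) + c (2 * t - 1)) / 2" by (auto simp: c_def max_def min_def)
    have e: "1 / 2 ^ Suc k = (1 / 2 ^ k :: real) / 2" by simp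
    \<comment> \<open>In either half of the interval one of the two terms is exact, namely 0 or 1,
      so averaging halves the error.\<close>
    have low: "ct \<le> (A1 + A2) / 2 \<and> (A1 + A2) / 2 \<le> ct + d / 2"
      if "A2 = 0" "c2 = 0" "c1 \<le> A1 \<and> A1 \<le> c1 + d" "ct = (c1 + c2) / 2" for A1 A2 c1 c2 ct d :: real
      using that by auto
    have high: "ct \<le> (A1 + A2) / 2 \<and> (A1 + A2) / 2 \<le> ct + d / 2"
      if "c1 = 1" "A1 \<le> 1" "c1 \<le> A1 \<and> A1 \<le> c1 + d" "c2 \<le> A2 \<and> A2 \<le> c2 + d" "ct = (c1 + c2) / 2"
      for A1 A2 c1 c2 ct d :: real
      using that by auto
    show ?case
    proof (cases "t \<le> 1 / 2")
      case True
      show ?thesis unfolding step e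
        by (rule low[OF _ _ Suc c]) (use True in \<open>auto intro!: zero simp: c_def\<close>)
    next
      case False
      show ?thesis unfolding step e
        by (rule high[OF _ _ Suc Suc c]) (use False in \<open>auto simp: c_def\<close>)
    qed
  qed
  then show "c t \<le> ?A k t" "?A k t \<le> c t + 1 / 2 ^ k" by auto
qed

definition quantile :: "real pmf \<Rightarrow> real \<Rightarrow> real" where
  "quantile p \<theta> = Min {x \<in> set_pmf p. \<theta> < (\<Sum>y\<in>{y \<in> set_pmf p. y \<le> x}. pmf p y)}"

text \<open>The value \<open>x\<close> owns an interval of length \<open>pmf p x\<close> below the
  distribution function. Rounding costs at most \<open>1 / 2 ^ k\<close>, and the lower bound on
  \<open>pmf p x\<close> turns this into a relative loss of \<open>2 ^ N / 2 ^ k\<close>.\<close>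

lemma pmf_quantile:
  assumes p: "finite (set_pmf p)" and x: "x \<in> set_pmf p" "1 / 2 ^ N \<le> pmf p x"
  shows "(1 - 2 ^ N / 2 ^ k) * pmf p x \<le> pmf (map_pmf (\<lambda>r. quantile p (binary_fraction (rev r))) (flips k)) x"
proof -
  let ?cdf = "\<lambda>x. \<Sum>y\<in>{y \<in> set_pmf p. y \<le> x}. pmf p y"
  define s where "s = (\<Sum>y\<in>{y \<in> set_pmf p. y < x}. pmf p y)"
  define t where "t = ?cdf x"
  have "{y \<in> set_pmf p. y \<le> x} = insert x {y \<in> set_pmf p. y < x}" using x by auto
  then have t: "t = s + pmf p x" unfolding s_def t_def using p by simp
  have s0: "0 \<le> s" unfolding s_def by (intro sum_nonneg) auto
  have "t \<le> (\<Sum>y\<in>set_pmf p. pmf p y)" unfolding t_def using p by (intro sum_mono2) auto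
  then have t1: "t \<le> 1" using sum_pmf_eq_1[OF p] by simp
  have quant: "quantile p \<theta> = x" if "s \<le> \<theta>" "\<theta> < t" for \<theta>
    unfolding quantile_def
  proof (rule Min_eqI)
    fix z assume z: "z \<in> {x \<in> set_pmf p. \<theta> < ?cdf x}"
    show "x \<le> z"
    proof (rule ccontr)
      assume "\<not> x \<le> z"
      then have "?cdf z \<le> s" unfolding s_def using p by (intro sum_mono2) auto
      then show False using z that by simp
    qed
  qed (use p x that in \<open>auto simp: t_def\<close>)
  have "pmf p x - 1 / 2 ^ k \<le> measure_pmf.prob (flips k) {r. binary_fraction r < t} - measure_pmf.prob (flips k) {r. binary_fraction r < s}"
    using prob_binary_fraction(1)[of t k] prob_binary_fraction(2)[of k s] s0 t1 t pmf_nonneg[of p x] by simp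
  also have "\<dots> = measure_pmf.prob (flips k) ({r. binary_fraction r < t} - {r. binary_fraction r < s})"
  proof (rule measure_pmf.finite_measure_Diff[symmetric])
    have "s \<le> t" using t pmf_nonneg[of p x] by simp
    then show "{r :: bool list. binary_fraction r < s} \<subseteq> {r. binary_fraction r < t}" by auto
  qed auto
  also have "\<dots> \<le> measure_pmf.prob (flips k) {r. quantile p (binary_fraction r) = x}"
    by (intro measure_pmf.finite_measure_mono) (auto intro: quant)
  also have "\<dots> = pmf (map_pmf (\<lambda>r. quantile p (binary_fraction r)) (map_pmf rev (flips k))) x"
    unfolding map_rev_flips pmf_map by (simp add: vimage_def)
  also have "\<dots> = pmf (map_pmf (\<lambda>r. quantile p (binary_fraction (rev r))) (flips k)) x"
    by (simp add: pmf.map_comp o_def)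
  finally have "pmf p x - 1 / 2 ^ k \<le> pmf (map_pmf (\<lambda>r. quantile p (binary_fraction (rev r))) (flips k)) x" .
  moreover have "1 / 2 ^ k \<le> 2 ^ N / 2 ^ k * pmf p x"
    using mult_left_mono[OF x(2), of "2 ^ N / 2 ^ k"] by simp
  ultimately show ?thesis by (simp add: algebra_simps)
qed

section \<open>Functional descriptions of the commitment and the next action\<close>

section \<open>The programs\<close>

lemma ptime_comp2:
  assumes "ptime (\<lambda>F v. h F (left_of v) (right_of v))" "ptime f" "ptime g"
  shows "ptime (\<lambda>F v. h F (f F v) (g F v))"
  using ptime_comp[OF assms(1) ptime_Node[OF assms(2,3)]] by simp

lemma ptime_comp3:
  assumes "ptime (\<lambda>F v. h F (left_of v) (left_of (right_of v)) (right_of (right_of v)))" "ptime f" "ptime g" "ptime e"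
  shows "ptime (\<lambda>F v. h F (f F v) (g F v) (e F v))"
  using ptime_comp[OF assms(1) ptime_Node[OF assms(2) ptime_Node[OF assms(3,4)]]] by simp

definition v_above :: "val \<Rightarrow> val \<Rightarrow> val" where
  "v_above t l = vfilter (\<lambda>x. num_of (left_of t) \<le> num_of (left_of x)) l"

definition v_ratio :: "val \<Rightarrow> val \<Rightarrow> val \<Rightarrow> val" where
  "v_ratio t l c = vdiv (vsub (vsum (\<lambda>x. vmul (right_of x) (left_of x)) (v_above t l)) c)
     (vsum (\<lambda>x. right_of x) (v_above t l))"

definition v_root :: "val \<Rightarrow> val \<Rightarrow> val" where
  "v_root l c = left_of (vbest (vmap (\<lambda>t. Node (v_ratio t l c) (Num 0)) l))"

definition v_open :: "val \<Rightarrow> val" where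
  "v_open B = v_root (right_of B) (left_of B)"

definition v_grab :: "val \<Rightarrow> val" where
  "v_grab B = vsub (Num 0)
     (v_root (vmap (\<lambda>x. Node (vsub (Num 0) (left_of x)) (right_of x)) (right_of B)) (left_of B))"

definition v_mean :: "val \<Rightarrow> val" where
  "v_mean B = vsum (\<lambda>x. vmul (right_of x) (left_of x)) (right_of B)"

definition v_max :: "val \<Rightarrow> val \<Rightarrow> val" where
  "v_max v w = (if num_of v < num_of w then w else v)"

definition v_min :: "val \<Rightarrow> val \<Rightarrow> val" where
  "v_min v w = (if num_of v < num_of w then v else w)"

definition v_surrogate :: "val \<Rightarrow> val \<Rightarrow> val" where
  "v_surrogate B x = (if num_of (v_grab B) \<le> num_of (v_open B) then v_max (v_grab B) (v_min x (v_open B)) else v_mean B)"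

definition v_cdf :: "val \<Rightarrow> val \<Rightarrow> val" where
  "v_cdf x l = vsum (\<lambda>y. right_of y) (vfilter (\<lambda>y. num_of (left_of y) \<le> num_of (left_of x)) l)"

definition v_quantile :: "val \<Rightarrow> val \<Rightarrow> val" where
  "v_quantile l \<theta> = left_of (left_of (vfilter (\<lambda>x. num_of \<theta> < num_of (v_cdf x l)) l))"

definition v_slice :: "val \<Rightarrow> val \<Rightarrow> val \<Rightarrow> val" where
  "v_slice R s k = vmap (\<lambda>e. right_of e)
     (vfilter (\<lambda>e. num_of s \<le> num_of (left_of e) \<and> num_of (left_of e) < num_of (vadd s k)) (venum R))"

definition v_length :: "val \<Rightarrow> val" where
  "v_length l = vsum (\<lambda>_. Num 1) l"

text \<open>The flips are shared evenly among \<open>n * n\<close> draws: one draw of every box for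
  the decision of every box.\<close>

definition v_block :: "val \<Rightarrow> val" where
  "v_block w = vfloor (vdiv (v_length (right_of w)) (vmul (v_length (left_of w)) (v_length (left_of w))))"

text \<open>Here and below, \<open>w\<close> is the pair of instance and coin flips, and \<open>e\<close> a numbered box.\<close>

definition v_sample :: "val \<Rightarrow> val \<Rightarrow> val \<Rightarrow> val" where
  "v_sample w i e = v_quantile (right_of (right_of e))
     (vfrac (v_slice (right_of w)
       (vmul (vadd (vmul i (v_length (left_of w))) (left_of e)) (v_block w)) (v_block w)))"

definition v_weights :: "val \<Rightarrow> val \<Rightarrow> val" where
  "v_weights w i = vmap (\<lambda>e. Node (left_of e) (v_surrogate (right_of e) (v_sample w i e))) (venum (left_of w))"

text \<open>The box itself is filtered out instead of being reweighted by its grab index, since it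
  is never ahead of itself.\<close>

definition v_ahead :: "val \<Rightarrow> val \<Rightarrow> val" where
  "v_ahead w e = vmap (\<lambda>x. left_of x) (vfilter (\<lambda>x. \<not> num_of (left_of x) = num_of (left_of e) \<and>
     (num_of (v_grab (right_of e)) < num_of (right_of x) \<or>
      num_of (right_of x) = num_of (v_grab (right_of e)) \<and> num_of (left_of x) < num_of (left_of e)))
     (v_weights w (left_of e)))"

definition v_grabs :: "nat set set \<Rightarrow> val \<Rightarrow> val \<Rightarrow> bool" where
  "v_grabs F w e \<longleftrightarrow> num_of (v_open (right_of e)) < num_of (v_grab (right_of e)) \<or>
     answer F (Node (left_of e) (vbasis F (v_ahead w e))) = Num 1"

definition v_commit :: "nat set set \<Rightarrow> val \<Rightarrow> val" where
  "v_commit F w = vmap (\<lambda>e. if v_grabs F w e then Num 0 else Num 1) (venum (left_of w))"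

definition v_accepted :: "val \<Rightarrow> val" where
  "v_accepted H = vmap (\<lambda>e. right_of e) (vfilter (\<lambda>e. num_of (left_of e) = num_of (Num 2)) H)"

definition v_opened :: "val \<Rightarrow> val \<Rightarrow> val" where
  "v_opened H i = vfilter (\<lambda>e. num_of (left_of e) = num_of (Num 0) \<and> num_of (left_of (right_of e)) = num_of i) H"

definition v_grabbed :: "val \<Rightarrow> val \<Rightarrow> val" where
  "v_grabbed H i = vfilter (\<lambda>e. num_of (left_of e) = num_of (Num 1) \<and> num_of (right_of e) = num_of i) H"

definition v_candidate :: "nat set set \<Rightarrow> val \<Rightarrow> val \<Rightarrow> bool" where
  "v_candidate F H i \<longleftrightarrow> \<not> is_node (vfilter (\<lambda>x. num_of x = num_of i) (v_accepted H)) \<and>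
     answer F (Node i (v_accepted H)) = Num 1"

definition v_flag :: "val \<Rightarrow> val \<Rightarrow> val" where
  "v_flag c i = right_of (left_of (vfilter (\<lambda>e. num_of (left_of e) = num_of i) (venum c)))"

text \<open>Key and encoded action side by side, so that \<open>vbest\<close> selects an action
  while comparing only keys.\<close>

definition v_entry :: "val \<Rightarrow> val \<Rightarrow> val \<Rightarrow> val" where
  "v_entry H c e =
     (if is_node (v_opened H (left_of e)) then
        Node (right_of (right_of (left_of (v_opened H (left_of e))))) (Node (Num 2) (left_of e))
      else if is_node (v_grabbed H (left_of e)) then Node (v_mean (right_of e)) (Node (Num 2) (left_of e))
      else if num_of (v_flag c (left_of e)) = num_of (Num 1) then Node (v_open (right_of e)) (Node (Num 0) (left_of e))
      else Node (v_mean (right_of e)) (Node (Num 1) (left_of e)))"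

definition v_choice :: "nat set set \<Rightarrow> val \<Rightarrow> val \<Rightarrow> val \<Rightarrow> val" where
  "v_choice F V H c = vbest (vmap (\<lambda>e. v_entry H c e) (vfilter (\<lambda>e. v_candidate F H (left_of e)) (venum V)))"

text \<open>The commitment is recomputed from the flips at every step, so the program keeps no state
  between steps.\<close>

definition v_act :: "nat set set \<Rightarrow> val \<Rightarrow> val" where
  "v_act F z = (let b = v_choice F (left_of z) (right_of (right_of z))
       (v_commit F (Node (left_of z) (left_of (right_of z)))) in
     if is_node b then right_of b else Num 3)"

text \<open>Each function is first treated on packed arguments and then restated for computed
  arguments, the form in which the next one can use it.\<close>

lemma ptime_programs: "ptime v_commit" "ptime v_act"
proof -
  have 1: "ptime (\<lambda>F v. v_above (left_of v) (right_of v))"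
    unfolding v_above_def by (intro ptime_intros)
  note i1 = ptime_comp2[where h="\<lambda>F. v_above", OF 1]
  have 2: "ptime (\<lambda>F v. v_ratio (left_of v) (left_of (right_of v)) (right_of (right_of v)))"
    unfolding v_ratio_def by (intro i1 ptime_intros)
  note i2 = ptime_comp3[where h="\<lambda>F. v_ratio", OF 2]
  have 3: "ptime (\<lambda>F v. v_root (left_of v) (right_of v))"
    unfolding v_root_def by (intro i2 ptime_intros)
  note i3 = ptime_comp2[where h="\<lambda>F. v_root", OF 3]
  have 4: "ptime (\<lambda>F v. v_open v)" "ptime (\<lambda>F v. v_grab v)" "ptime (\<lambda>F v. v_mean v)"
    unfolding v_open_def v_grab_def v_mean_def by (intro i3 ptime_intros)+
  note i4 = ptime_comp[OF 4(1)] ptime_comp[OF 4(2)] ptime_comp[OF 4(3)]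
  have 5: "ptime (\<lambda>F v. v_max (left_of v) (right_of v))" "ptime (\<lambda>F v. v_min (left_of v) (right_of v))"
    unfolding v_max_def v_min_def by (intro ptime_intros)+
  note i5 = ptime_comp2[where h="\<lambda>F. v_max", OF 5(1)] ptime_comp2[where h="\<lambda>F. v_min", OF 5(2)]
  have 6: "ptime (\<lambda>F v. v_surrogate (left_of v) (right_of v))"
    unfolding v_surrogate_def by (intro i4 i5 ptime_intros)
  note i6 = ptime_comp2[where h="\<lambda>F. v_surrogate", OF 6]
  have 7: "ptime (\<lambda>F v. v_cdf (left_of v) (right_of v))"
    unfolding v_cdf_def by (intro ptime_intros)
  note i7 = ptime_comp2[where h="\<lambda>F. v_cdf", OF 7]
  have 8: "ptime (\<lambda>F v. v_quantile (left_of v) (right_of v))"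
    unfolding v_quantile_def by (intro i7 ptime_intros)
  note i8 = ptime_comp2[where h="\<lambda>F. v_quantile", OF 8]
  have 9: "ptime (\<lambda>F v. v_slice (left_of v) (left_of (right_of v)) (right_of (right_of v)))"
    unfolding v_slice_def by (intro ptime_intros)
  note i9 = ptime_comp3[where h="\<lambda>F. v_slice", OF 9]
  have 10: "ptime (\<lambda>F v. v_length v)" unfolding v_length_def by (intro ptime_intros)
  note i10 = ptime_comp[OF 10]
  have 11: "ptime (\<lambda>F v. v_block v)" unfolding v_block_def by (intro i10 ptime_intros)
  note i11 = ptime_comp[OF 11]
  have 12: "ptime (\<lambda>F v. v_sample (left_of v) (left_of (right_of v)) (right_of (right_of v)))"
    unfolding v_sample_def by (intro i8 i9 i10 i11 ptime_intros)
  note i12 = ptime_comp3[where h="\<lambda>F. v_sample", OF 12]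
  have 13: "ptime (\<lambda>F v. v_weights (left_of v) (right_of v))"
    unfolding v_weights_def by (intro i6 i12 ptime_intros)
  note i13 = ptime_comp2[where h="\<lambda>F. v_weights", OF 13]
  have 14: "ptime (\<lambda>F v. v_ahead (left_of v) (right_of v))"
    unfolding v_ahead_def by (intro i4 i13 ptime_intros)
  note i14 = ptime_comp2[where h="\<lambda>F. v_ahead", OF 14]
  have 15: "ptime (\<lambda>F v. val_of_bool (v_grabs F (left_of v) (right_of v)))"
    unfolding v_grabs_def by (intro i4 i14 ptime_intros)
  note i15 = ptime_comp2[where h="\<lambda>F x y. val_of_bool (v_grabs F x y)", OF 15]
  show 16: "ptime v_commit"
    unfolding v_commit_def[abs_def] by (intro i15 ptime_intros)
  note i16 = ptime_comp[OF 16]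
  have 17: "ptime (\<lambda>F v. v_accepted v)" unfolding v_accepted_def by (intro ptime_intros)
  note i17 = ptime_comp[OF 17]
  have 18: "ptime (\<lambda>F v. v_opened (left_of v) (right_of v))" unfolding v_opened_def by (intro ptime_intros)
  note i18 = ptime_comp2[where h="\<lambda>F. v_opened", OF 18]
  have 19: "ptime (\<lambda>F v. v_grabbed (left_of v) (right_of v))" unfolding v_grabbed_def by (intro ptime_intros)
  note i19 = ptime_comp2[where h="\<lambda>F. v_grabbed", OF 19]
  have 20: "ptime (\<lambda>F v. val_of_bool (v_candidate F (left_of v) (right_of v)))"
    unfolding v_candidate_def by (intro i17 ptime_intros)
  note i20 = ptime_comp2[where h="\<lambda>F x y. val_of_bool (v_candidate F x y)", OF 20]
  have 21: "ptime (\<lambda>F v. v_flag (left_of v) (right_of v))" unfolding v_flag_def by (intro ptime_intros)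
  note i21 = ptime_comp2[where h="\<lambda>F. v_flag", OF 21]
  have 22: "ptime (\<lambda>F v. v_entry (left_of v) (left_of (right_of v)) (right_of (right_of v)))"
    unfolding v_entry_def by (intro i4 i18 i19 i21 ptime_intros)
  note i22 = ptime_comp3[where h="\<lambda>F. v_entry", OF 22]
  have 23: "ptime (\<lambda>F v. v_choice F (left_of v) (left_of (right_of v)) (right_of (right_of v)))"
    unfolding v_choice_def by (intro i20 i22 ptime_intros)
  note i23 = ptime_comp3[where h=v_choice, OF 23]
  show "ptime v_act" unfolding v_act_def[abs_def] Let_def by (intro i16 i23 ptime_intros)
qed

section \<open>Agreement of the programs with the real-valued definitions\<close>

section \<open>Correctness of the programs\<close>

definition real_val :: "val \<Rightarrow> real" where
  "real_val v = of_rat (num_of v)"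

lemma real_val_simps [simp]:
  "real_val (vadd v w) = real_val v + real_val w"
  "real_val (vsub v w) = real_val v - real_val w"
  "real_val (vmul v w) = real_val v * real_val w"
  "real_val (vdiv v w) = real_val v / real_val w"
  "real_val (Num q) = of_rat q"
  "real_val (val_of_nat i) = real i"
  by (simp_all add: real_val_def vadd_def vsub_def vmul_def vdiv_def val_of_nat_def
      of_rat_add of_rat_diff of_rat_mult of_rat_divide)

lemma num_of_compare:
  "num_of v \<le> num_of w \<longleftrightarrow> real_val v \<le> real_val w"
  "num_of v < num_of w \<longleftrightarrow> real_val v < real_val w"
  "num_of v = num_of w \<longleftrightarrow> real_val v = real_val w"
  by (simp_all add: real_val_def of_rat_less_eq of_rat_less)

lemma of_rat_sum_list: "(of_rat (sum_list qs) :: real) = sum_list (map of_rat qs)"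
  by (induction qs) (simp_all add: of_rat_add)

lemma real_val_vsum: "real_val (vsum f v) = (\<Sum>x\<leftarrow>list_of v. real_val (f x))"
  by (simp add: vsum_def of_rat_sum_list o_def) (simp add: real_val_def)

lemma list_of_simps [simp]:
  "list_of (vmap f v) = map f (list_of v)"
  "list_of (vfilter P v) = filter P (list_of v)"
  by (simp_all add: vmap_def vfilter_def)

lemma list_of_venum: "list_of (venum v) = map (\<lambda>i. Node (val_of_nat i) (list_of v ! i)) [0..<length (list_of v)]"
  unfolding venum_def by (rule nth_equalityI) (auto simp: nth_enumerate_eq)

lemma is_node_list_of: "is_node v \<longleftrightarrow> list_of v \<noteq> []" and left_of_hd: "list_of v \<noteq> [] \<Longrightarrow> left_of v = hd (list_of v)"
  by (cases v; simp)+

lemma real_val_of_real: "x \<in> \<rat> \<Longrightarrow> real_val (val_of_real x) = x"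
proof -
  assume "x \<in> \<rat>"
  then obtain q where q: "x = of_rat q" by (elim Rats_cases)
  then have "(THE q. of_rat q = x) = q" by (intro the_equality) auto
  then show ?thesis by (simp add: val_of_real_def q)
qed

lemma vbest_max:
  assumes "list_of v \<noteq> []" "\<forall>x\<in>set (list_of v). is_node x"
  shows "vbest v \<in> set (list_of v)" "\<forall>x\<in>set (list_of v). real_val (left_of x) \<le> real_val (left_of (vbest v))"
proof -
  let ?f = "\<lambda>acc x. if \<not> is_node acc \<or> num_of (left_of acc) < num_of (left_of x) then x else acc"
  have "foldl ?f (Num 0) xs \<in> set xs \<and> (\<forall>x\<in>set xs. real_val (left_of x) \<le> real_val (left_of (foldl ?f (Num 0) xs)))"
    if "xs \<noteq> []" "\<forall>x\<in>set xs. is_node x" for xs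
    using that
  proof (induction xs rule: rev_induct)
    case (snoc x xs)
    show ?case
    proof (cases "xs = []")
      case False
      define acc where "acc = foldl ?f (Num 0) xs"
      have IH: "acc \<in> set xs" "\<forall>x\<in>set xs. real_val (left_of x) \<le> real_val (left_of acc)"
        using snoc False unfolding acc_def by auto
      then have "is_node acc" using snoc by auto
      then have "foldl ?f (Num 0) (xs @ [x]) = (if real_val (left_of acc) < real_val (left_of x) then x else acc)"
        by (simp add: acc_def num_of_compare)
      then show ?thesis using IH by (auto intro: order_trans less_imp_le)
    qed simp
  qed simp
  from this[OF assms] show "vbest v \<in> set (list_of v)"
    "\<forall>x\<in>set (list_of v). real_val (left_of x) \<le> real_val (left_of (vbest v))"
    unfolding vbest_def by auto
qed

text \<open>The reading \<open>f\<close>, \<open>p\<close> of the list entries is left abstract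
  because the grab index applies this to negated values.\<close>

lemma v_root_correct:
  assumes l: "list_of l = map g xs" and xs: "distinct xs" "xs \<noteq> []"
    and g: "\<And>x. x \<in> set xs \<Longrightarrow> real_val (left_of (g x)) = f x" "\<And>x. x \<in> set xs \<Longrightarrow> real_val (right_of (g x)) = p x"
  shows "real_val (v_root l c) = gain_root (set xs) p f (real_val c)"
proof -
  let ?r = "\<lambda>t. ((\<Sum>x\<in>{x \<in> set xs. f t \<le> f x}. p x * f x) - real_val c) / (\<Sum>x\<in>{x \<in> set xs. f t \<le> f x}. p x)"
  have ratio: "real_val (v_ratio (g t) l c) = ?r t" if t: "t \<in> set xs" for t
  proof -
    let ?ys = "filter (\<lambda>x. f t \<le> f x) xs"
    have above: "list_of (v_above (g t) l) = map g ?ys"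
      unfolding v_above_def by (simp add: l num_of_compare filter_map o_def g t cong: filter_cong)
    have ys: "distinct ?ys" "set ?ys = {x \<in> set xs. f t \<le> f x}" using xs by auto
    have "(\<Sum>v\<leftarrow>list_of (v_above (g t) l). real_val (right_of v) * real_val (left_of v)) = (\<Sum>x\<leftarrow>?ys. p x * f x)"
      unfolding above map_map o_def by (intro arg_cong[where f=sum_list] map_cong refl) (simp add: g)
    moreover have "(\<Sum>v\<leftarrow>list_of (v_above (g t) l). real_val (right_of v)) = (\<Sum>x\<leftarrow>?ys. p x)"
      unfolding above map_map o_def by (intro arg_cong[where f=sum_list] map_cong refl) (simp add: g)
    ultimately show ?thesis
      unfolding v_ratio_def ys(2)[symmetric]
      by (simp only: real_val_simps real_val_vsum sum_list_distinct_conv_sum_set[OF ys(1)])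
  qed
  define bs where "bs = vmap (\<lambda>t. Node (v_ratio t l c) (Num 0)) l"
  have bs: "list_of bs = map (\<lambda>t. Node (v_ratio (g t) l c) (Num 0)) xs" unfolding bs_def by (simp add: l)
  then have ne: "list_of bs \<noteq> []" "\<forall>x\<in>set (list_of bs). is_node x" using xs by auto
  obtain t where t: "t \<in> set xs" "vbest bs = Node (v_ratio (g t) l c) (Num 0)"
    using vbest_max(1)[OF ne] unfolding bs by auto
  have max: "\<forall>u\<in>set xs. ?r u \<le> ?r t"
    using vbest_max(2)[OF ne] unfolding bs t(2) using ratio t(1) by auto
  have "real_val (v_root l c) = ?r t" unfolding v_root_def bs_def[symmetric] t(2) using ratio[OF t(1)] by simp
  also have "\<dots> = gain_root (set xs) p f (real_val c)"
    unfolding gain_root_def using max t(1) by (intro Max_eqI[symmetric]) auto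
  finally show ?thesis .
qed

locale rational_box = finite_box +
  assumes rat: "cost B \<in> \<rat>" "set_pmf (value_dist B) \<subseteq> \<rat>" "range (pmf (value_dist B)) \<subseteq> \<rat>"
begin

abbreviation "support \<equiv> sorted_list_of_set (set_pmf D)"
abbreviation "atom x \<equiv> Node (val_of_real x) (val_of_real (pmf D x))"

lemma support: "set support = set_pmf D" "distinct support" "support \<noteq> []" "sorted support"
  using finite_support set_pmf_not_empty[of D] by auto

lemma list_of_box: "list_of (right_of (val_of_box B)) = map atom support"
  by (simp add: val_of_box_def)

lemma atom_correct: "x \<in> set support \<Longrightarrow> real_val (left_of (atom x)) = x" "real_val (right_of (atom x)) = pmf D x"
  using rat finite_support by (auto intro!: real_val_of_real)

lemma cost_correct: "real_val (left_of (val_of_box B)) = cost B"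
  using rat by (simp add: val_of_box_def real_val_of_real)

lemma v_open_correct: "real_val (v_open (val_of_box B)) = open_index B"
proof -
  have "real_val (v_root (right_of (val_of_box B)) (left_of (val_of_box B))) =
     gain_root (set support) (pmf D) (\<lambda>x. x) (real_val (left_of (val_of_box B)))"
    by (rule v_root_correct[OF list_of_box support(2,3)]) (use atom_correct in simp_all)
  then show ?thesis unfolding v_open_def open_index_def support(1) cost_correct .
qed

lemma v_grab_correct: "real_val (v_grab (val_of_box B)) = grab_index B"
proof -
  have "real_val (v_root (vmap (\<lambda>x. Node (vsub (Num 0) (left_of x)) (right_of x)) (right_of (val_of_box B))) (left_of (val_of_box B))) =
     gain_root (set support) (pmf D) uminus (real_val (left_of (val_of_box B)))"
  proof (rule v_root_correct[where g="\<lambda>x. Node (vsub (Num 0) (left_of (atom x))) (right_of (atom x))", OF _ support(2,3)])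
    show "list_of (vmap (\<lambda>x. Node (vsub (Num 0) (left_of x)) (right_of x)) (right_of (val_of_box B))) =
        map (\<lambda>x. Node (vsub (Num 0) (left_of (atom x))) (right_of (atom x))) support"
      by (simp add: list_of_box)
  qed (use atom_correct in simp_all)
  then show ?thesis unfolding v_grab_def grab_index_def support(1) cost_correct by simp
qed

lemma sum_support: "(\<Sum>x\<leftarrow>filter Q support. h x) = (\<Sum>x\<in>{x \<in> set_pmf D. Q x}. h x)" for h :: "real \<Rightarrow> real"
  using support by (subst sum_list_distinct_conv_sum_set) auto

lemma v_mean_correct: "real_val (v_mean (val_of_box B)) = mean B"
proof -
  have "real_val (v_mean (val_of_box B)) = (\<Sum>x\<leftarrow>support. real_val (right_of (atom x)) * real_val (left_of (atom x)))"
    unfolding v_mean_def real_val_vsum list_of_box by (simp add: o_def)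
  also have "\<dots> = (\<Sum>x\<leftarrow>support. pmf D x * x)"
    using atom_correct by (intro arg_cong[where f=sum_list] map_cong refl) simp
  also have "\<dots> = mean B"
    unfolding mean_def expect_sum_pmf[OF finite_support] using sum_support[where Q="\<lambda>_. True"] by simp
  finally show ?thesis .
qed

lemma v_surrogate_correct: "real_val (v_surrogate (val_of_box B) x) = surrogate B (real_val x)"
  unfolding v_surrogate_def surrogate_def v_max_def v_min_def num_of_compare
  by (auto simp: v_open_correct v_grab_correct v_mean_correct max_def min_def)

text \<open>The support is listed in increasing order, so the first value whose cumulative
  probability exceeds \<open>\<theta>\<close> is the minimum in \<open>quantile\<close>;
  \<open>\<theta> < 1\<close> guarantees that there is one.\<close>

lemma v_quantile_correct:
  assumes "real_val \<theta> < 1"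
  shows "real_val (v_quantile (right_of (val_of_box B)) \<theta>) = quantile D (real_val \<theta>)"
proof -
  let ?l = "right_of (val_of_box B)"
  let ?cdf = "\<lambda>x. \<Sum>y\<in>{y \<in> set_pmf D. y \<le> x}. pmf D y"
  let ?P = "\<lambda>x. real_val \<theta> < ?cdf x"
  have cdf: "real_val (v_cdf (atom x) ?l) = ?cdf x" if x: "x \<in> set support" for x
  proof -
    have "filter (\<lambda>y. num_of (left_of y) \<le> num_of (left_of (atom x))) (list_of ?l) = map atom (filter (\<lambda>y. y \<le> x) support)"
      unfolding list_of_box filter_map o_def num_of_compare
      by (intro arg_cong[where f="map atom"] filter_cong refl) (simp only: atom_correct x)
    then have "real_val (v_cdf (atom x) ?l) = (\<Sum>y\<leftarrow>filter (\<lambda>y. y \<le> x) support. real_val (right_of (atom y)))"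
      unfolding v_cdf_def real_val_vsum by (simp add: o_def)
    then show ?thesis unfolding atom_correct(2) sum_support .
  qed
  have filter: "filter (\<lambda>x. num_of \<theta> < num_of (v_cdf x ?l)) (list_of ?l) = map atom (filter ?P support)"
    unfolding list_of_box filter_map o_def num_of_compare
    by (intro arg_cong[where f="map atom"] filter_cong refl) (simp only: cdf)
  have "?cdf (Max (set_pmf D)) = (\<Sum>y\<in>set_pmf D. pmf D y)"
    using finite_support by (intro sum.cong) auto
  then have "?P (Max (set_pmf D))" using sum_pmf_eq_1[OF finite_support] assms by simp
  moreover have "Max (set_pmf D) \<in> set_pmf D" using finite_support set_pmf_not_empty by (rule Max_in)
  ultimately have ne: "filter ?P support \<noteq> []" using support(1) by (auto simp: filter_empty_conv)
  have sorted: "sorted (filter ?P support)" using support(4) by (rule sorted_wrt_filter)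
  have hd: "hd (filter ?P support) = quantile D (real_val \<theta>)"
    unfolding quantile_def
  proof (rule Min_eqI[symmetric])
    show "hd (filter ?P support) \<in> {x \<in> set_pmf D. ?P x}"
      using hd_in_set[OF ne] support(1) by auto
    fix y assume "y \<in> {x \<in> set_pmf D. ?P x}"
    then have "y \<in> set (filter ?P support)" using support(1) by auto
    then show "hd (filter ?P support) \<le> y" using sorted by (cases "filter ?P support") auto
  qed (use finite_support in simp)
  have "v_quantile ?l \<theta> = left_of (atom (hd (filter ?P support)))"
    unfolding v_quantile_def using ne filter by (subst left_of_hd) (simp_all add: hd_map)
  then show ?thesis using atom_correct(1)[of "hd (filter ?P support)"] hd_in_set[OF ne] hd by simp
qed

end

lemma of_rat_binary_fraction: "(of_rat (binary_fraction bs) :: real) = binary_fraction bs"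
  by (induction bs) (simp_all add: of_rat_divide of_rat_add)

lemma vfrac_correct: "list_of v = map val_of_bool bs \<Longrightarrow> real_val (vfrac v) = binary_fraction (rev bs)"
  by (simp add: vfrac_eq of_rat_binary_fraction o_def)

lemma filter_upt: "filter (\<lambda>i. a \<le> i \<and> i < b) [0..<m] = [a..<min b m]"
  by (rule sorted_distinct_set_unique) (auto simp: sorted_wrt_filter)

lemma v_slice_correct:
  assumes "real_val s = real a" "real_val k = real c"
  shows "list_of (v_slice (val_of_bits r) s k) = map val_of_bool (take c (drop a r))"
proof -
  have eq: "(real_val s \<le> real i \<and> real i < real_val s + real_val k) \<longleftrightarrow> a \<le> i \<and> i < a + c" for i
    unfolding assms by (simp flip: of_nat_add)
  have "list_of (v_slice (val_of_bits r) s k) = map (\<lambda>i. map val_of_bool r ! i) [a..<min (a + c) (length r)]"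
    unfolding v_slice_def val_of_bits_def
    by (simp add: list_of_venum filter_map o_def num_of_compare eq filter_upt)
  also have "\<dots> = map val_of_bool (take c (drop a r))"
  proof (rule nth_equalityI)
    fix t assume "t < length (map (\<lambda>i. map val_of_bool r ! i) [a..<min (a + c) (length r)])"
    then have "a + t < min (a + c) (length r)" by auto
    then show "map (\<lambda>i. map val_of_bool r ! i) [a..<min (a + c) (length r)] ! t = map val_of_bool (take c (drop a r)) ! t"
      by (auto simp: min_less_iff_conj)
  qed simp
  finally show ?thesis .
qed

lemma val_of_nat_inj: "val_of_nat i = val_of_nat j \<longleftrightarrow> i = j"
  by (simp add: val_of_nat_def)

lemma val_of_list_inj: "val_of_list xs = val_of_list ys \<longleftrightarrow> xs = ys"
  by (metis list_of_val_of_list)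

lemma answer_correct: "answer F (val_of_list (map val_of_nat js)) = Num 1 \<longleftrightarrow> set js \<in> F"
proof -
  have "inj val_of_nat" by (rule injI) (simp add: val_of_nat_inj)
  then have "(\<exists>is. val_of_list (map val_of_nat js) = val_of_list (map val_of_nat is) \<and> set is \<in> F) \<longleftrightarrow> set js \<in> F"
    by (auto simp: val_of_list_inj inj_map_eq_map)
  then show ?thesis unfolding answer_def by (simp only:) (cases "set js \<in> F"; simp)
qed

lemma answer_insert:
  "answer F (Node (val_of_nat i) (val_of_list (map val_of_nat js))) = Num 1 \<longleftrightarrow> insert i (set js) \<in> F"
  using answer_correct[of F "i # js"] by simp

text \<open>One pass in any order suffices: an element rejected once stays dependent when the set
  grows.\<close>

lemma vbasis_correct:
  assumes m: "matroid E F" and v: "list_of v = map val_of_nat js"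
  obtains bs where "vbasis F v = val_of_list (map val_of_nat bs)" "basis_of F (set js) (set bs)"
proof -
  have "\<exists>bs. foldl (\<lambda>acc x. if answer F (Node x acc) = Num 1 then Node x acc else acc) (Num 0) (map val_of_nat js) =
    val_of_list (map val_of_nat bs) \<and> basis_of F (set js) (set bs)" for js
  proof (induction js rule: rev_induct)
    case Nil
    show ?case by (rule exI[of _ "[]"]) (simp add: basis_of_def matroidD(2)[OF m])
  next
    case (snoc j js)
    then obtain bs where bs: "foldl (\<lambda>acc x. if answer F (Node x acc) = Num 1 then Node x acc else acc) (Num 0) (map val_of_nat js) =
      val_of_list (map val_of_nat bs)" "basis_of F (set js) (set bs)" by blast
    show ?case
    proof (cases "insert j (set bs) \<in> F")
      case True
      have "insert x (insert j (set bs)) \<notin> F" if "x \<in> set js - set bs" for x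
        using bs(2) that matroidD(6)[OF m, of "insert x (insert j (set bs))" "insert x (set bs)"] by (auto simp: basis_of_def)
      then have "basis_of F (set (js @ [j])) (set (j # bs))" using True bs(2) by (auto simp: basis_of_def)
      then show ?thesis using True by (intro exI[of _ "j # bs"]) (simp add: bs(1) answer_insert)
    next
      case False
      then have "basis_of F (set (js @ [j])) (set bs)" using bs(2) by (auto simp: basis_of_def)
      then show ?thesis using False by (intro exI[of _ bs]) (simp add: bs(1) answer_insert)
    qed
  qed
  then show thesis using that unfolding vbasis_def v by blast
qed

locale rational_valid_instance = valid_instance +
  assumes rational: "rational_instance I"
begin

abbreviation "V \<equiv> val_of_pboi I"

lemma rational_bx: "i < n \<Longrightarrow> rational_box (bx i)"
proof -
  assume i: "i < n"
  interpret finite_box "bx i" by (rule finite_bx[OF i])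
  show ?thesis using rational nth_mem[OF i] unfolding rational_instance_def by unfold_locales auto
qed

lemma list_of_V: "list_of (venum V) = map (\<lambda>i. Node (val_of_nat i) (val_of_box (bx i))) [0..<n]"
  unfolding list_of_venum val_of_pboi_def by simp

lemma v_length_correct: "real_val (v_length v) = real (length (list_of v))"
proof -
  have "(\<Sum>x\<leftarrow>xs. real_val (Num 1)) = real (length xs)" for xs :: "val list"
    by (induction xs) auto
  then show ?thesis unfolding v_length_def real_val_vsum .
qed

lemma length_V: "real_val (v_length V) = real n"
  by (simp add: v_length_correct val_of_pboi_def)

definition block :: "bool list \<Rightarrow> nat" where
  "block r = length r div (n * n)"

lemma v_block_correct: "real_val (v_block (Node V (val_of_bits r))) = real (block r)"
proof -
  have "real_of_rat (num_of (v_length v)) = real (length (list_of v))" for v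
    using v_length_correct[of v] by (simp add: real_val_def)
  then have num: "num_of (v_length v) = of_nat (length (list_of v))" for v
    by (metis of_rat_eq_iff of_rat_of_nat_eq)
  have "\<lfloor>num_of (vdiv (v_length (val_of_bits r)) (vmul (v_length V) (v_length V)))\<rfloor> = int (block r)"
    by (simp add: vdiv_def vmul_def num val_of_bits_def val_of_pboi_def block_def floor_divide_of_nat_eq flip: of_nat_mult)
  then show ?thesis unfolding v_block_def vfloor_def by simp
qed

definition sample :: "bool list \<Rightarrow> nat \<Rightarrow> nat \<Rightarrow> real" where
  "sample r i j = quantile (dist_of j) (binary_fraction (rev (take (block r) (drop ((i * n + j) * block r) r))))"

lemma v_sample_correct:
  assumes "j < n"
  shows "real_val (v_sample (Node V (val_of_bits r)) (val_of_nat i) (Node (val_of_nat j) (val_of_box (bx j)))) = sample r i j"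
proof -
  interpret b: rational_box "bx j" by (rule rational_bx[OF assms])
  let ?R = "val_of_bits r" and ?k = "v_block (Node V (val_of_bits r))"
  let ?s = "vmul (vadd (vmul (val_of_nat i) (v_length V)) (val_of_nat j)) ?k"
  have "list_of (v_slice ?R ?s ?k) = map val_of_bool (take (block r) (drop ((i * n + j) * block r) r))"
    by (rule v_slice_correct) (simp_all add: v_block_correct length_V)
  from vfrac_correct[OF this] show ?thesis
    using b.v_quantile_correct[of "vfrac (v_slice ?R ?s ?k)"]
    by (simp add: v_sample_def sample_def binary_fraction_bounds)
qed

lemma v_ahead_correct:
  assumes "i < n"
  obtains js where "list_of (v_ahead (Node V (val_of_bits r)) (Node (val_of_nat i) (val_of_box (bx i)))) = map val_of_nat js"
    "set js = ahead {..<n} ((sampled_weights (sample r i))(i := grab_index (bx i))) i"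
proof -
  let ?w = "Node V (val_of_bits r)"
  let ?W = "\<lambda>j. v_surrogate (val_of_box (bx j)) (v_sample ?w (val_of_nat i) (Node (val_of_nat j) (val_of_box (bx j))))"
  have W: "real_val (?W j) = sampled_weights (sample r i) j" if "j < n" for j
    using rational_box.v_surrogate_correct[OF rational_bx[OF that]] v_sample_correct[OF that] by (simp add: sampled_weights_def)
  have a: "real_val (v_grab (val_of_box (bx i))) = grab_index (bx i)"
    by (rule rational_box.v_grab_correct[OF rational_bx[OF assms]])
  let ?P = "\<lambda>j. j \<noteq> i \<and> (grab_index (bx i) < real_val (?W j) \<or> real_val (?W j) = grab_index (bx i) \<and> j < i)"
  have "list_of (v_ahead ?w (Node (val_of_nat i) (val_of_box (bx i)))) = map val_of_nat (filter ?P [0..<n])"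
    unfolding v_ahead_def v_weights_def by (simp add: list_of_V filter_map o_def num_of_compare a)
  moreover have "set (filter ?P [0..<n]) = ahead {..<n} ((sampled_weights (sample r i))(i := grab_index (bx i))) i"
    unfolding ahead_def by (auto simp: W)
  ultimately show thesis by (rule that)
qed

text \<open>Whichever basis the program happens to find decides the span test, by
  \<open>unspanned_basis_iff\<close>.\<close>

lemma v_grabs_correct:
  assumes i: "i < n"
  shows "v_grabs F (Node V (val_of_bits r)) (Node (val_of_nat i) (val_of_box (bx i))) \<longleftrightarrow> grabs i (sample r i)"
proof -
  interpret b: rational_box "bx i" by (rule rational_bx[OF i])
  let ?u = "(sampled_weights (sample r i))(i := grab_index (bx i))"
  let ?A = "v_ahead (Node V (val_of_bits r)) (Node (val_of_nat i) (val_of_box (bx i)))"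
  obtain js where js: "list_of ?A = map val_of_nat js" "set js = ahead {..<n} ?u i"
    using v_ahead_correct[OF i] .
  obtain bs where bs: "vbasis F ?A = val_of_list (map val_of_nat bs)" "basis_of F (set js) (set bs)"
    using vbasis_correct[OF mat js(1)] .
  have "i \<notin> ahead {..<n} ?u i" by (simp add: ahead_def)
  then have "unspanned F (ahead {..<n} ?u i) i \<longleftrightarrow> insert i (set bs) \<in> F"
    using unspanned_basis_iff[OF mat bs(2)] js(2) by simp
  then show ?thesis
    using i by (simp add: v_grabs_def grabs_def greedy_set_def bs(1) answer_insert num_of_compare b.v_open_correct b.v_grab_correct)
qed

definition seed_commitment :: "bool list \<Rightarrow> nat set" where
  "seed_commitment r = opened_by (\<lambda>i. grabs i (sample r i))"

lemma v_commit_correct: "v_commit F (Node V (val_of_bits r)) = val_of_commitment I (seed_commitment r)"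
proof -
  have "map (\<lambda>e. if v_grabs F (Node V (val_of_bits r)) e then Num 0 else Num 1) (list_of (venum V)) =
      map val_of_bool (map (\<lambda>i. i \<in> seed_commitment r) [0..<n])"
    unfolding list_of_V map_map
    by (intro map_cong refl) (simp add: v_grabs_correct seed_commitment_def opened_by_def)
  then show ?thesis by (simp add: v_commit_def vmap_def val_of_commitment_def val_of_bits_def)
qed

end

lemma (in valid_instance) event_facts:
  assumes "valid_history I h" "Opened i x \<in> set h"
  shows "i < n \<and> x \<in> set_pmf (dist_of i) \<and> terminal_value I h i = x"
  using assms
proof (induction rule: valid_history.induct)
  case (valid_Opened h j y)
  show ?case
  proof (cases "Opened i x \<in> set h")
    case True
    then have "i \<noteq> j" using valid_Opened(2) by (auto simp: inspected_def)
    then show ?thesis using valid_Opened(4)[OF True] terminal_value_snoc(1)[of i j h y] by simp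
  next
    case False
    then have "i = j" "x = y" using valid_Opened(5) by auto
    then show ?thesis using valid_Opened(2,3) terminal_value_snoc(4)[of j h y] by simp
  qed
next
  case (valid_Grabbed h j)
  then have h: "Opened i x \<in> set h" by simp
  then have "i \<noteq> j" using valid_Grabbed(2) by (auto simp: inspected_def)
  then show ?case using valid_Grabbed(3)[OF h] terminal_value_snoc(2)[of i j h] by simp
next
  case (valid_Accepted h j)
  then have "Opened i x \<in> set h" by simp
  then show ?case using valid_Accepted(3) terminal_value_snoc(3)[of h j i] by simp
qed simp

lemma (in valid_instance) length_history:
  assumes "valid_history I h"
  shows "length h = card (inspected h) + card (accepted h)" "length h \<le> 2 * n"
proof -
  have fin: "finite (inspected h)" if "valid_history I h" for h
    by (rule finite_subset[OF valid_history_facts(1)[OF that]]) simp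
  have finA: "finite (accepted h)" if "valid_history I h" for h
    by (rule finite_subset[OF valid_history_facts(2)[OF that] fin[OF that]])
  show eq: "length h = card (inspected h) + card (accepted h)"
    using assms
  proof (induction rule: valid_history.induct)
    case (valid_Opened h i x)
    then show ?case using fin[of h] by simp
  next
    case (valid_Grabbed h i)
    then show ?case using fin[of h] by simp
  next
    case (valid_Accepted h i)
    then show ?case using finA[of h] by simp
  qed simp
  have "card (inspected h) \<le> n" using card_mono[OF _ valid_history_facts(1)[OF assms]] by simp
  moreover have "card (accepted h) \<le> card (inspected h)"
    using card_mono[OF fin[OF assms] valid_history_facts(2)[OF assms]] .
  ultimately show "length h \<le> 2 * n" using eq by simp
qed

context rational_valid_instance
begin

abbreviation "H h \<equiv> val_of_list (map val_of_event h)"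

lemma v_accepted_correct: "\<exists>js. v_accepted (H h) = val_of_list (map val_of_nat js) \<and> set js = accepted h"
proof -
  have "\<exists>js. map right_of (filter (\<lambda>e. num_of (left_of e) = num_of (Num 2)) (map val_of_event h)) = map val_of_nat js
      \<and> set js = accepted h"
  proof (induction h)
    case (Cons e h)
    then obtain js where js: "map right_of (filter (\<lambda>e. num_of (left_of e) = num_of (Num 2)) (map val_of_event h)) = map val_of_nat js"
      "set js = accepted h" by blast
    show ?case
    proof (cases e)
      case (Accepted i)
      then show ?thesis using js by (intro exI[of _ "i # js"]) (auto simp: accepted_def)
    qed (use js in \<open>auto intro!: exI[of _ js] simp: accepted_def\<close>)
  qed (simp add: accepted_def)
  then obtain js where js: "map right_of (filter (\<lambda>e. num_of (left_of e) = num_of (Num 2)) (map val_of_event h)) = map val_of_nat js"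
      "set js = accepted h" by blast
  then show ?thesis unfolding v_accepted_def vmap_def list_of_simps list_of_val_of_list
    by (intro exI[of _ js]) simp
qed

lemma v_opened_correct:
  "is_node (v_opened (H h) (val_of_nat i)) \<longleftrightarrow> (\<exists>x. Opened i x \<in> set h)"
  "\<exists>x. Opened i x \<in> set h \<Longrightarrow> \<exists>x. Opened i x \<in> set h \<and>
    right_of (right_of (left_of (v_opened (H h) (val_of_nat i)))) = val_of_real x"
proof -
  let ?l = "list_of (v_opened (H h) (val_of_nat i))"
  have mem: "v \<in> set ?l \<longleftrightarrow> (\<exists>x. Opened i x \<in> set h \<and> v = val_of_event (Opened i x))" for v
  proof
    assume "v \<in> set ?l"
    then obtain e where e: "e \<in> set h" "v = val_of_event e" "num_of (left_of v) = num_of (Num 0)"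
      "num_of (left_of (right_of v)) = num_of (val_of_nat i)" unfolding v_opened_def by auto
    have "\<exists>x. e = Opened i x" by (cases e) (use e(2-4) in \<open>simp_all add: val_of_nat_def\<close>)
    then show "\<exists>x. Opened i x \<in> set h \<and> v = val_of_event (Opened i x)" using e by blast
  qed (force simp: v_opened_def intro: rev_image_eqI)
  show iff: "is_node (v_opened (H h) (val_of_nat i)) \<longleftrightarrow> (\<exists>x. Opened i x \<in> set h)"
  proof -
    have "set ?l = {v. \<exists>x. Opened i x \<in> set h \<and> v = val_of_event (Opened i x)}"
      by (rule set_eqI) (simp only: mem mem_Collect_eq)
    then show ?thesis unfolding is_node_list_of set_empty[symmetric] by (simp only:) auto
  qed
  assume "\<exists>x. Opened i x \<in> set h"
  then have ne: "?l \<noteq> []" using iff is_node_list_of by blast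
  then have "hd ?l \<in> set ?l" by simp
  then obtain x where "Opened i x \<in> set h" "hd ?l = val_of_event (Opened i x)" using mem by blast
  then show "\<exists>x. Opened i x \<in> set h \<and>
    right_of (right_of (left_of (v_opened (H h) (val_of_nat i)))) = val_of_real x"
    using left_of_hd[OF ne] by auto
qed

lemma v_grabbed_correct: "is_node (v_grabbed (H h) (val_of_nat i)) \<longleftrightarrow> Grabbed i \<in> set h"
proof -
  let ?l = "list_of (v_grabbed (H h) (val_of_nat i))"
  have "Grabbed i \<in> set h" if ne: "?l \<noteq> []"
  proof -
    have "hd ?l \<in> set ?l" using ne by simp
    then obtain e where e: "e \<in> set h" "num_of (left_of (val_of_event e)) = num_of (Num 1)"
      "num_of (right_of (val_of_event e)) = num_of (val_of_nat i)" unfolding v_grabbed_def by auto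
    have "e = Grabbed i" by (cases e) (use e(2,3) in \<open>simp_all add: val_of_nat_def\<close>)
    then show ?thesis using e(1) by simp
  qed
  moreover have "?l \<noteq> []" if "Grabbed i \<in> set h"
  proof -
    have "val_of_event (Grabbed i) \<in> set ?l"
      using imageI[OF that, of val_of_event] unfolding v_grabbed_def by simp
    then show ?thesis by force
  qed
  ultimately show ?thesis unfolding is_node_list_of by (rule iffI)
qed

lemma v_flag_correct:
  assumes "i < n"
  shows "v_flag (val_of_commitment I C) (val_of_nat i) = val_of_bool (i \<in> C)"
proof -
  let ?c = "val_of_commitment I C"
  let ?l = "list_of (vfilter (\<lambda>e. num_of (left_of e) = num_of (val_of_nat i)) (venum ?c))"
  have c: "list_of (venum ?c) = map (\<lambda>j. Node (val_of_nat j) (val_of_bool (j \<in> C))) [0..<n]"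
    unfolding list_of_venum by (simp add: val_of_commitment_def val_of_bits_def)
  have l: "set ?l = {Node (val_of_nat i) (val_of_bool (i \<in> C))}"
    using assms by (auto simp: c val_of_nat_def)
  have ne: "?l \<noteq> []"
  proof
    assume "?l = []"
    with l show False by (simp only: list.set) blast
  qed
  then have "hd ?l \<in> set ?l" by (rule hd_in_set)
  then have "hd ?l = Node (val_of_nat i) (val_of_bool (i \<in> C))" unfolding l by (rule singletonD)
  then show ?thesis unfolding v_flag_def left_of_hd[OF ne] by (simp only: right_of.simps)
qed

lemma v_entry_correct:
  assumes h: "valid_history I h" and i: "i < n"
  obtains key where "v_entry (H h) (val_of_commitment I C) (Node (val_of_nat i) (val_of_box (bx i))) =
    Node key (val_of_action (advance C h i))" "real_val key = index C h i"
proof -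
  interpret b: rational_box "bx i" by (rule rational_bx[OF i])
  have flag: "num_of (val_of_bool (i \<in> C)) = num_of (Num 1) \<longleftrightarrow> i \<in> C" by (cases "i \<in> C") auto
  consider (o) "\<exists>x. Opened i x \<in> set h" | (g) "\<not> (\<exists>x. Opened i x \<in> set h)" "Grabbed i \<in> set h"
    | (c) "i \<notin> inspected h" by (auto simp: inspected_def)
  then show thesis
  proof cases
    case o
    obtain x where x: "Opened i x \<in> set h" "right_of (right_of (left_of (v_opened (H h) (val_of_nat i)))) = val_of_real x"
      using v_opened_correct(2)[OF o] by blast
    have "x \<in> \<rat>" "terminal_value I h i = x" using event_facts[OF h x(1)] b.rat(2) by auto
    moreover have "i \<in> inspected h" using x(1) by (auto simp: inspected_def)
    ultimately show thesis using o x(2)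
      by (intro that[of "val_of_real x"]) (simp_all add: v_entry_def v_opened_correct(1) advance_def index_def real_val_of_real)
  next
    case g
    then have "i \<in> inspected h" "terminal_value I h i = mean (bx i)" by (auto simp: inspected_def terminal_value_def)
    then show thesis using g
      by (intro that[of "v_mean (val_of_box (bx i))"])
        (simp_all add: v_entry_def v_opened_correct(1) v_grabbed_correct advance_def index_def b.v_mean_correct)
  next
    case c
    then have "\<not> (\<exists>x. Opened i x \<in> set h)" "Grabbed i \<notin> set h" by (auto simp: inspected_def)
    then show thesis using c i flag
      by (intro that[of "if i \<in> C then v_open (val_of_box (bx i)) else v_mean (val_of_box (bx i))"])
        (simp_all add: v_entry_def v_opened_correct(1) v_grabbed_correct v_flag_correct advance_def index_def
          b.v_mean_correct b.v_open_correct)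
  qed
qed

lemma v_candidate_correct:
  assumes "i < n"
  shows "v_candidate F (H h) (val_of_nat i) \<longleftrightarrow> i \<in> candidates h"
proof -
  obtain js where js: "v_accepted (H h) = val_of_list (map val_of_nat js)" "set js = accepted h"
    using v_accepted_correct by blast
  have "is_node (vfilter (\<lambda>x. num_of x = num_of (val_of_nat i)) (v_accepted (H h))) \<longleftrightarrow> i \<in> accepted h"
    unfolding is_node_list_of js(2)[symmetric] js(1) by (auto simp: filter_empty_conv val_of_nat_def)
  then show ?thesis
    unfolding v_candidate_def using assms by (simp add: js answer_insert candidates_def)
qed

lemma v_act_correct:
  assumes h: "valid_history I h"
  shows "\<exists>a. v_act F (Node V (Node (val_of_bits r) (H h))) = val_of_action a \<and> greedy_step (seed_commitment r) h a"
proof -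
  let ?C = "seed_commitment r"
  let ?e = "\<lambda>i. Node (val_of_nat i) (val_of_box (bx i))"
  let ?entry = "\<lambda>i. v_entry (H h) (val_of_commitment I ?C) (?e i)"
  define cs where "cs = filter (\<lambda>i. i \<in> candidates h) [0..<n]"
  define es where "es = vmap (\<lambda>e. v_entry (H h) (val_of_commitment I ?C) e) (vfilter (\<lambda>e. v_candidate F (H h) (left_of e)) (venum V))"
  have act: "v_act F (Node V (Node (val_of_bits r) (H h))) = (if is_node (vbest es) then right_of (vbest es) else Num 3)"
    unfolding v_act_def v_choice_def es_def by (simp add: v_commit_correct Let_def)
  have set_cs: "set cs = candidates h" unfolding cs_def by (auto simp: candidates_def)
  have "filter (\<lambda>e. v_candidate F (H h) (left_of e)) (list_of (venum V)) = map ?e cs"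
    unfolding list_of_V filter_map cs_def o_def
    by (intro arg_cong[where f="map ?e"] filter_cong refl) (simp add: v_candidate_correct)
  then have es: "list_of es = map ?entry cs" unfolding es_def by simp
  have lt: "i < n" if "i \<in> candidates h" for i using that by (simp add: candidates_def)
  have entry: "\<exists>key. ?entry i = Node key (val_of_action (advance ?C h i)) \<and> real_val key = index ?C h i" if "i \<in> candidates h" for i
    using v_entry_correct[OF h lt[OF that], of ?C] by blast
  show ?thesis
  proof (cases "candidates h = {}")
    case True
    then have "vbest es = Num 0" using set_cs es by (simp add: vbest_def)
    then have "v_act F (Node V (Node (val_of_bits r) (H h))) = val_of_action Stop" unfolding act by simp
    then show ?thesis using True by (intro exI[of _ Stop]) (simp add: greedy_step_def)
  next
    case False
    then have "cs \<noteq> []" using set_cs by auto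
    moreover have "is_node (?entry i)" if "i \<in> candidates h" for i using entry[OF that] by auto
    ultimately have ne: "list_of es \<noteq> []" "\<forall>x\<in>set (list_of es). is_node x"
      unfolding es using set_cs by auto
    obtain i where i: "i \<in> candidates h" "vbest es = ?entry i"
      using vbest_max(1)[OF ne] unfolding es using set_cs by auto
    have "index ?C h j \<le> index ?C h i" if j: "j \<in> candidates h" for j
    proof -
      have "?entry j \<in> set (list_of es)" unfolding es using set_cs j by auto
      then have "real_val (left_of (?entry j)) \<le> real_val (left_of (?entry i))"
        using vbest_max(2)[OF ne] i(2) by auto
      then show ?thesis using entry[OF j] entry[OF i(1)] by auto
    qed
    moreover have "v_act F (Node V (Node (val_of_bits r) (H h))) = val_of_action (advance ?C h i)"
      unfolding act i(2) using entry[OF i(1)] by auto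
    ultimately show ?thesis using i(1) False unfolding greedy_step_def by auto
  qed
qed

text \<open>Read off the output of the program, whose behaviour is known on valid histories; on all
  others the choice is arbitrary.\<close>

definition seed_policy :: "bool list \<Rightarrow> policy" where
  "seed_policy r h = (SOME a. v_act F (Node V (Node (val_of_bits r) (H h))) = val_of_action a \<and>
     greedy_step (seed_commitment r) h a)"

lemma seed_policy:
  assumes "valid_history I h"
  shows "v_act F (Node V (Node (val_of_bits r) (H h))) = val_of_action (seed_policy r h)"
    "greedy_step (seed_commitment r) h (seed_policy r h)"
  using someI_ex[OF v_act_correct[OF assms]] unfolding seed_policy_def by auto

subsection \<open>Sizes\<close>

abbreviation "N \<equiv> val_size V"

lemma n_le_N: "n \<le> N"
  using length_list_of[of V] by (simp add: val_of_pboi_def)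

lemma val_size_box:
  assumes "i < n"
  shows "val_size (val_of_box (bx i)) \<le> N"
  using assms by (intro val_size_list_of) (auto simp: val_of_pboi_def)

lemma val_size_atom:
  assumes "i < n" "x \<in> set_pmf (dist_of i)"
  shows "val_size (Node (val_of_real x) (val_of_real (pmf (dist_of i) x))) \<le> N"
proof -
  interpret b: rational_box "bx i" by (rule rational_bx[OF assms(1)])
  have "b.atom x \<in> set (list_of (right_of (val_of_box (bx i))))"
    unfolding b.list_of_box using assms(2) b.support(1) by auto
  from val_size_list_of[OF this] show ?thesis
    using val_size_right[of "val_of_box (bx i)"] val_size_box[OF assms(1)] by linarith
qed

text \<open>A positive rational whose denominator has at most \<open>N\<close> bits is at least
  \<open>1 / 2 ^ N\<close>. This ties the number of flips to the input size.\<close>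

lemma pmf_lower_bound:
  assumes "i < n" "x \<in> set_pmf (dist_of i)"
  shows "1 / 2 ^ N \<le> pmf (dist_of i) x"
proof -
  interpret b: rational_box "bx i" by (rule rational_bx[OF assms(1)])
  let ?v = "val_of_real (pmf (dist_of i) x)"
  have "val_size ?v \<le> Suc N" using val_size_atom[OF assms] by simp
  then obtain p d where pd: "d > 0" "num_of ?v = of_int p / of_int d" "d < 2 ^ N"
    by (rule val_size_Num_D)
  have "real_val ?v = pmf (dist_of i) x" using b.rat(3) by (intro real_val_of_real) auto
  then have eq: "pmf (dist_of i) x = of_int p / of_int d"
    unfolding real_val_def pd(2) by (simp add: of_rat_divide)
  then have "0 < real_of_int p / of_int d" using assms(2) by (simp flip: eq add: pmf_positive)
  then have p: "1 \<le> p" using pd(1) by (simp add: zero_less_divide_iff)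
  have "real_of_int d \<le> 2 ^ N" using pd(3) by (metis less_imp_le of_int_le_iff of_int_numeral of_int_power)
  then have "1 / 2 ^ N \<le> 1 / real_of_int d" using pd(1) by (intro divide_left_mono) auto
  also have "\<dots> \<le> of_int p / of_int d" using p pd(1) by (intro divide_right_mono) auto
  finally show ?thesis unfolding eq .
qed

lemma val_size_bits: "val_size (val_of_bits r) \<le> 2 + 4 * length r"
  unfolding val_of_bits_def
  using val_size_val_of_list[of "map val_of_bool r" 3] val_size_bool by force

lemma val_size_history:
  assumes "valid_history I h"
  shows "val_size (H h) \<le> 2 + 2 * N * (7 + 2 * N)"
proof -
  have "val_size v \<le> 6 + 2 * N" if v: "v \<in> set (map val_of_event h)" for v
  proof -
    obtain e where e: "e \<in> set h" "v = val_of_event e" using v by auto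
    have nat: "val_size (val_of_nat i) \<le> 2 + N" if "i < n" for i
      using val_size_val_of_nat[of i] that n_le_N by linarith
    have small: "val_size (Num 0) \<le> 2" "val_size (Num 1) \<le> 3" "val_size (Num 2) \<le> 4"
      using val_size_val_of_nat[of 0] val_size_val_of_nat[of 1] val_size_val_of_nat[of 2]
      by (simp_all add: val_of_nat_def)
    show ?thesis
    proof (cases e)
      case (Opened i x)
      then have "i < n" "x \<in> set_pmf (dist_of i)" using event_facts[OF assms] e(1) by auto
      then show ?thesis using val_size_atom[of i x] nat[of i] small(1) Opened e(2) by simp
    next
      case (Grabbed i)
      then have "i \<in> inspected h" using e(1) by (auto simp: inspected_def)
      then have "i < n" using valid_history_facts(1)[OF assms] by auto
      then show ?thesis using nat[of i] small(2) Grabbed e(2) by simp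
    next
      case (Accepted i)
      then have "i \<in> inspected h" using e(1) valid_history_facts(2)[OF assms] by (auto simp: accepted_def)
      then have "i < n" using valid_history_facts(1)[OF assms] by auto
      then show ?thesis using nat[of i] small(3) val_size_ge_2[of V] Accepted e(2) by simp
    qed
  qed
  then have "val_size (H h) \<le> 2 + length (map val_of_event h) * (1 + (6 + 2 * N))"
    by (rule val_size_val_of_list)
  also have "\<dots> \<le> 2 + 2 * N * (1 + (6 + 2 * N))"
    using length_history(2)[OF assms] n_le_N by (intro add_left_mono mult_right_mono) auto
  finally show ?thesis by simp
qed

subsection \<open>The distribution of the commitment\<close>

lemma grabs_cong:
  assumes "\<And>j. j < n \<Longrightarrow> xs j = ys j" "i < n"
  shows "grabs i xs \<longleftrightarrow> grabs i ys"
proof -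
  have "ahead {..<n} ((sampled_weights xs)(i := a)) i = ahead {..<n} ((sampled_weights ys)(i := a)) i" for a
    using assms(1) by (auto simp: ahead_def sampled_weights_def)
  then show ?thesis unfolding grabs_def greedy_set_def by simp
qed

text \<open>The flips are cut at two levels, into a chunk for each deciding box and then a block for
  each sampled box, which matches the offset \<open>(i * n + j) * block r\<close> of the
  program.\<close>

lemma expect_seed_commitment:
  defines "P \<equiv> \<lambda>k j. map_pmf (\<lambda>s. quantile (dist_of j) (binary_fraction (rev s))) (flips k)"
  shows "expect (flips L) (\<lambda>r. commitment_value (seed_commitment r)) =
    expect (grab_flags (P (L div (n * n)))) (\<lambda>g. commitment_value (opened_by g))"
proof -
  define k where "k = L div (n * n)"
  define e where "e = L mod (n * n)"
  let ?q = "\<lambda>j s. quantile (dist_of j) (binary_fraction (rev s))"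
  let ?S = "\<lambda>s j. if j < n then ?q j (chunk k j s) else 0"
  have L: "L = n * (n * k) + e" unfolding k_def e_def by (metis mult.assoc mult_div_mod_eq)
  have "Pi_pmf {..<n} 0 (P k) = map_pmf (\<lambda>g j. if j \<in> {..<n} then ?q j (g j) else 0) (Pi_pmf {..<n} [] (\<lambda>_. flips k))"
    unfolding P_def by (rule Pi_pmf_map_dependent) simp
  also have "\<dots> = map_pmf ?S (flips (n * k))"
    unfolding flips_chunks[of n k 0, symmetric] pmf.map_comp
    by (simp add: o_def cong: if_cong) 
  finally have S: "Pi_pmf {..<n} 0 (P k) = map_pmf ?S (flips (n * k))" .
  have "grab_flags (P k) = map_pmf (\<lambda>g i. if i \<in> {..<n} then grabs i (?S (g i)) else False) (Pi_pmf {..<n} [] (\<lambda>_. flips (n * k)))"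
    unfolding grab_flags_def S pmf.map_comp by (subst Pi_pmf_map_dependent[where d="[]"]) (simp_all add: o_def)
  also have "\<dots> = map_pmf (\<lambda>r i. if i < n then grabs i (?S (chunk (n * k) i r)) else False) (flips L)"
    unfolding L flips_chunks[of n "n * k" e, symmetric] pmf.map_comp
    by (simp add: o_def cong: if_cong)
  finally have "expect (grab_flags (P k)) (\<lambda>g. commitment_value (opened_by g)) =
      expect (flips L) (\<lambda>r. commitment_value (opened_by (\<lambda>i. if i < n then grabs i (?S (chunk (n * k) i r)) else False)))"
    by simp
  also have "\<dots> = expect (flips L) (\<lambda>r. commitment_value (seed_commitment r))"
  proof (rule expect_cong)
    fix r assume "r \<in> set_pmf (flips L)"
    then have block: "block r = k" by (simp add: set_flips block_def k_def)
    have "?S (chunk (n * k) i r) j = sample r i j" if "j < n" for i j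
    proof -
      have "j * k + k \<le> n * k" using that mult_le_mono1[of "Suc j" n k] by simp
      then have "chunk k j (chunk (n * k) i r) = take k (drop ((i * n + j) * k) r)"
        by (simp add: chunk_def drop_take algebra_simps)
      then show ?thesis using that by (simp add: sample_def block)
    qed
    then have "grabs i (?S (chunk (n * k) i r)) \<longleftrightarrow> grabs i (sample r i)" if "i < n" for i
      using that by (intro grabs_cong) auto
    then show "commitment_value (opened_by (\<lambda>i. if i < n then grabs i (?S (chunk (n * k) i r)) else False)) =
        commitment_value (seed_commitment r)"
      unfolding seed_commitment_def by (intro arg_cong[where f=commitment_value]) (auto simp: opened_by_def)
  qed
  finally show ?thesis unfolding k_def by simp
qed

text \<open>For \<open>n > 0\<close>, as \<open>n \<le> N\<close>, each draw receives at least
  \<open>3 * N + 6\<close> flips and its relative error is at most \<open>1 / (64 * 4 ^ N)\<close>.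
  There are at most \<open>4 ^ N\<close> draws, so Bernoulli's inequality leaves a factor of at
  least 63/64.\<close>

lemma seed_commitment_guarantee:
  assumes L: "L = N\<^sup>2 * (3 * N + 6)"
  shows "0.582 * OPT I \<le> expect (flips L) (\<lambda>r. commitment_value (seed_commitment r))"
proof -
  define k where "k = L div (n * n)"
  \<comment> \<open>For \<open>n = 0\<close> the division gives \<open>k = 0\<close> and the formula
    would be negative; nothing is drawn then, so the factor is 1.\<close>
  define c :: real where "c = (if n = 0 then 1 else 1 - 2 ^ N / 2 ^ k)"
  define P where "P = (\<lambda>j. map_pmf (\<lambda>s. quantile (dist_of j) (binary_fraction (rev s))) (flips k))"
  have c: "0 \<le> c \<and> 63 / 64 \<le> (c ^ n) ^ n"
  proof (cases "n = 0")
    case False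
    have "n * n * (3 * N + 6) \<le> L"
      unfolding L power2_eq_square using n_le_N by (intro mult_right_mono mult_le_mono) auto
    then have "n * n * (3 * N + 6) div (n * n) \<le> k" unfolding k_def by (rule div_le_mono)
    then have k: "3 * N + 6 \<le> k" using False by simp
    have "(2::real) ^ N / 2 ^ k \<le> 2 ^ N / 2 ^ (3 * N + 6)"
      using k by (intro divide_left_mono power_increasing) auto
    also have "(2::real) ^ (3 * N + 6) = 2 ^ (N + N + N + 6)" by (rule arg_cong[where f="power 2"]) simp
    also have "(2::real) ^ N / 2 ^ (N + N + N + 6) = 1 / (64 * (2 ^ N * 2 ^ N))" unfolding power_add by simp
    finally have small: "(2::real) ^ N / 2 ^ k \<le> 1 / (64 * (2 ^ N * 2 ^ N))" .
    have "real n < 2 ^ N" using n_le_N less_exp[of N] by (metis le_less_trans of_nat_less_iff of_nat_numeral of_nat_power)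
    then have nn: "real (n * n) \<le> 2 ^ N * 2 ^ N" by (simp add: mult_mono)
    have "real (n * n) * (2 ^ N / 2 ^ k) \<le> (2 ^ N * 2 ^ N) * (1 / (64 * (2 ^ N * 2 ^ N)))"
      using small nn by (intro mult_mono) auto
    then have b: "real (n * n) * (2 ^ N / 2 ^ k) \<le> 1 / 64" by simp
    have "1 \<le> real (n * n)" using False by (metis One_nat_def Suc_leI mult_pos_pos neq0_conv of_nat_1 of_nat_le_iff)
    then have "1 * (2 ^ N / 2 ^ k) \<le> real (n * n) * (2 ^ N / 2 ^ k)" by (intro mult_right_mono) auto
    then have le: "2 ^ N / 2 ^ k \<le> (1 :: real)" using b by linarith
    have "1 + real (n * n) * (- (2 ^ N / 2 ^ k)) \<le> (1 + (- (2 ^ N / 2 ^ k))) ^ (n * n)"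
      using le by (intro Bernoulli_inequality) simp
    moreover have "real (n * n) * (- (2 ^ N / 2 ^ k)) = - (real (n * n) * (2 ^ N / 2 ^ k))" by simp
    moreover have "(c ^ n) ^ n = (1 + (- (2 ^ N / 2 ^ k))) ^ (n * n)" using False by (simp add: c_def power_mult)
    moreover have "0 \<le> c" using le False by (simp add: c_def)
    ultimately show ?thesis using b by linarith
  qed (simp add: c_def)
  have "(c ^ n) ^ n * (1 - 1 / (1 + 1 / real 5) ^ 5) * OPT I \<le> expect (grab_flags P) (\<lambda>g. commitment_value (opened_by g))"
  proof (rule approximate_commitment)
    fix i assume i: "i < n"
    then have "n \<noteq> 0" by linarith
    then have "c = 1 - 2 ^ N / 2 ^ k" unfolding c_def by (rule if_not_P)
    then show "finite (set_pmf (P i)) \<and> (\<forall>x\<in>set_pmf (dist_of i). c * pmf (dist_of i) x \<le> pmf (P i) x)"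
      unfolding P_def using finite_flips pmf_quantile[OF finite_dist[OF i] _ pmf_lower_bound[OF i]] by auto
  qed (use c in auto)
  also have "\<dots> = expect (flips L) (\<lambda>r. commitment_value (seed_commitment r))"
    unfolding P_def k_def expect_seed_commitment ..
  finally have main: "(c ^ n) ^ n * (1 - 1 / (1 + 1 / real 5) ^ 5) * OPT I \<le> expect (flips L) (\<lambda>r. commitment_value (seed_commitment r))" .
  show ?thesis
  proof (cases "0 \<le> OPT I")
    case True
    have "63 / 64 * (1 - 1 / (1 + 1 / real 5) ^ 5) \<le> (c ^ n) ^ n * (1 - 1 / (1 + 1 / real 5) ^ 5)"
      using c by (intro mult_right_mono) (auto simp: power_divide)
    \<comment> \<open>The gap factor for five rounds is about 0.5981, and 63/64 of it about
      0.5887.\<close>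
    moreover have "0.582 \<le> 63 / 64 * (1 - 1 / (1 + 1 / real 5) ^ 5)" by (simp add: power_divide)
    ultimately have "0.582 \<le> (c ^ n) ^ n * (1 - 1 / (1 + 1 / real 5) ^ 5)" by linarith
    then have "0.582 * OPT I \<le> (c ^ n) ^ n * (1 - 1 / (1 + 1 / real 5) ^ 5) * OPT I"
      using True by (rule mult_right_mono)
    then show ?thesis using main by linarith
  next
    \<comment> \<open>A negative optimum would be trivial, as the value of a commitment is
      nonnegative.\<close>
    case False
    have "0 \<le> expect (flips L) (\<lambda>r. commitment_value (seed_commitment r))"
      by (intro integral_nonneg_AE AE_I2 commitment_value_nonneg)
    then show ?thesis using False by simp
  qed
qed

end

section \<open>Assembly: exact sampling in general, coin flips for rational data\<close>

section \<open>The randomized committing policy\<close>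

text \<open>Supplies the nonnegative indices that the index policy requires of opened boxes: a box
  whose open index lies below its grab index is always grabbed.\<close>

lemma (in valid_instance) not_grabs_open_index:
  assumes "i < n" "\<not> grabs i xs"
  shows "0 \<le> open_index (bx i)"
proof -
  have "grab_index (bx i) \<le> open_index (bx i)" using assms(2) by (simp add: grabs_def not_less)
  then show ?thesis using finite_box.grab_index_nonneg[OF finite_bx[OF assms(1)]] by linarith
qed

lemma (in valid_instance) greedy_step_exists: "\<exists>a. greedy_step C h a"
proof (cases "candidates h = {}")
  case False
  have fin: "finite (candidates h)" by (simp add: candidates_def)
  have "Max (index C h ` candidates h) \<in> index C h ` candidates h" using fin False by (intro Max_in) auto
  then obtain i where i: "i \<in> candidates h" "index C h i = Max (index C h ` candidates h)" by auto
  have "\<forall>j\<in>candidates h. index C h j \<le> index C h i" unfolding i(2) using fin by auto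
  then show ?thesis using i(1) False by (intro exI[of _ "advance C h i"]) (auto simp: greedy_step_def)
qed (simp add: greedy_step_def)

text \<open>For arbitrary real data the exact distributions are sampled, which is
  \<open>approximate_commitment\<close> with \<open>c = 1\<close>.\<close>

lemma (in valid_instance) committing_policy_exists:
  "\<exists>P. committing_policy I P \<and> 0.582 * OPT I \<le> rand_utility I (map_pmf snd P)"
proof -
  define p where "p C = (\<lambda>h. SOME a. greedy_step C h a)" for C
  have p: "greedy_step C h (p C h)" for C h unfolding p_def by (rule someI_ex[OF greedy_step_exists])
  define G where "G = grab_flags dist_of"
  have fin: "finite (set_pmf G)"
    unfolding G_def grab_flags_def using finite_samples by (intro finite_set_Pi_pmf) auto
  define P where "P = map_pmf (\<lambda>g. (opened_by g, p (opened_by g))) G"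
  have "committing_policy I P"
    unfolding committing_policy_def P_def using greedy_policy(1,2)[OF p] by (auto simp: opened_by_def)
  moreover have "0.582 * OPT I \<le> rand_utility I (map_pmf snd P)"
  proof -
    have "expect G (\<lambda>g. commitment_value (opened_by g)) \<le> expect G (\<lambda>g. expected_utility I (p (opened_by g)))"
    proof (rule expect_mono[OF fin])
      fix g assume g: "g \<in> set_pmf G"
      show "commitment_value (opened_by g) \<le> expected_utility I (p (opened_by g))"
      proof (rule greedy_policy(4)[OF p])
        fix i assume "i \<in> opened_by g"
        then have i: "i < n" "\<not> g i" by (auto simp: opened_by_def)
        then have "g i \<in> set_pmf (map_pmf (grabs i) samples)"
          using g unfolding G_def grab_flags_def by (auto simp: set_Pi_pmf PiE_dflt_def)
        then show "0 \<le> open_index (bx i)" using i not_grabs_open_index by auto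
      qed
    qed
    also have "\<dots> = rand_utility I (map_pmf snd P)" by (simp add: P_def rand_utility_def)
    finally have le: "expect G (\<lambda>g. commitment_value (opened_by g)) \<le> rand_utility I (map_pmf snd P)" .
    show ?thesis
    proof (cases "0 \<le> OPT I")
      case True
      have "0.582 \<le> 1 - 1 / (1 + 1 / real 5) ^ 5" by (simp add: power_divide)
      then have "0.582 * OPT I \<le> (1 - 1 / (1 + 1 / real 5) ^ 5) * OPT I" using True by (rule mult_right_mono)
      also have "\<dots> = (1 ^ n) ^ n * (1 - 1 / (1 + 1 / real 5) ^ 5) * OPT I" by simp
      also have "\<dots> \<le> expect G (\<lambda>g. commitment_value (opened_by g))"
        unfolding G_def by (rule approximate_commitment) (auto simp: finite_dist)
      finally show ?thesis using le by (rule order_trans)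
    next
      case False
      have "0 \<le> expect G (\<lambda>g. commitment_value (opened_by g))"
        by (intro integral_nonneg_AE AE_I2 commitment_value_nonneg)
      moreover have "0.582 * OPT I \<le> 0" using False by simp
      ultimately show ?thesis using le by (meson order_trans)
    qed
  qed
  ultimately show ?thesis by blast
qed

context rational_valid_instance
begin

lemma seed_policy_valid:
  "is_policy I (seed_policy r)" "adheres I (seed_commitment r) (seed_policy r)"
  "h \<in> reachable I (seed_policy r) \<Longrightarrow> valid_history I h"
  "commitment_value (seed_commitment r) \<le> expected_utility I (seed_policy r)"
proof -
  show "is_policy I (seed_policy r)" "adheres I (seed_commitment r) (seed_policy r)"
    "h \<in> reachable I (seed_policy r) \<Longrightarrow> valid_history I h"
    using greedy_policy(1-3)[OF seed_policy(2)] by auto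
  show "commitment_value (seed_commitment r) \<le> expected_utility I (seed_policy r)"
    by (rule greedy_policy(4)[OF seed_policy(2)])
      (auto simp: seed_commitment_def opened_by_def intro: not_grabs_open_index)
qed

definition seed_length :: nat where
  "seed_length = N\<^sup>2 * (3 * N + 6)"

definition seed_distribution :: "(nat set \<times> policy) pmf" where
  "seed_distribution = map_pmf (\<lambda>r. (seed_commitment r, seed_policy r)) (pmf_of_set {r. length r = seed_length})"

lemma seed_distribution:
  "committing_policy I seed_distribution" "0.582 * OPT I \<le> rand_utility I (map_pmf snd seed_distribution)"
proof -
  show "committing_policy I seed_distribution"
    unfolding committing_policy_def seed_distribution_def
    using seed_policy_valid(1,2) by (auto simp: seed_commitment_def opened_by_def)
  have "0.582 * OPT I \<le> expect (flips seed_length) (\<lambda>r. commitment_value (seed_commitment r))"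
    by (rule seed_commitment_guarantee[OF seed_length_def])
  also have "\<dots> \<le> expect (flips seed_length) (\<lambda>r. expected_utility I (seed_policy r))"
    by (rule expect_mono[OF finite_flips seed_policy_valid(4)])
  also have "\<dots> = rand_utility I (map_pmf snd seed_distribution)"
    by (simp add: rand_utility_def seed_distribution_def flips_def)
  finally show "0.582 * OPT I \<le> rand_utility I (map_pmf snd seed_distribution)" .
qed

end

text \<open>The factor 4 is the size of one encoded flip together with its list cell; the rest is
  the seed length and the instance.\<close>

definition commit_size :: "nat \<Rightarrow> nat" where
  "commit_size x = 3 + x + 4 * (x\<^sup>2 * (3 * x + 6))"

definition act_size :: "nat \<Rightarrow> nat" where
  "act_size x = commit_size x + (3 + 2 * x * (7 + 2 * x))"

lemma (in rational_valid_instance) input_sizes: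
  assumes "length r = seed_length"
  shows "val_size (Node V (val_of_bits r)) \<le> commit_size N"
    "valid_history I h \<Longrightarrow> val_size (Node V (Node (val_of_bits r) (H h))) \<le> act_size N"
  using val_size_bits[of r] val_size_history[of h] assms
  by (simp_all add: commit_size_def act_size_def seed_length_def)

lemma polytime:
  assumes R: "\<And>I. pboi_instance I \<Longrightarrow> rational_instance I \<Longrightarrow> R I = rational_valid_instance.seed_distribution I"
  shows "polytime_policy R"
proof -
  obtain c1 k1 where c1: "\<forall>F v T. val_size v ^ k1 \<le> T \<longrightarrow> computes_within F c1 T v (v_commit F v)"
    using ptime_computes_within[OF ptime_programs(1)] .
  obtain c2 k2 where c2: "\<forall>F v T. val_size v ^ k2 \<le> T \<longrightarrow> computes_within F c2 T v (v_act F v)"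
    using ptime_computes_within[OF ptime_programs(2)] .
  have "poly_bounded (\<lambda>x. commit_size x ^ k1 + act_size x ^ k2)"
    unfolding commit_size_def act_size_def by (intro poly_bounded_intros)
  then obtain k where k: "\<And>x. 2 \<le> x \<Longrightarrow> commit_size x ^ k1 + act_size x ^ k2 \<le> x ^ k"
    unfolding poly_bounded_def by blast
  \<comment> \<open>\<open>[:0, 0, 6, 3:]\<close> lists the coefficients of
    \<open>x\<^sup>2 * (3 * x + 6)\<close> in ascending order, the seed length.\<close>
  have main: "\<exists>C p. R I = map_pmf (\<lambda>r. (C r, p r)) (pmf_of_set {r. length r = poly [:0, 0, 6, 3:] (val_size (val_of_pboi I))}) \<and>
      (\<forall>r\<in>{r. length r = poly [:0, 0, 6, 3:] (val_size (val_of_pboi I))}.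
         computes_within (indep I) c1 (poly (monom 1 k) (val_size (val_of_pboi I)))
           (Node (val_of_pboi I) (val_of_bits r)) (val_of_commitment I (C r)) \<and>
         (\<forall>h\<in>reachable I (p r).
            computes_within (indep I) c2 (poly (monom 1 k) (val_size (val_of_pboi I)))
              (Node (val_of_pboi I) (Node (val_of_bits r) (val_of_list (map val_of_event h))))
              (val_of_action (p r h))))"
    if I: "pboi_instance I" "rational_instance I" for I
  proof -
    interpret rational_valid_instance I by unfold_locales (fact I)+
    have len: "poly [:0, 0, 6, 3:] N = seed_length"
      by (simp add: seed_length_def power2_eq_square algebra_simps)
    have time: "poly (monom 1 k) N = N ^ k" by (simp add: poly_monom)
    have kN: "commit_size N ^ k1 + act_size N ^ k2 \<le> N ^ k" by (rule k[OF val_size_ge_2])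
    show ?thesis unfolding len time
    proof (intro exI[of _ seed_commitment] exI[of _ seed_policy] conjI ballI)
      show "R I = map_pmf (\<lambda>r. (seed_commitment r, seed_policy r)) (pmf_of_set {r. length r = seed_length})"
        unfolding R[OF I] by (rule seed_distribution_def)
      fix r :: "bool list" assume "r \<in> {r. length r = seed_length}"
      then have r: "length r = seed_length" by simp
      have "val_size (Node V (val_of_bits r)) ^ k1 \<le> commit_size N ^ k1"
        by (rule power_mono[OF input_sizes(1)[OF r]]) simp
      then have "val_size (Node V (val_of_bits r)) ^ k1 \<le> N ^ k" using kN by linarith
      then have "computes_within F c1 (N ^ k) (Node V (val_of_bits r)) (v_commit F (Node V (val_of_bits r)))"
        using c1 by blast
      then show "computes_within F c1 (N ^ k) (Node V (val_of_bits r)) (val_of_commitment I (seed_commitment r))"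
        unfolding v_commit_correct .
      fix h assume "h \<in> reachable I (seed_policy r)"
      then have h: "valid_history I h" by (rule seed_policy_valid(3))
      have "val_size (Node V (Node (val_of_bits r) (H h))) ^ k2 \<le> act_size N ^ k2"
        by (rule power_mono[OF input_sizes(2)[OF r h]]) simp
      then have "val_size (Node V (Node (val_of_bits r) (H h))) ^ k2 \<le> N ^ k" using kN by linarith
      then have "computes_within F c2 (N ^ k) (Node V (Node (val_of_bits r) (H h))) (v_act F (Node V (Node (val_of_bits r) (H h))))"
        using c2 by blast
      then show "computes_within F c2 (N ^ k) (Node V (Node (val_of_bits r) (H h))) (val_of_action (seed_policy r h))"
        unfolding seed_policy(1)[OF h] .
    qed
  qed
  show ?thesis unfolding polytime_policy_def Let_def
    by (intro exI[of _ c1] exI[of _ c2] exI[of _ "[:0, 0, 6, 3:]"] exI[of _ "monom 1 k"] allI impI main) auto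
qed

theorem theorem9:
  shows "\<exists>R :: pboi \<Rightarrow> (nat set \<times> policy) pmf.
    polytime_policy R \<and>
    (\<forall>I. pboi_instance I \<longrightarrow>
       committing_policy I (R I) \<and>
       rand_utility I (map_pmf snd (R I)) \<ge> 0.582 * OPT I)"
proof -
  \<comment> \<open>\<open>polytime_policy\<close> constrains \<open>R\<close> on rational instances
    only, so the two constructions can be glued together.\<close>
  define R where "R I = (if rational_instance I then rational_valid_instance.seed_distribution I
    else SOME P. committing_policy I P \<and> 0.582 * OPT I \<le> rand_utility I (map_pmf snd P))" for I
  have "committing_policy I (R I) \<and> 0.582 * OPT I \<le> rand_utility I (map_pmf snd (R I))"
    if I: "pboi_instance I" for I
  proof (cases "rational_instance I")
    case True
    interpret rational_valid_instance I by unfold_locales (fact I True)+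
    show ?thesis using True seed_distribution by (simp add: R_def)
  next
    case False
    interpret valid_instance I by unfold_locales (fact I)
    show ?thesis using someI_ex[OF committing_policy_exists] False by (simp add: R_def)
  qed
  moreover have "polytime_policy R" by (rule polytime) (simp add: R_def)
  ultimately show ?thesis by blast
qed

end
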